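(* Let $U=\langle U_\varepsilon\rangle\subseteq\widetilde{\mathbb{R}}^n$ be a non-empty strongly internal set. Let $N\in\mathbb{N}$ be such that for some $x=[x_\varepsilon]\in U$ one has $d(x_\varepsilon,U_\varepsilon^c)>\varepsilon^N$ and $|x_\varepsilon|\le\varepsilon^{-N}$ for $\varepsilon$ small. For $j\in\mathbb{N}$, $j\ge N$, set $K_{j\varepsilon}:=\{x\in\mathbb{R}^n : d(x,U_\varepsilon^c)\ge\varepsilon^j,\ |x|\le\varepsilon^{-j}\}$ and $K_j:=[K_{j\varepsilon}]$. Then: (i) $K_j\subseteq U$ is non-empty and functionally compact for all $j\ge N$; (ii) $K_j\subseteq K_{j+1}$ for all $j\ge N$; (iii) $U=\bigcup_{j\ge N}K_j$; (iv) for every non-empty functionally compact $K\subseteq U$ there exists some $j\ge N$ such that $K\subseteq K_j$; (v) $\mathcal{GD}(U)$ is the strict inductive limit of the family $(\mathcal{GD}_{K_j}(U))_{j\ge N}$: $\mathcal{GD}(U)=\varinjlim_{j\ge N}\mathcal{GD}_{K_j}(U)$.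
   Context: Generalized numbers: $I=(0,1]$; nets are indexed by $\varepsilon\in I$; "for $\varepsilon$ small" means for all $\varepsilon\in(0,\varepsilon_0]$ for some $\varepsilon_0\in I$. A net $(x_\varepsilon)$ in $\mathbb{R}^n$ is moderate if $|x_\varepsilon|=O(\varepsilon^{-N})$ as $\varepsilon\to0$ for some $N\in\mathbb{N}$; $(x_\varepsilon)\sim(y_\varepsilon)$ iff $|x_\varepsilon-y_\varepsilon|=O(\varepsilon^m)$ for all $m\in\mathbb{N}$. $\widetilde{\mathbb{R}}^n$ is the set of classes $[x_\varepsilon]$ of moderate nets in $\mathbb{R}^n$; $\widetilde{\mathbb{R}}$ is a ring. $x\le y$ iff there are representatives with $x_\varepsilon\le y_\varepsilon$ for $\varepsilon$ small; $x<y$ means $x\le y$ and $y-x$ invertible. $|[x_\varepsilon]|:=[|x_\varepsilon|]$, $\mathrm{d}\varepsilon^q:=[\varepsilon^q]$. The sharp topology on $\widetilde{\mathbb{R}}^n$ is generated by the balls $\{y : |y-x|<\rho\}$, $\rho\in\widetilde{\mathbb{R}}_{>0}$. $v([x_\varepsilon]):=\sup\{b\in\mathbb{R} : |x_\varepsilon|=O(\varepsilon^b)\}$ and $|x|_e:=e^{-v(x)}$ for $x\in\widetilde{\mathbb{R}}$. Sets: for a net $(A_\varepsilon)$ of subsets of $\mathbb{R}^n$, $[A_\varepsilon]:=\{[x_\varepsilon] : x_\varepsilon\in A_\varepsilon\text{ for }\varepsilon\text{ small}\}$ (internal set) and $\langle A_\varepsilon\rangle$ (strongly internal set) is the set of $[x_\varepsilon]$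 such that for every representative one has $x_\varepsilon\in A_\varepsilon$ for $\varepsilon$ small; strongly internal sets are sharply open. $A^c=\mathbb{R}^n\setminus A$, $d(x,A)$ is Euclidean distance, $d(x,\emptyset)=+\infty$. $K\subseteq\widetilde{\mathbb{R}}^n$ is functionally compact if $K=[K_\varepsilon]$ for a net of compact sets $K_\varepsilon\subseteq\mathbb{R}^n$ with $\sup_{x\in K_\varepsilon}|x|\le\varepsilon^{-M}$ for $\varepsilon$ small, for some $M\in\mathbb{R}_{>0}$. Generalized smooth functions: $f:X\to Y$ ($X\subseteq\widetilde{\mathbb{R}}^n$, $Y\subseteq\widetilde{\mathbb{R}}^d$) is in $\mathcal{G}^\infty(X,Y)$ if there is a net $u_\varepsilon\in C^\infty(\Omega_\varepsilon,\mathbb{R}^d)$ ($\Omega_\varepsilon$ open) defining $f$: $X\subseteq\langle\Omega_\varepsilon\rangle$, $f([x_\varepsilon])=[u_\varepsilon(x_\varepsilon)]\in Y$ and $(\partial^\alpha u_\varepsilon(x_\varepsilon))$ moderate for all $[x_\varepsilon]\in X$, $\alpha\in\mathbb{N}^n$. If $X$ is sharply open, $\partial^\alpha f([x_\varepsilon]):=[\partial^\alpha u_\varepsilon(x_\varepsilon)]$ is independent of the defining net. Compact supports: $\mathrm{ext}(K):=\{x : \forall a\in K,\ |x-a|>0\}$. For non-empty functionally compact $K\subseteq U$, $\mathcal{GD}_K(U)$ is the set of $f\in\mathcal{G}^\infty(U,\widetilde{\mathbb{R}})$ having a defining net $u_\varepsilon\in C^\infty(\mathbb{R}^n,\mathbb{R})$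 with $[\partial^\alpha u_\varepsilon(x_\varepsilon)]=0$ for all $\alpha\in\mathbb{N}^n$ and $[x_\varepsilon]\in\mathrm{ext}(K)$; $\mathcal{GD}(U):=\bigcup_K\mathcal{GD}_K(U)$ over all non-empty functionally compact $K\subseteq U$ (an $\widetilde{\mathbb{R}}$-module for such $U$). $\|f\|_m:=\max_{|\alpha|\le m}\max_{x\in K}|\partial^\alpha f(x)|\in\widetilde{\mathbb{R}}$ for $f\in\mathcal{GD}_K(U)$ (the maximum exists and does not depend on $K$). The sharp topology $\sigma_K$ on $\mathcal{GD}_K(U)$: $V$ is open iff for every $v\in V$ there are $m\in\mathbb{N}$, $\rho\in\widetilde{\mathbb{R}}_{>0}$ with $\{g\in\mathcal{GD}_K(U) : \|g-v\|_m<\rho\}\subseteq V$. Locally convex $\widetilde{\mathbb{R}}$-modules (Garetto): a subset $A$ of an $\widetilde{\mathbb{R}}$-module is $\widetilde{\mathbb{R}}$-balanced if $\lambda A\subseteq A$ whenever $|\lambda|_e\le1$; $\widetilde{\mathbb{R}}$-convex if $A+A\subseteq A$ and $\mathrm{d}\varepsilon^bA\subseteq A$ for all real $b\ge0$; absolutely $\widetilde{\mathbb{R}}$-convex if both. A locally convex topological $\widetilde{\mathbb{R}}$-module is a topological $\widetilde{\mathbb{R}}$-module ($\widetilde{\mathbb{R}}$ with the sharp topology) having a base of $\widetilde{\mathbb{R}}$-convex neighborhoods of $0$. If an $\widetilde{\mathbb{R}}$-module $\mathcal{G}$ is spanned by the images of $\widetilde{\mathbb{R}}$-linear maps $i_\gamma:\mathcal{G}_\gamma\to\mathcal{G}$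 from locally convex topological $\widetilde{\mathbb{R}}$-modules, the inductive limit topology on $\mathcal{G}$ is the finest $\widetilde{\mathbb{R}}$-locally convex topology making all $i_\gamma$ continuous (neighborhood base of $0$: the absolutely $\widetilde{\mathbb{R}}$-convex $V$ with every $i_\gamma^{-1}(V)$ a neighborhood of $0$). $\mathcal{GD}(U)$ carries the inductive limit topology with respect to all inclusions $\mathcal{GD}_K(U)\hookrightarrow\mathcal{GD}(U)$, $K$ non-empty functionally compact in $U$. An inductive limit of an increasing sequence $(\mathcal{G}_j)$ with $\mathcal{G}=\bigcup_j\mathcal{G}_j$ is strict if the topology of each $\mathcal{G}_j$ is the one induced by $\mathcal{G}_{j+1}$; (v) asserts that $(\mathcal{GD}_{K_j}(U))_{j\ge N}$ is such a sequence with union $\mathcal{GD}(U)$ and that the corresponding inductive limit topology is the given topology of $\mathcal{GD}(U)$. *)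

theory Defs
  imports
    "HOL-Analysis.Analysis"
    "HOL-Library.Landau_Symbols"
    "HOL-Library.Function_Algebras"
begin

section \<open>Generalized numbers\<close>

text \<open>
  A net indexed by \<open>(0,1]\<close> is a function on the reals of which only the values on \<open>(0,1]\<close> matter.
  ``For \<open>\<epsilon>\<close> small'' is \<^term>\<open>eventually P (at_right (0::real))\<close>.
\<close>

definition moderate :: "(real \<Rightarrow> 'a::real_normed_vector) \<Rightarrow> bool" where
  "moderate x \<longleftrightarrow> (\<exists>N::nat. (\<lambda>\<epsilon>. norm (x \<epsilon>)) \<in> O[at_right 0](\<lambda>\<epsilon>. 1 / \<epsilon> ^ N))"

definition negligible_net :: "(real \<Rightarrow> 'a::real_normed_vector) \<Rightarrow> bool" where
  "negligible_net x \<longleftrightarrow> (\<forall>m::nat. (\<lambda>\<epsilon>. norm (x \<epsilon>)) \<in> O[at_right 0](\<lambda>\<epsilon>. \<epsilon> ^ m))"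

lemma eventually_unit_interval: "eventually (\<lambda>\<epsilon>::real. 0 < \<epsilon> \<and> \<epsilon> < 1) (at_right 0)"
  by (auto simp: eventually_at_right_field intro: exI[of _ 1])

lemma bigo_inverse_power_mono:
  assumes "f \<in> O[at_right 0](\<lambda>\<epsilon>::real. 1 / \<epsilon> ^ N :: real)" and "N \<le> M"
  shows "f \<in> O[at_right 0](\<lambda>\<epsilon>. 1 / \<epsilon> ^ M)"
proof -
  have "(\<lambda>\<epsilon>::real. 1 / \<epsilon> ^ N) \<in> O[at_right 0](\<lambda>\<epsilon>. 1 / \<epsilon> ^ M)"
  proof (rule bigoI[where c = 1])
    show "\<forall>\<^sub>F \<epsilon>::real in at_right 0. norm (1 / \<epsilon> ^ N) \<le> 1 * norm (1 / \<epsilon> ^ M)"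
      using eventually_unit_interval
      by eventually_elim (use assms(2) in \<open>auto simp: frac_le power_decreasing\<close>)
  qed
  with assms(1) show ?thesis by (rule landau_o.big_trans)
qed

lemma moderate_const: "moderate (\<lambda>_. c)"
  unfolding moderate_def
  by (rule exI[of _ 0]) simp

lemma moderate_dominated:
  assumes "moderate x" "moderate y" "\<And>\<epsilon>. norm (z \<epsilon>) \<le> norm (x \<epsilon>) + norm (y \<epsilon>)"
  shows "moderate z"
proof -
  obtain N M where
    N: "(\<lambda>\<epsilon>. norm (x \<epsilon>)) \<in> O[at_right 0](\<lambda>\<epsilon>. 1 / \<epsilon> ^ N)" and
    M: "(\<lambda>\<epsilon>. norm (y \<epsilon>)) \<in> O[at_right 0](\<lambda>\<epsilon>. 1 / \<epsilon> ^ M)"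
    using assms(1,2) by (auto simp: moderate_def)
  have "(\<lambda>\<epsilon>. norm (x \<epsilon>) + norm (y \<epsilon>)) \<in> O[at_right 0](\<lambda>\<epsilon>. 1 / \<epsilon> ^ max N M)"
    by (intro sum_in_bigo bigo_inverse_power_mono[OF N] bigo_inverse_power_mono[OF M]) auto
  moreover have "(\<lambda>\<epsilon>. norm (z \<epsilon>)) \<in> O[at_right 0](\<lambda>\<epsilon>. norm (x \<epsilon>) + norm (y \<epsilon>))"
    by (rule bigoI[where c = 1]) (use assms(3) in auto)
  ultimately show ?thesis
    unfolding moderate_def by (blast intro: landau_o.big_trans)
qed

lemma moderate_add: "moderate x \<Longrightarrow> moderate y \<Longrightarrow> moderate (\<lambda>\<epsilon>. x \<epsilon> + y \<epsilon>)"
  by (rule moderate_dominated[of x y]) (auto intro: norm_triangle_ineq)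

lemma moderate_uminus: "moderate x \<Longrightarrow> moderate (\<lambda>\<epsilon>. - x \<epsilon>)"
  by (simp add: moderate_def)

lemma moderate_diff: "moderate x \<Longrightarrow> moderate y \<Longrightarrow> moderate (\<lambda>\<epsilon>. x \<epsilon> - y \<epsilon>)"
  by (rule moderate_dominated[of x y]) (auto intro: norm_triangle_ineq4)

lemma moderate_norm: "moderate x \<Longrightarrow> moderate (\<lambda>\<epsilon>. norm (x \<epsilon>))"
  by (simp add: moderate_def)

lemma moderate_mult:
  fixes x y :: "real \<Rightarrow> 'a::real_normed_field"
  assumes "moderate x" "moderate y"
  shows "moderate (\<lambda>\<epsilon>. x \<epsilon> * y \<epsilon>)"
proof -
  obtain N M where
    N: "(\<lambda>\<epsilon>. norm (x \<epsilon>)) \<in> O[at_right 0](\<lambda>\<epsilon>. 1 / \<epsilon> ^ N)" and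
    M: "(\<lambda>\<epsilon>. norm (y \<epsilon>)) \<in> O[at_right 0](\<lambda>\<epsilon>. 1 / \<epsilon> ^ M)"
    using assms by (auto simp: moderate_def)
  from landau_o.big.mult[OF N M]
  have "(\<lambda>\<epsilon>. norm (x \<epsilon> * y \<epsilon>)) \<in> O[at_right 0](\<lambda>\<epsilon>. 1 / \<epsilon> ^ (N + M))"
    by (simp add: norm_mult power_add)
  then show ?thesis unfolding moderate_def by blast
qed

lemma negligible_net_zero: "negligible_net (\<lambda>_. 0)"
  by (simp add: negligible_net_def)

lemma negligible_net_dominated:
  assumes "negligible_net x" "negligible_net y" "\<And>\<epsilon>. norm (z \<epsilon>) \<le> norm (x \<epsilon>) + norm (y \<epsilon>)"
  shows "negligible_net z"
  unfolding negligible_net_def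
proof
  fix m
  have "(\<lambda>\<epsilon>. norm (x \<epsilon>) + norm (y \<epsilon>)) \<in> O[at_right 0](\<lambda>\<epsilon>. \<epsilon> ^ m)"
    using assms(1,2) by (auto simp: negligible_net_def intro: sum_in_bigo)
  moreover have "(\<lambda>\<epsilon>. norm (z \<epsilon>)) \<in> O[at_right 0](\<lambda>\<epsilon>. norm (x \<epsilon>) + norm (y \<epsilon>))"
    by (rule bigoI[where c = 1]) (use assms(3) in auto)
  ultimately show "(\<lambda>\<epsilon>. norm (z \<epsilon>)) \<in> O[at_right 0](\<lambda>\<epsilon>. \<epsilon> ^ m)"
    by (blast intro: landau_o.big_trans)
qed

lemma negligible_net_add:
  "negligible_net x \<Longrightarrow> negligible_net y \<Longrightarrow> negligible_net (\<lambda>\<epsilon>. x \<epsilon> + y \<epsilon>)"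
  by (rule negligible_net_dominated[of x y]) (auto intro: norm_triangle_ineq)

lemma negligible_net_uminus: "negligible_net x \<Longrightarrow> negligible_net (\<lambda>\<epsilon>. - x \<epsilon>)"
  by (simp add: negligible_net_def)

lemma negligible_net_mult:
  fixes x y :: "real \<Rightarrow> 'a::real_normed_field"
  assumes "negligible_net x" "moderate y"
  shows "negligible_net (\<lambda>\<epsilon>. x \<epsilon> * y \<epsilon>)"
  unfolding negligible_net_def
proof
  fix m
  obtain M where M: "(\<lambda>\<epsilon>. norm (y \<epsilon>)) \<in> O[at_right 0](\<lambda>\<epsilon>. 1 / \<epsilon> ^ M)"
    using assms(2) by (auto simp: moderate_def)
  have "(\<lambda>\<epsilon>. norm (x \<epsilon>)) \<in> O[at_right 0](\<lambda>\<epsilon>. \<epsilon> ^ (m + M))"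
    using assms(1) unfolding negligible_net_def by blast
  from landau_o.big.mult[OF this M]
  have "(\<lambda>\<epsilon>. norm (x \<epsilon> * y \<epsilon>)) \<in> O[at_right 0](\<lambda>\<epsilon>. \<epsilon> ^ (m + M) * (1 / \<epsilon> ^ M))"
    by (simp add: norm_mult)
  also have "O[at_right 0](\<lambda>\<epsilon>::real. \<epsilon> ^ (m + M) * (1 / \<epsilon> ^ M)) = O[at_right 0](\<lambda>\<epsilon>. \<epsilon> ^ m)"
    by (rule landau_o.big.cong, use eventually_unit_interval in eventually_elim)
      (auto simp: power_add)
  finally show "(\<lambda>\<epsilon>. norm (x \<epsilon> * y \<epsilon>)) \<in> O[at_right 0](\<lambda>\<epsilon>. \<epsilon> ^ m)" .
qed

definition gen_rel :: "(real \<Rightarrow> 'a::real_normed_vector) \<Rightarrow> (real \<Rightarrow> 'a) \<Rightarrow> bool" where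
  "gen_rel x y \<longleftrightarrow> moderate x \<and> moderate y \<and> negligible_net (\<lambda>\<epsilon>. x \<epsilon> - y \<epsilon>)"

lemma gen_rel_part_equivp: "part_equivp (gen_rel :: (real \<Rightarrow> 'a::real_normed_vector) \<Rightarrow> _)"
proof (rule part_equivpI)
  show "\<exists>x::real \<Rightarrow> 'a. gen_rel x x"
    by (rule exI[of _ "\<lambda>_. 0"]) (simp add: gen_rel_def moderate_const negligible_net_zero)
  show "symp (gen_rel :: (real \<Rightarrow> 'a) \<Rightarrow> _)"
    by (rule sympI) (use negligible_net_uminus in \<open>fastforce simp: gen_rel_def\<close>)
  show "transp (gen_rel :: (real \<Rightarrow> 'a) \<Rightarrow> _)"
  proof (rule transpI)
    fix x y z :: "real \<Rightarrow> 'a"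
    assume "gen_rel x y" "gen_rel y z"
    then show "gen_rel x z"
      using negligible_net_add[of "\<lambda>\<epsilon>. x \<epsilon> - y \<epsilon>" "\<lambda>\<epsilon>. y \<epsilon> - z \<epsilon>"] by (simp add: gen_rel_def)
  qed
qed

text \<open>
  \<open>real gen\<close> is the ring of generalized real numbers and \<open>(real ^ 'n) gen\<close> is the
  space of \<open>n\<close>-dimensional generalized points; \<open>abs_gen x\<close> is the class of a moderate net \<open>x\<close>
  (it is unspecified if \<open>x\<close> is not moderate).
\<close>

quotient_type (overloaded) 'a gen = "real \<Rightarrow> 'a::real_normed_vector" / partial: gen_rel
  by (rule gen_rel_part_equivp)

definition represents :: "(real \<Rightarrow> 'a::real_normed_vector) \<Rightarrow> 'a gen \<Rightarrow> bool" where
  "represents \<xi> x \<longleftrightarrow> moderate \<xi> \<and> abs_gen \<xi> = x"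

instantiation gen :: (real_normed_vector) ab_group_add
begin

lift_definition zero_gen :: "'a gen" is "\<lambda>_. 0"
  by (simp add: gen_rel_def moderate_const negligible_net_zero)

lift_definition plus_gen :: "'a gen \<Rightarrow> 'a gen \<Rightarrow> 'a gen" is "\<lambda>x y \<epsilon>. x \<epsilon> + y \<epsilon>"
  subgoal for x x' y y'
    using negligible_net_add[of "\<lambda>\<epsilon>. x \<epsilon> - x' \<epsilon>" "\<lambda>\<epsilon>. y \<epsilon> - y' \<epsilon>"]
    by (auto simp: gen_rel_def moderate_add algebra_simps)
  done

lift_definition uminus_gen :: "'a gen \<Rightarrow> 'a gen" is "\<lambda>x \<epsilon>. - x \<epsilon>"
  subgoal for x x'
    using negligible_net_uminus[of "\<lambda>\<epsilon>. x \<epsilon> - x' \<epsilon>"]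
    by (auto simp: gen_rel_def moderate_uminus)
  done

lift_definition minus_gen :: "'a gen \<Rightarrow> 'a gen \<Rightarrow> 'a gen" is "\<lambda>x y \<epsilon>. x \<epsilon> - y \<epsilon>"
  subgoal for x x' y y'
    using negligible_net_add[of "\<lambda>\<epsilon>. x \<epsilon> - x' \<epsilon>" "\<lambda>\<epsilon>. - (y \<epsilon> - y' \<epsilon>)"]
      negligible_net_uminus[of "\<lambda>\<epsilon>. y \<epsilon> - y' \<epsilon>"]
    by (auto simp: gen_rel_def moderate_diff algebra_simps)
  done

instance
  by standard
    (transfer; simp add: gen_rel_def algebra_simps moderate_const moderate_add moderate_uminus
      moderate_diff negligible_net_zero)+

end

instantiation gen :: (real_normed_field) comm_ring_1
begin

lift_definition one_gen :: "'a gen" is "\<lambda>_. 1"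
  by (simp add: gen_rel_def moderate_const negligible_net_zero)

lift_definition times_gen :: "'a gen \<Rightarrow> 'a gen \<Rightarrow> 'a gen" is "\<lambda>x y \<epsilon>. x \<epsilon> * y \<epsilon>"
  subgoal for x x' y y'
    using negligible_net_add[of "\<lambda>\<epsilon>. (x \<epsilon> - x' \<epsilon>) * y \<epsilon>" "\<lambda>\<epsilon>. (y \<epsilon> - y' \<epsilon>) * x' \<epsilon>"]
      negligible_net_mult[of "\<lambda>\<epsilon>. x \<epsilon> - x' \<epsilon>" y] negligible_net_mult[of "\<lambda>\<epsilon>. y \<epsilon> - y' \<epsilon>" x']
    by (auto simp: gen_rel_def moderate_mult algebra_simps)
  done

instance
proof
  show "(0::'a gen) \<noteq> 1"
  proof (transfer, rule notI)
    assume "gen_rel (\<lambda>_. 0::'a) (\<lambda>_. 1)"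
    then have "(\<lambda>\<epsilon>::real. 1::real) \<in> O[at_right 0](\<lambda>\<epsilon>. \<epsilon> ^ 1)"
      by (auto simp: gen_rel_def negligible_net_def dest: spec[of _ 1])
    then obtain c where c: "c > 0" "eventually (\<lambda>\<epsilon>::real. 1 \<le> c * \<bar>\<epsilon>\<bar>) (at_right 0)"
      by (auto elim!: landau_o.bigE)
    have "eventually (\<lambda>\<epsilon>::real. 0 < \<epsilon> \<and> \<epsilon> < 1 / c) (at_right 0)"
      using c(1) by (auto simp: eventually_at_right_field intro!: exI[of _ "1 / c"])
    with c(2) have "eventually (\<lambda>\<epsilon>::real. False) (at_right 0)"
      by eventually_elim (use c(1) in \<open>auto simp: field_simps\<close>)
    then show False by simp
  qed
qed (transfer; simp add: gen_rel_def algebra_simps moderate_const moderate_add moderate_mult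
      negligible_net_zero)+

end

lift_definition gabs :: "'a::real_normed_vector gen \<Rightarrow> real gen" is "\<lambda>x \<epsilon>. norm (x \<epsilon>)"
proof -
  fix x y :: "real \<Rightarrow> 'a" assume *: "gen_rel x y"
  have "negligible_net (\<lambda>\<epsilon>. norm (x \<epsilon>) - norm (y \<epsilon>))"
    by (rule negligible_net_dominated[of "\<lambda>\<epsilon>. x \<epsilon> - y \<epsilon>" "\<lambda>_. 0"])
      (use * in \<open>auto simp: gen_rel_def negligible_net_zero norm_triangle_ineq3\<close>)
  with * show "gen_rel (\<lambda>\<epsilon>. norm (x \<epsilon>)) (\<lambda>\<epsilon>. norm (y \<epsilon>))"
    by (simp add: gen_rel_def moderate_norm)
qed

text \<open>
  The order is only partial, and \<open>x < y\<close> requires \<open>y - x\<close> to be invertible, which is stronger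
  than \<open>x \<le> y \<and> x \<noteq> y\<close>. Hence \<open>gen\<close> is made an instance of the syntactic class \<open>ord\<close> only.
\<close>

instantiation gen :: ("{real_normed_field, ord}") ord
begin

definition less_eq_gen :: "'a gen \<Rightarrow> 'a gen \<Rightarrow> bool" where
  "x \<le> y \<longleftrightarrow> (\<exists>\<xi> \<eta>. represents \<xi> x \<and> represents \<eta> y \<and> (\<forall>\<^sub>F \<epsilon> in at_right 0. \<xi> \<epsilon> \<le> \<eta> \<epsilon>))"

definition less_gen :: "'a gen \<Rightarrow> 'a gen \<Rightarrow> bool" where
  "(x :: 'a gen) < y \<longleftrightarrow> x \<le> y \<and> (y - x) dvd 1"

instance ..

end

text \<open>The sharp topology.\<close>

instantiation gen :: (real_normed_vector) topological_space
begin

definition open_gen :: "'a gen set \<Rightarrow> bool" where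
  "open_gen = generate_topology {{y. gabs (y - x) < \<rho>} |x \<rho>. 0 < \<rho>}"

instance
  by standard (auto simp: open_gen_def intro: generate_topology.intros)

end

definition deps :: "real \<Rightarrow> real gen" where
  "deps q = abs_gen (\<lambda>\<epsilon>. \<epsilon> powr q)"

definition greatest_element :: "real gen set \<Rightarrow> real gen" where
  "greatest_element S = (THE r. r \<in> S \<and> (\<forall>t\<in>S. t \<le> r))"

text \<open>
  The maximum of a finite family of generalized numbers is taken \<open>\<epsilon>\<close>-wise (it is the supremum
  of the family, but need not be one of its members); the result does not depend on the
  representatives.
\<close>

definition finite_gmax :: "'i set \<Rightarrow> ('i \<Rightarrow> real gen) \<Rightarrow> real gen" where
  "finite_gmax F a = abs_gen (\<lambda>\<epsilon>. MAX i\<in>F. rep_gen (a i) \<epsilon>)"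


section \<open>Internal, strongly internal and functionally compact sets\<close>

definition internal_set :: "(real \<Rightarrow> 'a::real_normed_vector set) \<Rightarrow> 'a gen set" where
  "internal_set A = {x. \<exists>\<xi>. represents \<xi> x \<and> (\<forall>\<^sub>F \<epsilon> in at_right 0. \<xi> \<epsilon> \<in> A \<epsilon>)}"

definition strongly_internal_set :: "(real \<Rightarrow> 'a::real_normed_vector set) \<Rightarrow> 'a gen set" where
  "strongly_internal_set A = {x. \<forall>\<xi>. represents \<xi> x \<longrightarrow> (\<forall>\<^sub>F \<epsilon> in at_right 0. \<xi> \<epsilon> \<in> A \<epsilon>)}"

text \<open>Unlike \<^const>\<open>infdist\<close>, the distance to the empty set is infinite.\<close>

definition set_dist :: "'a::metric_space \<Rightarrow> 'a set \<Rightarrow> ereal" where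
  "set_dist x A = (INF a\<in>A. ereal (dist x a))"

definition functionally_compact :: "'a::real_normed_vector gen set \<Rightarrow> bool" where
  "functionally_compact K \<longleftrightarrow>
    (\<exists>Ke. (\<forall>\<epsilon>\<in>{0<..1}. compact (Ke \<epsilon>)) \<and> K = internal_set Ke \<and>
      (\<exists>M>0. \<forall>\<^sub>F \<epsilon> in at_right 0. \<forall>x\<in>Ke \<epsilon>. norm x \<le> \<epsilon> powr (- M)))"

definition ext :: "'a::real_normed_vector gen set \<Rightarrow> 'a gen set" where
  "ext K = {x. \<forall>a\<in>K. 0 < gabs (x - a)}"


section \<open>Generalized smooth functions\<close>

definition partial_deriv :: "'n \<Rightarrow> (real ^ 'n \<Rightarrow> 'b::real_normed_vector) \<Rightarrow> real ^ 'n \<Rightarrow> 'b" where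
  "partial_deriv i u x = frechet_derivative u (at x) (axis i 1)"

primrec iter_partial :: "'n list \<Rightarrow> (real ^ 'n \<Rightarrow> 'b::real_normed_vector) \<Rightarrow> real ^ 'n \<Rightarrow> 'b" where
  "iter_partial [] u = u"
| "iter_partial (i # is) u = partial_deriv i (iter_partial is u)"

text \<open>
  For open \<open>\<Omega>\<close> this is \<open>C\<^sup>\<infinity>\<close>: total differentiability of all iterated partial derivatives includes
  their continuity.
\<close>

definition smooth_on :: "(real ^ 'n) set \<Rightarrow> (real ^ 'n \<Rightarrow> 'b::real_normed_vector) \<Rightarrow> bool" where
  "smooth_on \<Omega> u \<longleftrightarrow> (\<forall>is. \<forall>x\<in>\<Omega>. iter_partial is u differentiable (at x))"

text \<open>
  The multi-index derivative \<open>\<partial>\<^sup>\<alpha>\<close> differentiates \<open>\<alpha> i\<close> times in each direction \<open>i\<close>, in some order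
  depending on \<open>\<alpha>\<close> only; on smooth functions the order is irrelevant.
\<close>

definition multi_deriv ::
    "('n \<Rightarrow> nat) \<Rightarrow> (real ^ 'n \<Rightarrow> 'b::real_normed_vector) \<Rightarrow> real ^ 'n \<Rightarrow> 'b" where
  "multi_deriv \<alpha> u = iter_partial (SOME is. \<forall>i. count_list is i = \<alpha> i) u"

definition defining_net ::
    "(real \<Rightarrow> (real ^ 'n) set) \<Rightarrow> (real \<Rightarrow> real ^ 'n \<Rightarrow> 'b::real_normed_vector) \<Rightarrow>
      (real ^ 'n) gen set \<Rightarrow> ((real ^ 'n) gen \<Rightarrow> 'b gen) \<Rightarrow> bool" where
  "defining_net \<Omega> u X f \<longleftrightarrow>
    (\<forall>\<epsilon>\<in>{0<..1}. open (\<Omega> \<epsilon>) \<and> smooth_on (\<Omega> \<epsilon>) (u \<epsilon>)) \<and>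
    X \<subseteq> strongly_internal_set \<Omega> \<and>
    (\<forall>x\<in>X. \<forall>\<xi>. represents \<xi> x \<longrightarrow>
      represents (\<lambda>\<epsilon>. u \<epsilon> (\<xi> \<epsilon>)) (f x) \<and>
      (\<forall>\<alpha>. moderate (\<lambda>\<epsilon>. multi_deriv \<alpha> (u \<epsilon>) (\<xi> \<epsilon>))))"

text \<open>
  A function with domain \<open>X\<close> is represented by the total function that vanishes outside \<open>X\<close>, so that
  the pointwise operations on total functions give the module operations.
\<close>

definition gsf ::
    "(real ^ 'n) gen set \<Rightarrow> 'b gen set \<Rightarrow> ((real ^ 'n) gen \<Rightarrow> 'b::real_normed_vector gen) set" where
  "gsf X Y = {f. f ` X \<subseteq> Y \<and> (\<forall>x. x \<notin> X \<longrightarrow> f x = 0) \<and> (\<exists>\<Omega> u. defining_net \<Omega> u X f)}"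

text \<open>Meaningful for sharply open \<open>X\<close>, \<open>f \<in> gsf X Y\<close> and \<open>x \<in> X\<close>.\<close>

definition gderiv ::
    "(real ^ 'n) gen set \<Rightarrow> ('n \<Rightarrow> nat) \<Rightarrow> ((real ^ 'n) gen \<Rightarrow> 'b::real_normed_vector gen) \<Rightarrow>
      (real ^ 'n) gen \<Rightarrow> 'b gen" where
  "gderiv X \<alpha> f x =
    (THE y. \<exists>\<Omega> u \<xi>. defining_net \<Omega> u X f \<and> represents \<xi> x \<and>
      y = abs_gen (\<lambda>\<epsilon>. multi_deriv \<alpha> (u \<epsilon>) (\<xi> \<epsilon>)))"


section \<open>Compactly supported generalized smooth functions\<close>

definition GD_on ::
    "(real ^ 'n) gen set \<Rightarrow> (real ^ 'n) gen set \<Rightarrow> ((real ^ 'n) gen \<Rightarrow> real gen) set" where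
  "GD_on U K = {f \<in> gsf U UNIV. \<exists>u. defining_net (\<lambda>_. UNIV) u U f \<and>
    (\<forall>x\<in>ext K. \<forall>\<xi>. represents \<xi> x \<longrightarrow>
      (\<forall>\<alpha>. represents (\<lambda>\<epsilon>. multi_deriv \<alpha> (u \<epsilon>) (\<xi> \<epsilon>)) 0))}"

definition fcompacts :: "(real ^ 'n) gen set \<Rightarrow> (real ^ 'n) gen set set" where
  "fcompacts U = {K. K \<noteq> {} \<and> functionally_compact K \<and> K \<subseteq> U}"

definition GD :: "(real ^ 'n) gen set \<Rightarrow> ((real ^ 'n) gen \<Rightarrow> real gen) set" where
  "GD U = (\<Union>K\<in>fcompacts U. GD_on U K)"

definition GD_norm ::
    "(real ^ 'n) gen set \<Rightarrow> (real ^ 'n) gen set \<Rightarrow> nat \<Rightarrow> ((real ^ 'n) gen \<Rightarrow> real gen) \<Rightarrow> real gen" where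
  "GD_norm U K m f =
    finite_gmax {\<alpha>. (\<Sum>i\<in>UNIV. \<alpha> i) \<le> m} (\<lambda>\<alpha>. greatest_element ((\<lambda>x. gabs (gderiv U \<alpha> f x)) ` K))"

definition GD_on_topology ::
    "(real ^ 'n) gen set \<Rightarrow> (real ^ 'n) gen set \<Rightarrow> ((real ^ 'n) gen \<Rightarrow> real gen) topology" where
  "GD_on_topology U K = topology (\<lambda>V. V \<subseteq> GD_on U K \<and>
    (\<forall>v\<in>V. \<exists>m \<rho>. 0 < \<rho> \<and> {g \<in> GD_on U K. GD_norm U K m (g - v) < \<rho>} \<subseteq> V))"


section \<open>Locally convex topological modules over the generalized numbers\<close>

text \<open>
  Modules are submodules of an ambient type with scalar multiplication \<open>s\<close>; a topology on \<open>M\<close> is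
  a \<^typ>\<open>'b topology\<close> with carrier \<open>M\<close>. The scalars carry the sharp topology.
\<close>

definition topological_gmodule ::
    "(real gen \<Rightarrow> 'b::ab_group_add \<Rightarrow> 'b) \<Rightarrow> 'b set \<Rightarrow> 'b topology \<Rightarrow> bool" where
  "topological_gmodule s M T \<longleftrightarrow>
    module s \<and> module.subspace s M \<and> topspace T = M \<and>
    continuous_map (prod_topology T T) T (\<lambda>(x, y). x + y) \<and>
    continuous_map (prod_topology euclidean T) T (\<lambda>(c, x). s c x)"

definition gconvex :: "(real gen \<Rightarrow> 'b::ab_group_add \<Rightarrow> 'b) \<Rightarrow> 'b set \<Rightarrow> bool" where
  "gconvex s A \<longleftrightarrow> (\<forall>x\<in>A. \<forall>y\<in>A. x + y \<in> A) \<and> (\<forall>b\<ge>0. s (deps b) ` A \<subseteq> A)"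

definition locally_convex_gmodule ::
    "(real gen \<Rightarrow> 'b::ab_group_add \<Rightarrow> 'b) \<Rightarrow> 'b set \<Rightarrow> 'b topology \<Rightarrow> bool" where
  "locally_convex_gmodule s M T \<longleftrightarrow>
    topological_gmodule s M T \<and>
    (\<forall>W. openin T W \<and> 0 \<in> W \<longrightarrow>
      (\<exists>V\<subseteq>W. gconvex s V \<and> (\<exists>O'. openin T O' \<and> 0 \<in> O' \<and> O' \<subseteq> V)))"

definition glinear_on ::
    "(real gen \<Rightarrow> 'b::ab_group_add \<Rightarrow> 'b) \<Rightarrow> (real gen \<Rightarrow> 'c::ab_group_add \<Rightarrow> 'c) \<Rightarrow>
      'b set \<Rightarrow> ('b \<Rightarrow> 'c) \<Rightarrow> bool" where
  "glinear_on s s' M i \<longleftrightarrow>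
    (\<forall>x\<in>M. \<forall>y\<in>M. i (x + y) = i x + i y) \<and> (\<forall>c. \<forall>x\<in>M. i (s c x) = s' c (i x))"

text \<open>
  \<open>T\<close> is the inductive limit topology on \<open>M\<close> with respect to the maps \<open>i \<gamma>\<close> from the locally
  convex modules \<open>G \<gamma>\<close> with topologies \<open>T\<^sub>G \<gamma>\<close>: the finest locally convex topology that
  makes all of them continuous.
\<close>

definition is_inductive_limit_topology ::
    "(real gen \<Rightarrow> 'b::ab_group_add \<Rightarrow> 'b) \<Rightarrow> (real gen \<Rightarrow> 'c::ab_group_add \<Rightarrow> 'c) \<Rightarrow>
      'i set \<Rightarrow> ('i \<Rightarrow> 'b set) \<Rightarrow> ('i \<Rightarrow> 'b topology) \<Rightarrow> ('i \<Rightarrow> 'b \<Rightarrow> 'c) \<Rightarrow>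
      'c set \<Rightarrow> 'c topology \<Rightarrow> bool" where
  "is_inductive_limit_topology s s' \<Gamma> G T\<^sub>G i M T \<longleftrightarrow>
    (\<forall>\<gamma>\<in>\<Gamma>. locally_convex_gmodule s (G \<gamma>) (T\<^sub>G \<gamma>) \<and> glinear_on s s' (G \<gamma>) (i \<gamma>)) \<and>
    M = module.span s' (\<Union>\<gamma>\<in>\<Gamma>. i \<gamma> ` G \<gamma>) \<and>
    locally_convex_gmodule s' M T \<and> (\<forall>\<gamma>\<in>\<Gamma>. continuous_map (T\<^sub>G \<gamma>) T (i \<gamma>)) \<and>
    (\<forall>T'. locally_convex_gmodule s' M T' \<and> (\<forall>\<gamma>\<in>\<Gamma>. continuous_map (T\<^sub>G \<gamma>) T' (i \<gamma>)) \<longrightarrow>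
      (\<forall>V. openin T' V \<longrightarrow> openin T V))"

definition is_strict_inductive_limit ::
    "(real gen \<Rightarrow> 'b::ab_group_add \<Rightarrow> 'b) \<Rightarrow> nat \<Rightarrow> (nat \<Rightarrow> 'b set) \<Rightarrow> (nat \<Rightarrow> 'b topology) \<Rightarrow>
      'b set \<Rightarrow> 'b topology \<Rightarrow> bool" where
  "is_strict_inductive_limit s N G T\<^sub>G M T \<longleftrightarrow>
    (\<forall>j\<ge>N. G j \<subseteq> G (Suc j) \<and> T\<^sub>G j = subtopology (T\<^sub>G (Suc j)) (G j)) \<and>
    M = (\<Union>j\<in>{N..}. G j) \<and>
    is_inductive_limit_topology s s {N..} G T\<^sub>G (\<lambda>_ x. x) M T"

definition fscale :: "real gen \<Rightarrow> ('x \<Rightarrow> real gen) \<Rightarrow> 'x \<Rightarrow> real gen" where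
  "fscale c f = (\<lambda>x. c * f x)"

definition GD_topology ::
    "(real ^ 'n) gen set \<Rightarrow> ((real ^ 'n) gen \<Rightarrow> real gen) topology" where
  "GD_topology U = (THE T. is_inductive_limit_topology fscale fscale
    (fcompacts U) (GD_on U) (GD_on_topology U) (\<lambda>_ f. f) (GD U) T)"

end

theory Submission
  imports Defs
begin

text \<open>
  A point of a strongly internal set has distance at least \<open>\<epsilon>\<^sup>m\<close> from the complement, since otherwise points
  of the complement could be glued into one of its representatives; the same gluing applied to a net of
  compact sets gives (iv), and (iii) is (iv) for singletons.

  For (v), the point is that the seminorms do not depend on \<open>K\<close>: a derivative of \<open>f \<in> GD\<^sub>K(U)\<close> that is
  \<open>O(\<epsilon>\<^sup>q)\<close> on \<open>K\<close> is \<open>O(\<epsilon>\<^sup>q)\<close> on all of \<open>U\<close>. Hence all the spaces \<open>GD\<^sub>K(U)\<close> carry the topology induced by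
  one system of additive subgroups, which gives strictness. By (iv) the sequence is cofinal among all
  functionally compact subsets, so both families have the same inductive limit.
\<close>

section \<open>Generalized numbers\<close>

text \<open>The order on \<open>real gen\<close> is only partial: a number that fails to be small
  need not be large, since a net may be small along one sequence of parameters and large along
  another. Failures are therefore only available on a set S of parameters accumulating at 0, and the
  gluing consists in continuing the bad values on S by harmless values off S, so that a moderate net
  results.

  Sizes are measured by the additive groups \<open>bigo_gen q\<close> of classes that are
  O(\<epsilon>^q), not by balls. They form a base of sharp neighborhoods of 0, and they turn convex
  neighborhoods into subgroups stable under bounded scalars, so that all topologies involved are
  linear topologies.

  Three notions are descriptions that need a uniqueness proof before they can be used:
  \<open>multi_deriv\<close> (order of differentiation), \<open>gderiv\<close> (choice of the
  defining net) and \<open>GD_topology\<close>. The first rests on Schwarz' theorem, the second on a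
  bound for a first derivative by the function and its second derivative, the third on the universal
  property.\<close>

lemma gen_rel_refl_iff: "gen_rel x x \<longleftrightarrow> moderate x"
  by (simp add: gen_rel_def negligible_net_zero)

lemma represents_abs: "moderate \<xi> \<Longrightarrow> represents \<xi> (abs_gen \<xi>)"
  by (simp add: represents_def)

lemma represents_rep: "represents (rep_gen x) x"
  using Quotient3_abs_rep[OF Quotient3_gen] Quotient3_rep_reflp[OF Quotient3_gen]
  by (auto simp: represents_def gen_rel_refl_iff)

lemma represents_moderate: "represents \<xi> x \<Longrightarrow> moderate \<xi>"
  by (simp add: represents_def)

lemma abs_gen_eq_iff:
  "moderate \<xi> \<Longrightarrow> moderate \<eta> \<Longrightarrow> abs_gen \<xi> = abs_gen \<eta> \<longleftrightarrow> negligible_net (\<lambda>\<epsilon>. \<xi> \<epsilon> - \<eta> \<epsilon>)"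
  using Quotient3_rel[OF Quotient3_gen, of \<xi> \<eta>] by (auto simp: gen_rel_refl_iff gen_rel_def)

lemma represents_unique: "represents \<xi> x \<Longrightarrow> represents \<xi> y \<Longrightarrow> x = y"
  by (simp add: represents_def)

lemma represents_negligible:
  "represents \<xi> x \<Longrightarrow> represents \<eta> x \<Longrightarrow> negligible_net (\<lambda>\<epsilon>. \<xi> \<epsilon> - \<eta> \<epsilon>)"
  using abs_gen_eq_iff[of \<xi> \<eta>] by (simp add: represents_def)

lemma moderate_cong_negligible:
  assumes "moderate \<xi>" "negligible_net (\<lambda>\<epsilon>. \<xi> \<epsilon> - \<eta> \<epsilon>)"
  shows "moderate \<eta>"
proof -
  have "(\<lambda>\<epsilon>. norm (\<xi> \<epsilon> - \<eta> \<epsilon>)) \<in> O[at_right 0](\<lambda>\<epsilon>. \<epsilon> ^ 0)"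
    using assms(2) unfolding negligible_net_def by blast
  then have "moderate (\<lambda>\<epsilon>. \<xi> \<epsilon> - \<eta> \<epsilon>)"
    unfolding moderate_def by (intro exI[of _ 0]) simp
  from moderate_diff[OF assms(1) this] show ?thesis by simp
qed

lemma represents_cong:
  assumes "represents \<xi> x" "negligible_net (\<lambda>\<epsilon>. \<xi> \<epsilon> - \<eta> \<epsilon>)"
  shows "represents \<eta> x"
  using assms moderate_cong_negligible abs_gen_eq_iff by (metis represents_def)

lemma represents_iff: "represents \<xi> x \<Longrightarrow> represents \<eta> x \<longleftrightarrow> negligible_net (\<lambda>\<epsilon>. \<xi> \<epsilon> - \<eta> \<epsilon>)"
  using represents_cong represents_negligible by blast

lemma represents_0_iff: "represents \<xi> 0 \<longleftrightarrow> negligible_net \<xi>"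
proof -
  have *: "represents (\<lambda>_. 0) (0::'a gen)"
    by (simp add: represents_def moderate_const zero_gen_def)
  have "negligible_net (\<lambda>\<epsilon>. 0 - \<xi> \<epsilon>) \<longleftrightarrow> negligible_net \<xi>"
    by (simp add: negligible_net_def)
  then show ?thesis using represents_iff[OF *, of \<xi>] by simp
qed

lemma represents_1: "represents (\<lambda>_. 1) 1"
  by (simp add: represents_def moderate_const one_gen_def)

lemma represents_add:
  "represents \<xi> x \<Longrightarrow> represents \<eta> y \<Longrightarrow> represents (\<lambda>\<epsilon>. \<xi> \<epsilon> + \<eta> \<epsilon>) (x + y)"
  by (auto simp: represents_def moderate_add plus_gen.abs_eq gen_rel_refl_iff)

lemma represents_diff:
  "represents \<xi> x \<Longrightarrow> represents \<eta> y \<Longrightarrow> represents (\<lambda>\<epsilon>. \<xi> \<epsilon> - \<eta> \<epsilon>) (x - y)"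
  by (auto simp: represents_def moderate_diff minus_gen.abs_eq gen_rel_refl_iff)

lemma represents_mult:
  "represents \<xi> x \<Longrightarrow> represents \<eta> y \<Longrightarrow> represents (\<lambda>\<epsilon>. \<xi> \<epsilon> * \<eta> \<epsilon>) (x * y)"
  by (auto simp: represents_def moderate_mult times_gen.abs_eq gen_rel_refl_iff)

lemma represents_gabs: "represents \<xi> x \<Longrightarrow> represents (\<lambda>\<epsilon>. norm (\<xi> \<epsilon>)) (gabs x)"
  by (auto simp: represents_def moderate_norm gabs.abs_eq gen_rel_refl_iff)

section \<open>Asymptotic bounds in powers of \<epsilon>\<close>

lemma two_power_Suc_le: "0 < \<epsilon> \<Longrightarrow> \<epsilon> < 1/2 \<Longrightarrow> 2 * \<epsilon> ^ Suc m \<le> (\<epsilon>::real) ^ m"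
  using mult_right_mono[of "2 * \<epsilon>" 1 "\<epsilon> ^ m"] by (simp add: mult.assoc)

lemma eventually_small: "0 < d \<Longrightarrow> eventually (\<lambda>\<epsilon>::real. 0 < \<epsilon> \<and> \<epsilon> < d) (at_right 0)"
  by (auto simp: eventually_at_right_field intro: exI[of _ d])

text \<open>The power \<epsilon>^(q - r) tends to 0 and absorbs the constant hidden in the O-bound.
  Giving up an arbitrarily small part of the exponent thus yields estimates free of
  constants.\<close>

lemma bigo_powr_bound:
  assumes "f \<in> O[at_right 0](\<lambda>\<epsilon>::real. \<epsilon> powr q :: real)" "r < q"
  shows "\<forall>\<^sub>F \<epsilon> in at_right 0. \<bar>f \<epsilon>\<bar> \<le> \<epsilon> powr r"
proof -
  obtain c where c: "c > 0" "eventually (\<lambda>\<epsilon>::real. norm (f \<epsilon>) \<le> c * norm (\<epsilon> powr q)) (at_right 0)"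
    using assms(1) by (auto elim!: landau_o.bigE)
  have "eventually (\<lambda>\<epsilon>::real. 0 < \<epsilon> \<and> \<epsilon> < (1 / c) powr (1 / (q - r))) (at_right 0)"
    using c by (intro eventually_small) auto
  with c(2) show ?thesis
  proof eventually_elim
    case (elim \<epsilon>)
    have "\<epsilon> powr (q - r) \<le> ((1 / c) powr (1 / (q - r))) powr (q - r)"
      using elim assms(2) by (intro powr_mono2) auto
    also have "\<dots> = 1 / c" using assms(2) c by (simp add: powr_powr)
    finally have "c * \<epsilon> powr (q - r) \<le> 1" using c by (simp add: field_simps)
    then have "c * \<epsilon> powr (q - r) * \<epsilon> powr r \<le> \<epsilon> powr r"
      by (intro mult_left_le_one_le) (use c in auto)
    also have "c * \<epsilon> powr (q - r) * \<epsilon> powr r = c * \<epsilon> powr q"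
      using elim by (simp add: powr_add[symmetric])
    finally show ?case using elim by simp
  qed
qed

lemma bigo_powrI:
  assumes "\<forall>\<^sub>F \<epsilon> in at_right 0. \<bar>f \<epsilon>\<bar> \<le> \<epsilon> powr q"
  shows "f \<in> O[at_right 0](\<lambda>\<epsilon>::real. \<epsilon> powr q :: real)"
  using assms by (intro bigoI[where c = 1]) simp

lemma bigo_powr_mono:
  assumes "f \<in> O[at_right 0](\<lambda>\<epsilon>::real. \<epsilon> powr q :: real)" "r \<le> q"
  shows "f \<in> O[at_right 0](\<lambda>\<epsilon>::real. \<epsilon> powr r)"
proof (cases "r = q")
  case False
  then show ?thesis using bigo_powrI[OF bigo_powr_bound[OF assms(1), of r]] assms(2) by simp
qed (use assms in simp)

lemma bigo_power_powr:
  "O[at_right 0](\<lambda>\<epsilon>::real. \<epsilon> ^ m :: real) = O[at_right 0](\<lambda>\<epsilon>. \<epsilon> powr real m)"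
  by (rule landau_o.big.cong, use eventually_unit_interval in eventually_elim)
    (simp add: powr_realpow)

lemma bigo_inverse_power_powr:
  "O[at_right 0](\<lambda>\<epsilon>::real. 1 / \<epsilon> ^ m :: real) = O[at_right 0](\<lambda>\<epsilon>. \<epsilon> powr (- real m))"
  by (rule landau_o.big.cong, use eventually_unit_interval in eventually_elim)
    (simp add: powr_realpow powr_minus field_simps)

lemma moderate_bigo_iff:
  "moderate x \<longleftrightarrow> (\<exists>N::nat. (\<lambda>\<epsilon>. norm (x \<epsilon>)) \<in> O[at_right 0](\<lambda>\<epsilon>. \<epsilon> powr (- real N)))"
  by (simp add: moderate_def bigo_inverse_power_powr)

lemma moderateI:
  assumes "(\<lambda>\<epsilon>. norm (x \<epsilon>)) \<in> O[at_right 0](\<lambda>\<epsilon>. \<epsilon> powr q)"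
  shows "moderate x"
  unfolding moderate_bigo_iff
  by (rule exI[of _ "nat \<lceil>- q\<rceil>"], rule bigo_powr_mono[OF assms]) linarith

lemma moderate_iff:
  "moderate x \<longleftrightarrow> (\<exists>N::nat. \<forall>\<^sub>F \<epsilon> in at_right 0. norm (x \<epsilon>) \<le> \<epsilon> powr (- real N))"
proof
  assume "moderate x"
  then obtain N where "(\<lambda>\<epsilon>. norm (x \<epsilon>)) \<in> O[at_right 0](\<lambda>\<epsilon>. \<epsilon> powr (- real N))"
    by (auto simp: moderate_bigo_iff)
  from bigo_powr_bound[OF this, of "- real (Suc N)"]
  show "\<exists>N::nat. \<forall>\<^sub>F \<epsilon> in at_right 0. norm (x \<epsilon>) \<le> \<epsilon> powr (- real N)"
    by (intro exI[of _ "Suc N"]) simp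
next
  assume "\<exists>N::nat. \<forall>\<^sub>F \<epsilon> in at_right 0. norm (x \<epsilon>) \<le> \<epsilon> powr (- real N)"
  then show "moderate x"
    using bigo_powrI[of "\<lambda>\<epsilon>. norm (x \<epsilon>)"] by (auto simp: moderate_bigo_iff)
qed

lemma moderate_eventually_le:
  assumes "moderate x" "\<forall>\<^sub>F \<epsilon> in at_right 0. norm (y \<epsilon>) \<le> norm (x \<epsilon>)"
  shows "moderate y"
proof -
  obtain N :: nat where "\<forall>\<^sub>F \<epsilon> in at_right 0. norm (x \<epsilon>) \<le> \<epsilon> powr (- real N)"
    using assms(1) by (auto simp: moderate_iff)
  with assms(2) have "\<forall>\<^sub>F \<epsilon> in at_right 0. norm (y \<epsilon>) \<le> \<epsilon> powr (- real N)"
    by eventually_elim auto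
  then show ?thesis by (auto simp: moderate_iff)
qed

lemma negligible_net_iff:
  "negligible_net x \<longleftrightarrow> (\<forall>m::nat. \<forall>\<^sub>F \<epsilon> in at_right 0. norm (x \<epsilon>) \<le> \<epsilon> ^ m)"
proof
  assume x: "negligible_net x"
  show "\<forall>m::nat. \<forall>\<^sub>F \<epsilon> in at_right 0. norm (x \<epsilon>) \<le> \<epsilon> ^ m"
  proof
    fix m
    have "(\<lambda>\<epsilon>. norm (x \<epsilon>)) \<in> O[at_right 0](\<lambda>\<epsilon>. \<epsilon> powr real (Suc m))"
      using x unfolding negligible_net_def bigo_power_powr by blast
    then have "\<forall>\<^sub>F \<epsilon> in at_right 0. \<bar>norm (x \<epsilon>)\<bar> \<le> \<epsilon> powr real m"
      by (rule bigo_powr_bound) simp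
    then show "\<forall>\<^sub>F \<epsilon> in at_right 0. norm (x \<epsilon>) \<le> \<epsilon> ^ m"
      using eventually_unit_interval by eventually_elim (simp add: powr_realpow)
  qed
next
  assume *: "\<forall>m::nat. \<forall>\<^sub>F \<epsilon> in at_right 0. norm (x \<epsilon>) \<le> \<epsilon> ^ m"
  show "negligible_net x" unfolding negligible_net_def
  proof
    fix m
    show "(\<lambda>\<epsilon>. norm (x \<epsilon>)) \<in> O[at_right 0](\<lambda>\<epsilon>. \<epsilon> ^ m)"
      using *[rule_format, of m] by (intro bigoI[where c = 1], eventually_elim) auto
  qed
qed

lemma negligible_net_eventually_le:
  assumes "negligible_net x" "\<forall>\<^sub>F \<epsilon> in at_right 0. norm (y \<epsilon>) \<le> norm (x \<epsilon>)"
  shows "negligible_net y"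
  unfolding negligible_net_iff
proof
  fix m
  have "\<forall>\<^sub>F \<epsilon> in at_right 0. norm (x \<epsilon>) \<le> \<epsilon> ^ m"
    using assms(1) by (auto simp: negligible_net_iff)
  with assms(2) show "\<forall>\<^sub>F \<epsilon> in at_right 0. norm (y \<epsilon>) \<le> \<epsilon> ^ m"
    by eventually_elim auto
qed

lemma negligible_net_bigo_powr:
  assumes "negligible_net x"
  shows "(\<lambda>\<epsilon>. norm (x \<epsilon>)) \<in> O[at_right 0](\<lambda>\<epsilon>. \<epsilon> powr q)"
proof -
  have "(\<lambda>\<epsilon>. norm (x \<epsilon>)) \<in> O[at_right 0](\<lambda>\<epsilon>. \<epsilon> powr real (nat \<lceil>q\<rceil>))"
    using assms unfolding negligible_net_def bigo_power_powr by blast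
  then show ?thesis by (rule bigo_powr_mono) linarith
qed

text \<open>
  The diagonal argument behind every gluing of nets below: failures at all orders \<open>m\<close> are collected
  on one set \<open>S\<close> accumulating at \<open>0\<close>, along which the order \<open>k\<close> tends to infinity.
\<close>

lemma diagonal_subnet:
  fixes P :: "nat \<Rightarrow> real \<Rightarrow> bool"
  assumes "\<And>m. \<exists>\<^sub>F \<epsilon> in at_right 0. P m \<epsilon>"
  obtains S k where "\<exists>\<^sub>F \<epsilon> in at_right 0. \<epsilon> \<in> S" "\<And>\<epsilon>. \<epsilon> \<in> S \<Longrightarrow> P (k \<epsilon>) \<epsilon>"
    "\<And>m::nat. \<forall>\<^sub>F \<epsilon> in at_right 0. \<epsilon> \<in> S \<longrightarrow> m \<le> k \<epsilon>"
proof -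
  have ex: "\<exists>\<epsilon>. 0 < \<epsilon> \<and> \<epsilon> < d \<and> P m \<epsilon>" if "0 < d" for d m
  proof -
    have "\<exists>\<^sub>F \<epsilon> in at_right 0. P m \<epsilon> \<and> (0 < \<epsilon> \<and> \<epsilon> < d)"
      by (rule frequently_rev_mp[OF assms[of m]], use eventually_small[OF that] in eventually_elim) auto
    then show ?thesis by (auto dest: frequently_ex)
  qed
  \<comment> \<open>The bound 1 / Suc n makes e converge to 0, so that its range accumulates there.
    Strict decrease makes e injective, so that the order belonging to a parameter can be read off as
    \<open>inv e\<close>.\<close>
  have "\<exists>e. \<forall>n. (0 < e n \<and> e n < 1 / real (Suc n) \<and> P n (e n)) \<and> e (Suc n) < e n"
  proof (rule dependent_nat_choice)
    show "\<exists>x. 0 < x \<and> x < 1 / real (Suc 0) \<and> P 0 x" using ex[of 1 0] by simp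
    fix x n assume "0 < x \<and> x < 1 / real (Suc n) \<and> P n x"
    then show "\<exists>y. (0 < y \<and> y < 1 / real (Suc (Suc n)) \<and> P (Suc n) y) \<and> y < x"
      using ex[of "min x (1 / real (Suc (Suc n)))" "Suc n"] by auto
  qed
  then obtain e where e: "\<And>n. 0 < e n" "\<And>n. e n < 1 / real (Suc n)" "\<And>n. P n (e n)"
      "\<And>n. e (Suc n) < e n" by blast
  have dec: "m < n \<Longrightarrow> e n < e m" for m n using lift_Suc_mono_less[of "\<lambda>n. - e n" m n] e(4) by simp
  have inj: "inj e" by (rule injI) (metis dec less_irrefl linorder_neqE_nat)
  show thesis
  proof
    show "\<exists>\<^sub>F \<epsilon> in at_right 0. \<epsilon> \<in> range e"
      unfolding frequently_def
    proof
      assume "\<forall>\<^sub>F \<epsilon> in at_right 0. \<epsilon> \<notin> range e"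
      then obtain b where b: "b > 0" "\<And>y. 0 < y \<Longrightarrow> y < b \<Longrightarrow> y \<notin> range e"
        by (auto simp: eventually_at_right_field)
      obtain n where "1 / real (Suc n) < b"
        using b(1) nat_approx_posE by blast
      then show False using b(2)[of "e n"] e(1)[of n] e(2)[of n] by auto
    qed
    show "P (inv e \<epsilon>) \<epsilon>" if "\<epsilon> \<in> range e" for \<epsilon>
      using that e(3) inj by auto
    show "\<forall>\<^sub>F \<epsilon> in at_right 0. \<epsilon> \<in> range e \<longrightarrow> m \<le> inv e \<epsilon>" for m
      using eventually_small[OF e(1)[of m]]
    proof eventually_elim
      case (elim \<epsilon>)
      show ?case
      proof
        assume "\<epsilon> \<in> range e"
        then obtain n where "\<epsilon> = e n" by auto
        moreover have "m \<le> n" using dec[of n m] elim calculation by (meson less_asym not_le)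
        ultimately show "m \<le> inv e \<epsilon>" using inj by simp
      qed
    qed
  qed
qed

text \<open>A filtration by order of magnitude. It is slightly finer than the valuation: v(x) > q
  implies membership, membership implies v(x) \<ge> q. Using O(\<epsilon>^q) itself makes each level
  an additive group with a single explicit bound.\<close>

definition bigo_gen :: "real \<Rightarrow> 'a::real_normed_vector gen set" where
  "bigo_gen q = {x. \<exists>\<xi>. represents \<xi> x \<and> (\<lambda>\<epsilon>. norm (\<xi> \<epsilon>)) \<in> O[at_right 0](\<lambda>\<epsilon>. \<epsilon> powr q)}"

text \<open>Two representatives differ by a negligible net, which is O(\<epsilon>^q) for every real
  q.\<close>

lemma bigo_gen_iff:
  assumes "represents \<xi> x"
  shows "x \<in> bigo_gen q \<longleftrightarrow> (\<lambda>\<epsilon>. norm (\<xi> \<epsilon>)) \<in> O[at_right 0](\<lambda>\<epsilon>. \<epsilon> powr q)"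
proof
  assume "x \<in> bigo_gen q"
  then obtain \<eta> where \<eta>: "represents \<eta> x" "(\<lambda>\<epsilon>. norm (\<eta> \<epsilon>)) \<in> O[at_right 0](\<lambda>\<epsilon>. \<epsilon> powr q)"
    by (auto simp: bigo_gen_def)
  have "(\<lambda>\<epsilon>. norm (\<xi> \<epsilon>)) \<in> O[at_right 0](\<lambda>\<epsilon>. norm (\<eta> \<epsilon>) + norm (\<xi> \<epsilon> - \<eta> \<epsilon>))"
  proof (rule bigoI[where c = 1], rule always_eventually, rule allI)
    fix \<epsilon> show "norm (norm (\<xi> \<epsilon>)) \<le> 1 * norm (norm (\<eta> \<epsilon>) + norm (\<xi> \<epsilon> - \<eta> \<epsilon>))"
      using norm_triangle_ineq[of "\<eta> \<epsilon>" "\<xi> \<epsilon> - \<eta> \<epsilon>"] by simp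
  qed
  also have "(\<lambda>\<epsilon>. norm (\<eta> \<epsilon>) + norm (\<xi> \<epsilon> - \<eta> \<epsilon>)) \<in> O[at_right 0](\<lambda>\<epsilon>. \<epsilon> powr q)"
    by (intro sum_in_bigo \<eta>(2) negligible_net_bigo_powr represents_negligible[OF assms \<eta>(1)])
  finally show "(\<lambda>\<epsilon>. norm (\<xi> \<epsilon>)) \<in> O[at_right 0](\<lambda>\<epsilon>. \<epsilon> powr q)" .
qed (use assms in \<open>auto simp: bigo_gen_def\<close>)

lemma bigo_gen_ex: "\<exists>N::nat. x \<in> bigo_gen (- real N)"
  using represents_rep[of x] bigo_gen_iff[OF represents_rep, of x]
  by (auto simp: represents_def moderate_bigo_iff)

lemma bigo_gen_mono: "x \<in> bigo_gen q \<Longrightarrow> r \<le> q \<Longrightarrow> x \<in> bigo_gen r"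
  unfolding bigo_gen_iff[OF represents_rep] by (rule bigo_powr_mono)

lemma bigo_gen_0: "0 \<in> bigo_gen q"
  using bigo_gen_iff[of "\<lambda>_. 0" 0 q] by (simp add: represents_0_iff negligible_net_zero)

lemma bigo_gen_add:
  assumes "x \<in> bigo_gen q" "y \<in> bigo_gen q"
  shows "x + y \<in> bigo_gen q"
proof -
  obtain \<xi> \<eta> where r: "represents \<xi> x" "represents \<eta> y" by (meson represents_rep)
  have "(\<lambda>\<epsilon>. norm (\<xi> \<epsilon> + \<eta> \<epsilon>)) \<in> O[at_right 0](\<lambda>\<epsilon>. norm (\<xi> \<epsilon>) + norm (\<eta> \<epsilon>))"
    by (rule bigoI[where c = 1], intro always_eventually) (auto intro: norm_triangle_ineq)
  also have "(\<lambda>\<epsilon>. norm (\<xi> \<epsilon>) + norm (\<eta> \<epsilon>)) \<in> O[at_right 0](\<lambda>\<epsilon>. \<epsilon> powr q)"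
    using assms r by (auto intro!: sum_in_bigo simp: bigo_gen_iff)
  finally show ?thesis using bigo_gen_iff[OF represents_add[OF r]] by blast
qed

lemma bigo_gen_mult:
  fixes x y :: "'a::real_normed_field gen"
  assumes "x \<in> bigo_gen q" "y \<in> bigo_gen r"
  shows "x * y \<in> bigo_gen (q + r)"
proof -
  obtain \<xi> \<eta> where r: "represents \<xi> x" "represents \<eta> y" by (meson represents_rep)
  have "(\<lambda>\<epsilon>. norm (\<xi> \<epsilon>) * norm (\<eta> \<epsilon>)) \<in> O[at_right 0](\<lambda>\<epsilon>. \<epsilon> powr q * \<epsilon> powr r)"
    using assms r by (intro landau_o.big.mult) (auto simp: bigo_gen_iff)
  then show ?thesis using bigo_gen_iff[OF represents_mult[OF r]] by (simp add: norm_mult powr_add)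
qed

lemma bigo_gen_gabs: "gabs x \<in> bigo_gen q \<longleftrightarrow> x \<in> bigo_gen q"
  using bigo_gen_iff[OF represents_gabs[OF represents_rep], of x q] bigo_gen_iff[OF represents_rep, of x q]
  by simp

lemma gabs_0: "gabs (0 :: 'a::real_normed_vector gen) = 0"
proof -
  have "represents (\<lambda>_. 0) (0 :: 'a gen)"
    by (simp add: represents_0_iff negligible_net_zero)
  from represents_gabs[OF this] have "represents (\<lambda>_. 0) (gabs (0 :: 'a gen))" by simp
  then show ?thesis
    by (rule represents_unique) (simp add: represents_0_iff negligible_net_zero)
qed

lemma moderate_powr: "moderate (\<lambda>\<epsilon>. \<epsilon> powr q)"
  by (rule moderateI[of _ q]) simp

lemma represents_deps: "represents (\<lambda>\<epsilon>. \<epsilon> powr q) (deps q)"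
  unfolding deps_def by (rule represents_abs[OF moderate_powr])

lemma deps_bigo_gen: "deps q \<in> bigo_gen q"
  using bigo_gen_iff[OF represents_deps] by simp

lemma deps_add: "deps p * deps q = deps (p + q)"
  using represents_mult[OF represents_deps represents_deps, of p q] represents_deps[of "p + q"]
  by (simp add: powr_add represents_unique)

lemma deps_zero: "deps 0 = 1"
proof -
  have "negligible_net (\<lambda>\<epsilon>::real. 1 - \<epsilon> powr 0)"
    unfolding negligible_net_iff
  proof
    fix m show "\<forall>\<^sub>F \<epsilon> in at_right 0. norm (1 - \<epsilon> powr 0) \<le> \<epsilon> ^ m"
      using eventually_unit_interval by eventually_elim auto
  qed
  from represents_cong[OF represents_1 this] show ?thesis
    using represents_deps represents_unique by blast
qed

subsection \<open>The order\<close>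

text \<open>The definition provides some pair of ordered representatives. For a prescribed pair the
  inequality survives only up to an error \<epsilon>^m for every m, and this weaker form is enough
  to recover an ordered pair.\<close>

lemma less_eq_gen_iff:
  fixes x y :: "real gen"
  assumes r: "represents \<xi> x" "represents \<eta> y"
  shows "x \<le> y \<longleftrightarrow> (\<forall>m::nat. \<forall>\<^sub>F \<epsilon> in at_right 0. \<xi> \<epsilon> \<le> \<eta> \<epsilon> + \<epsilon> ^ m)"
proof
  assume "x \<le> y"
  then obtain \<xi>' \<eta>' where r': "represents \<xi>' x" "represents \<eta>' y" "\<forall>\<^sub>F \<epsilon> in at_right 0. \<xi>' \<epsilon> \<le> \<eta>' \<epsilon>"
    by (auto simp: less_eq_gen_def)
  show "\<forall>m::nat. \<forall>\<^sub>F \<epsilon> in at_right 0. \<xi> \<epsilon> \<le> \<eta> \<epsilon> + \<epsilon> ^ m"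
  proof
    fix m
    have "\<forall>\<^sub>F \<epsilon> in at_right 0. norm (\<xi> \<epsilon> - \<xi>' \<epsilon>) \<le> \<epsilon> ^ Suc m"
      "\<forall>\<^sub>F \<epsilon> in at_right 0. norm (\<eta> \<epsilon> - \<eta>' \<epsilon>) \<le> \<epsilon> ^ Suc m"
      using represents_negligible[OF r(1) r'(1)] represents_negligible[OF r(2) r'(2)]
      unfolding negligible_net_iff by blast+
    moreover have "\<forall>\<^sub>F \<epsilon> in at_right 0. 0 < \<epsilon> \<and> \<epsilon> < (1/2 :: real)" by (rule eventually_small) simp
    ultimately show "\<forall>\<^sub>F \<epsilon> in at_right 0. \<xi> \<epsilon> \<le> \<eta> \<epsilon> + \<epsilon> ^ m" using r'(3)
    proof eventually_elim
      case (elim \<epsilon>)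
      \<comment> \<open>Two errors of order Suc m fit into one of order m once \<epsilon> < 1/2. The
        same trade recurs in later estimates.\<close>
      have "2 * \<epsilon> ^ Suc m \<le> \<epsilon> ^ m" using elim by (intro two_power_Suc_le) auto
      then show ?case using elim unfolding real_norm_def by linarith
    qed
  qed
next
  assume *: "\<forall>m::nat. \<forall>\<^sub>F \<epsilon> in at_right 0. \<xi> \<epsilon> \<le> \<eta> \<epsilon> + \<epsilon> ^ m"
  \<comment> \<open>Cutting \<xi> off at \<eta> changes it by at most \<epsilon>^m for every m, so
    the minimum is a representative of x lying below \<eta>.\<close>
  have "negligible_net (\<lambda>\<epsilon>. \<xi> \<epsilon> - min (\<xi> \<epsilon>) (\<eta> \<epsilon>))"
    unfolding negligible_net_iff
  proof
    fix m show "\<forall>\<^sub>F \<epsilon> in at_right 0. norm (\<xi> \<epsilon> - min (\<xi> \<epsilon>) (\<eta> \<epsilon>)) \<le> \<epsilon> ^ m"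
      using *[rule_format, of m] eventually_unit_interval by eventually_elim (auto simp: min_def)
  qed
  from represents_cong[OF r(1) this] r(2) show "x \<le> y"
    unfolding less_eq_gen_def by (intro exI[of _ "\<lambda>\<epsilon>. min (\<xi> \<epsilon>) (\<eta> \<epsilon>)"] exI[of _ \<eta>]) auto
qed

lemma gen_leI:
  fixes x y :: "real gen"
  shows "represents \<xi> x \<Longrightarrow> represents \<eta> y \<Longrightarrow> \<forall>\<^sub>F \<epsilon> in at_right 0. \<xi> \<epsilon> \<le> \<eta> \<epsilon> \<Longrightarrow> x \<le> y"
  by (auto simp: less_eq_gen_def)

lemma gen_le_trans:
  fixes x y z :: "real gen"
  assumes "x \<le> y" "y \<le> z"
  shows "x \<le> z"
proof -
  obtain \<xi> \<eta> \<zeta> where r: "represents \<xi> x" "represents \<eta> y" "represents \<zeta> z" by (meson represents_rep)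
  show ?thesis unfolding less_eq_gen_iff[OF r(1,3)]
  proof
    fix m
    have "\<forall>\<^sub>F \<epsilon> in at_right 0. \<xi> \<epsilon> \<le> \<eta> \<epsilon> + \<epsilon> ^ Suc m" "\<forall>\<^sub>F \<epsilon> in at_right 0. \<eta> \<epsilon> \<le> \<zeta> \<epsilon> + \<epsilon> ^ Suc m"
      using assms unfolding less_eq_gen_iff[OF r(1,2)] less_eq_gen_iff[OF r(2,3)] by blast+
    moreover have "\<forall>\<^sub>F \<epsilon> in at_right 0. 0 < \<epsilon> \<and> \<epsilon> < (1/2 :: real)" by (rule eventually_small) simp
    ultimately show "\<forall>\<^sub>F \<epsilon> in at_right 0. \<xi> \<epsilon> \<le> \<zeta> \<epsilon> + \<epsilon> ^ m"
    proof eventually_elim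
      case (elim \<epsilon>)
      have "2 * \<epsilon> ^ Suc m \<le> \<epsilon> ^ m" using elim by (intro two_power_Suc_le) auto
      then show ?case using elim by linarith
    qed
  qed
qed

lemma gen_le_antisym:
  fixes x y :: "real gen"
  assumes "x \<le> y" "y \<le> x"
  shows "x = y"
proof -
  obtain \<xi> \<eta> where r: "represents \<xi> x" "represents \<eta> y" by (meson represents_rep)
  have "negligible_net (\<lambda>\<epsilon>. \<xi> \<epsilon> - \<eta> \<epsilon>)"
    unfolding negligible_net_iff
  proof
    fix m
    show "\<forall>\<^sub>F \<epsilon> in at_right 0. norm (\<xi> \<epsilon> - \<eta> \<epsilon>) \<le> \<epsilon> ^ m"
      using assms(1)[unfolded less_eq_gen_iff[OF r], rule_format, of m]
        assms(2)[unfolded less_eq_gen_iff[OF r(2) r(1)], rule_format, of m]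
      by eventually_elim auto
  qed
  from represents_cong[OF r(1) this] show ?thesis using r(2) represents_unique by blast
qed

lemma bigo_gen_le:
  assumes "gabs x \<le> y" "y \<in> bigo_gen q"
  shows "x \<in> bigo_gen q"
proof -
  obtain \<xi> \<eta> where r: "represents \<xi> x" "represents \<eta> y" by (meson represents_rep)
  have "\<forall>\<^sub>F \<epsilon> in at_right 0. norm (\<xi> \<epsilon>) \<le> \<eta> \<epsilon> + \<epsilon> ^ nat \<lceil>q\<rceil>"
    using assms(1) unfolding less_eq_gen_iff[OF represents_gabs[OF r(1)] r(2)] by blast
  then have "(\<lambda>\<epsilon>. norm (\<xi> \<epsilon>)) \<in> O[at_right 0](\<lambda>\<epsilon>. \<eta> \<epsilon> + \<epsilon> ^ nat \<lceil>q\<rceil>)"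
    by (intro bigoI[where c = 1], eventually_elim) auto
  also have "(\<lambda>\<epsilon>. \<eta> \<epsilon> + \<epsilon> ^ nat \<lceil>q\<rceil>) \<in> O[at_right 0](\<lambda>\<epsilon>. \<epsilon> powr q)"
  proof (rule sum_in_bigo)
    show "\<eta> \<in> O[at_right 0](\<lambda>\<epsilon>. \<epsilon> powr q)" using assms(2) bigo_gen_iff[OF r(2)] by simp
    have "(\<lambda>\<epsilon>. \<epsilon> ^ nat \<lceil>q\<rceil>) \<in> O[at_right 0](\<lambda>\<epsilon>. \<epsilon> powr real (nat \<lceil>q\<rceil>))"
      unfolding bigo_power_powr[symmetric] by simp
    then show "(\<lambda>\<epsilon>. \<epsilon> ^ nat \<lceil>q\<rceil>) \<in> O[at_right 0](\<lambda>\<epsilon>. \<epsilon> powr q)"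
      by (rule bigo_powr_mono) linarith
  qed
  finally show ?thesis using bigo_gen_iff[OF r(1)] by simp
qed

text \<open>A gap of size \<epsilon>^q makes the difference invertible: its pointwise inverse is
  bounded by \<epsilon>^(-q) and therefore moderate. A gap that is merely positive could be
  negligible.\<close>

lemma gen_lessI:
  fixes x y :: "real gen"
  assumes r: "represents \<xi> x" "represents \<eta> y" and le: "\<forall>\<^sub>F \<epsilon> in at_right 0. \<xi> \<epsilon> + \<epsilon> powr q \<le> \<eta> \<epsilon>"
  shows "x < y"
  unfolding less_gen_def
proof
  have 1: "\<forall>\<^sub>F \<epsilon> in at_right 0. 0 < \<epsilon> \<and> \<epsilon> powr q \<le> \<eta> \<epsilon> - \<xi> \<epsilon>"
    using le eventually_unit_interval by eventually_elim auto
  show "x \<le> y" by (rule gen_leI[OF r], use 1 in eventually_elim) (smt (verit) powr_ge_zero)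
  let ?s = "\<lambda>\<epsilon>. inverse (\<eta> \<epsilon> - \<xi> \<epsilon>)"
  have "\<forall>\<^sub>F \<epsilon> in at_right 0. norm (?s \<epsilon>) \<le> norm (\<epsilon> powr (- q))"
    using 1
  proof eventually_elim
    case (elim \<epsilon>)
    have p: "0 < \<epsilon> powr q" using elim by auto
    then have "inverse (\<eta> \<epsilon> - \<xi> \<epsilon>) \<le> inverse (\<epsilon> powr q)" using elim by (intro le_imp_inverse_le) auto
    moreover have "0 \<le> inverse (\<eta> \<epsilon> - \<xi> \<epsilon>)" using p elim by (simp del: powr_gt_zero)
    ultimately show ?case by (simp add: powr_minus)
  qed
  then have s: "moderate ?s" by (rule moderate_eventually_le[OF moderate_powr])
  have "represents (\<lambda>\<epsilon>. (\<eta> \<epsilon> - \<xi> \<epsilon>) * ?s \<epsilon>) ((y - x) * abs_gen ?s)"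
    by (intro represents_mult represents_diff r represents_abs s)
  moreover have "negligible_net (\<lambda>\<epsilon>. (\<eta> \<epsilon> - \<xi> \<epsilon>) * ?s \<epsilon> - 1)"
  proof (rule negligible_net_eventually_le[OF negligible_net_zero])
    show "\<forall>\<^sub>F \<epsilon> in at_right 0. norm ((\<eta> \<epsilon> - \<xi> \<epsilon>) * ?s \<epsilon> - 1) \<le> norm (0::real)"
      using 1
    proof eventually_elim
      case (elim \<epsilon>)
      then have "0 < \<epsilon> powr q" by auto
      with elim have "0 < \<eta> \<epsilon> - \<xi> \<epsilon>" by linarith
      then show ?case by simp
    qed
  qed
  ultimately have "represents (\<lambda>_. 1) ((y - x) * abs_gen ?s)" by (rule represents_cong)
  then show "(y - x) dvd 1" using represents_1 represents_unique by (metis dvd_triv_left)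
qed

text \<open>An inverse bounded by \<epsilon>^(-M) forces |\<xi>| \<ge> \<epsilon>^M / 2.
  Nonnegativity decides the sign: it holds for the given representative up to \<epsilon>^(M + 2),
  which is smaller than the lower bound \<epsilon>^(M + 1).\<close>

lemma gen_pos_bound:
  assumes "0 < \<rho>" "represents \<xi> (\<rho> :: real gen)"
  shows "\<exists>N::nat. \<forall>\<^sub>F \<epsilon> in at_right 0. \<epsilon> ^ N \<le> \<xi> \<epsilon>"
proof -
  from assms(1) obtain \<sigma> where \<sigma>: "1 = \<rho> * \<sigma>" and nn: "0 \<le> \<rho>"
    by (auto simp: less_gen_def dvd_def)
  obtain \<eta> where \<eta>: "represents \<eta> \<sigma>" by (meson represents_rep)
  obtain M where M: "\<forall>\<^sub>F \<epsilon> in at_right 0. norm (\<eta> \<epsilon>) \<le> \<epsilon> powr (- real M)"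
    using \<eta> by (auto simp: represents_def moderate_iff)
  have "negligible_net (\<lambda>\<epsilon>. \<xi> \<epsilon> * \<eta> \<epsilon> - 1)"
    using represents_negligible[OF represents_mult[OF assms(2) \<eta>, folded \<sigma>] represents_1] .
  then have 1: "\<forall>\<^sub>F \<epsilon> in at_right 0. norm (\<xi> \<epsilon> * \<eta> \<epsilon> - 1) \<le> \<epsilon> ^ 1"
    unfolding negligible_net_iff by blast
  have "represents (\<lambda>_. 0) (0 :: real gen)" by (simp add: represents_0_iff negligible_net_zero)
  from less_eq_gen_iff[OF this assms(2)] nn
  have 2: "\<forall>\<^sub>F \<epsilon> in at_right 0. 0 \<le> \<xi> \<epsilon> + \<epsilon> ^ (M + 2)" by blast
  have 3: "\<forall>\<^sub>F \<epsilon> in at_right 0. 0 < \<epsilon> \<and> \<epsilon> < (1/2 :: real)" by (rule eventually_small) simp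
  show ?thesis
  proof (rule exI[of _ "Suc M"], use 1 2 3 M in eventually_elim)
    case (elim \<epsilon>)
    have "1 / 2 \<le> \<bar>\<xi> \<epsilon>\<bar> * \<bar>\<eta> \<epsilon>\<bar>" using elim by (auto simp: abs_mult[symmetric])
    also have "\<dots> \<le> \<bar>\<xi> \<epsilon>\<bar> * \<epsilon> powr (- real M)" using elim by (intro mult_left_mono) auto
    also have "\<epsilon> powr (- real M) = 1 / \<epsilon> ^ M" using elim by (simp add: powr_minus powr_realpow field_simps)
    finally have a: "\<epsilon> ^ M / 2 \<le> \<bar>\<xi> \<epsilon>\<bar>" using elim by (simp add: field_simps)
    have b: "\<epsilon> ^ Suc M \<le> \<epsilon> ^ M / 2"
      using elim two_power_Suc_le[of \<epsilon> M] by simp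
    have c: "\<epsilon> ^ (M + 2) < \<epsilon> ^ Suc M" using elim by (intro power_strict_decreasing) auto
    show ?case using a b c elim by linarith
  qed
qed

lemma bigo_gen_less:
  assumes "0 < (\<rho> :: real gen)"
  shows "\<exists>r::nat. \<forall>x \<in> bigo_gen (real r). x < \<rho>"
proof -
  obtain \<eta> where \<eta>: "represents \<eta> \<rho>" by (meson represents_rep)
  obtain N where N: "\<forall>\<^sub>F \<epsilon> in at_right 0. \<epsilon> ^ N \<le> \<eta> \<epsilon>" using gen_pos_bound[OF assms \<eta>] by blast
  \<comment> \<open>Of the two extra orders one pays for the constant in the O-bound, the other
    leaves the gap \<epsilon>^(N + 1) that \<open>gen_lessI\<close> asks for.\<close>
  have "x < \<rho>" if x: "x \<in> bigo_gen (real (N + 2))" for x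
  proof -
    obtain \<xi> where \<xi>: "represents \<xi> x" by (meson represents_rep)
    have "(\<lambda>\<epsilon>. norm (\<xi> \<epsilon>)) \<in> O[at_right 0](\<lambda>\<epsilon>. \<epsilon> powr real (N + 2))"
      using x bigo_gen_iff[OF \<xi>] by blast
    then have 1: "\<forall>\<^sub>F \<epsilon> in at_right 0. \<bar>norm (\<xi> \<epsilon>)\<bar> \<le> \<epsilon> powr real (N + 1)"
      by (rule bigo_powr_bound) simp
    have 3: "\<forall>\<^sub>F \<epsilon> in at_right 0. 0 < \<epsilon> \<and> \<epsilon> < (1/2 :: real)" by (rule eventually_small) simp
    show ?thesis
    proof (rule gen_lessI[OF \<xi> \<eta>, of "real (N + 1)"], use N 1 3 in eventually_elim)
      case (elim \<epsilon>)
      have "2 * \<epsilon> ^ Suc N \<le> \<epsilon> ^ N" using elim by (intro two_power_Suc_le) auto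
      moreover have "\<epsilon> powr real (N + 1) = \<epsilon> ^ Suc N"
        using elim by (metis Suc_eq_plus1 powr_realpow)
      ultimately show ?case using elim unfolding abs_norm_cancel real_norm_def by linarith
    qed
  qed
  then show ?thesis by blast
qed

lemma deps_pos: "0 < deps q"
  by (rule gen_lessI[OF _ represents_deps, of "\<lambda>_. 0" _ q]) (auto simp: represents_0_iff negligible_net_zero)

text \<open>Balls enter the topology as a subbase, hence the induction on how V is generated. Inside
  a ball around z the point x has room left, because strict inequality makes \<rho> - |x - z|
  invertible and so bounds it below by a power of \<epsilon>.\<close>

lemma open_gen_ball:
  assumes "open V" "x \<in> V"
  shows "\<exists>r::nat. \<forall>y. y - x \<in> bigo_gen (real r) \<longrightarrow> y \<in> V"
proof -
  have "generate_topology {{y. gabs (y - x) < \<rho>} |x \<rho>. 0 < \<rho>} V" using assms(1) by (simp add: open_gen_def)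
  then show ?thesis using assms(2)
  proof (induction arbitrary: x)
    case (Int a b)
    then obtain r s :: nat where "\<forall>y. y - x \<in> bigo_gen (real r) \<longrightarrow> y \<in> a"
      "\<forall>y. y - x \<in> bigo_gen (real s) \<longrightarrow> y \<in> b" by blast
    moreover have "y \<in> bigo_gen (real r) \<and> y \<in> bigo_gen (real s)" if "y \<in> bigo_gen (real (max r s))" for y :: "'a gen"
      using that by (auto intro: bigo_gen_mono[of y "real (max r s)"])
    ultimately show ?case by (intro exI[of _ "max r s"]) blast
  next
    case (Basis s)
    then obtain z \<rho> where s: "s = {y. gabs (y - z) < \<rho>}" "0 < \<rho>" by auto
    obtain \<xi> \<zeta> \<eta> where r: "represents \<xi> x" "represents \<zeta> z" "represents \<eta> \<rho>" by (meson represents_rep)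
    have "0 < \<rho> - gabs (x - z)"
    proof -
      have "\<rho> - gabs (x - z) dvd 1" "gabs (x - z) \<le> \<rho>" using Basis s by (auto simp: less_gen_def)
      moreover have "0 \<le> \<rho> - gabs (x - z)"
      proof -
        obtain a b where "represents a (gabs (x - z))" "represents b \<rho>" "\<forall>\<^sub>F \<epsilon> in at_right 0. a \<epsilon> \<le> b \<epsilon>"
          using calculation(2) by (auto simp: less_eq_gen_def)
        then show ?thesis
          by (intro gen_leI[OF _ represents_diff, of "\<lambda>_. 0"]) (auto simp: represents_0_iff negligible_net_zero)
      qed
      ultimately show ?thesis by (simp add: less_gen_def)
    qed
    from gen_pos_bound[OF this represents_diff[OF r(3) represents_gabs[OF represents_diff[OF r(1,2)]]]]
    obtain N where N: "\<forall>\<^sub>F \<epsilon> in at_right 0. \<epsilon> ^ N \<le> \<eta> \<epsilon> - norm (\<xi> \<epsilon> - \<zeta> \<epsilon>)" by blast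
    have "y \<in> s" if y: "y - x \<in> bigo_gen (real (N + 2))" for y
    proof -
      obtain \<upsilon> where \<upsilon>: "represents \<upsilon> y" by (meson represents_rep)
      have "(\<lambda>\<epsilon>. norm (\<upsilon> \<epsilon> - \<xi> \<epsilon>)) \<in> O[at_right 0](\<lambda>\<epsilon>. \<epsilon> powr real (N + 2))"
        using y bigo_gen_iff[OF represents_diff[OF \<upsilon> r(1)]] by blast
      then have 1: "\<forall>\<^sub>F \<epsilon> in at_right 0. \<bar>norm (\<upsilon> \<epsilon> - \<xi> \<epsilon>)\<bar> \<le> \<epsilon> powr real (N + 1)"
        by (rule bigo_powr_bound) simp
      have 3: "\<forall>\<^sub>F \<epsilon> in at_right 0. 0 < \<epsilon> \<and> \<epsilon> < (1/2 :: real)" by (rule eventually_small) simp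
      have "gabs (y - z) < \<rho>"
      proof (rule gen_lessI[OF represents_gabs[OF represents_diff[OF \<upsilon> r(2)]] r(3), of "real (N + 1)"],
          use N 1 3 in eventually_elim)
        case (elim \<epsilon>)
        have "2 * \<epsilon> ^ Suc N \<le> \<epsilon> ^ N" using elim by (intro two_power_Suc_le) auto
        moreover have "\<epsilon> powr real (N + 1) = \<epsilon> ^ Suc N"
          using elim by (metis Suc_eq_plus1 powr_realpow)
        moreover have "norm (\<upsilon> \<epsilon> - \<zeta> \<epsilon>) \<le> norm (\<upsilon> \<epsilon> - \<xi> \<epsilon>) + norm (\<xi> \<epsilon> - \<zeta> \<epsilon>)"
          using norm_triangle_ineq[of "\<upsilon> \<epsilon> - \<xi> \<epsilon>" "\<xi> \<epsilon> - \<zeta> \<epsilon>"] by simp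
        ultimately show ?case using elim unfolding abs_norm_cancel by linarith
      qed
      then show ?thesis using s by simp
    qed
    then show ?case by blast
  next
    case (UN K)
    then obtain k where k: "k \<in> K" "x \<in> k" by auto
    from UN.IH[OF this] k(1) show ?case by blast
  qed simp
qed

text \<open>Additivity of O(\<epsilon>^q) acts as an ultrametric inequality: a ball of radius
  \<open>deps q\<close> around any member of the coset stays inside the coset.\<close>

lemma open_gen_coset: "open {y :: 'a::real_normed_vector gen. y - x \<in> bigo_gen q}"
proof -
  have eq: "{y :: 'a gen. y - x \<in> bigo_gen q} = (\<Union>z\<in>{z. z - x \<in> bigo_gen q}. {y. gabs (y - z) < deps q})"
  proof (intro set_eqI iffI)
    fix y assume "y \<in> {y. y - x \<in> bigo_gen q}"
    then show "y \<in> (\<Union>z\<in>{z. z - x \<in> bigo_gen q}. {y. gabs (y - z) < deps q})"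
      using deps_pos by (auto intro!: bexI[of _ y] simp: gabs_0)
  next
    fix y assume "y \<in> (\<Union>z\<in>{z. z - x \<in> bigo_gen q}. {y. gabs (y - z) < deps q})"
    then obtain z where z: "z - x \<in> bigo_gen q" "gabs (y - z) < deps q" by auto
    then have "y - z \<in> bigo_gen q"
      using bigo_gen_le deps_bigo_gen by (auto simp: less_gen_def)
    from bigo_gen_add[OF this z(1)] show "y \<in> {y. y - x \<in> bigo_gen q}" by simp
  qed
  moreover have "open {y :: 'a gen. gabs (y - z) < deps q}" for z
    unfolding open_gen_def by (rule generate_topology.Basis) (use deps_pos in auto)
  ultimately show ?thesis by (subst eq, intro open_UN ballI)
qed

lemma finite_gmax_represents:
  assumes "finite F" "F \<noteq> {}"
  shows "represents (\<lambda>\<epsilon>. MAX i\<in>F. rep_gen (a i) \<epsilon>) (finite_gmax F a)"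
  unfolding finite_gmax_def
proof (rule represents_abs)
  have "moderate (\<lambda>\<epsilon>. \<Sum>i\<in>F. norm (rep_gen (a i) \<epsilon>))"
    using assms(1)
  proof (induction)
    case (insert i F)
    then show ?case
      using moderate_add[OF moderate_norm[OF represents_moderate[OF represents_rep[of "a i"]]]] by simp
  qed (simp add: moderate_const)
  then show "moderate (\<lambda>\<epsilon>. MAX i\<in>F. rep_gen (a i) \<epsilon>)"
  proof (rule moderate_eventually_le, intro always_eventually allI)
    fix \<epsilon>
    have "(MAX i\<in>F. rep_gen (a i) \<epsilon>) \<in> (\<lambda>i. rep_gen (a i) \<epsilon>) ` F" using assms by (intro Max_in) auto
    then obtain i where i: "i \<in> F" "(MAX i\<in>F. rep_gen (a i) \<epsilon>) = rep_gen (a i) \<epsilon>" by auto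
    have "norm (rep_gen (a i) \<epsilon>) \<le> (\<Sum>i\<in>F. norm (rep_gen (a i) \<epsilon>))"
      by (rule member_le_sum) (use i assms in auto)
    then show "norm (MAX i\<in>F. rep_gen (a i) \<epsilon>) \<le> norm (\<Sum>i\<in>F. norm (rep_gen (a i) \<epsilon>))" using i by simp
  qed
qed

lemma finite_gmax_ge:
  assumes "finite F" "i \<in> F"
  shows "a i \<le> finite_gmax F a"
  by (rule gen_leI[OF represents_rep finite_gmax_represents]) (use assms in auto)

lemma finite_gmax_bigo_gen:
  assumes "finite F" "F \<noteq> {}" "\<And>i. i \<in> F \<Longrightarrow> a i \<in> bigo_gen q"
  shows "finite_gmax F a \<in> bigo_gen q"
proof -
  have "(\<lambda>\<epsilon>. \<Sum>i\<in>F. norm (rep_gen (a i) \<epsilon>)) \<in> O[at_right 0](\<lambda>\<epsilon>. \<epsilon> powr q)"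
    using assms(3) by (intro big_sum_in_bigo) (simp add: bigo_gen_iff[OF represents_rep])
  moreover have "(\<lambda>\<epsilon>. norm (MAX i\<in>F. rep_gen (a i) \<epsilon>)) \<in> O[at_right 0](\<lambda>\<epsilon>. \<Sum>i\<in>F. norm (rep_gen (a i) \<epsilon>))"
  proof (rule bigoI[where c = 1], intro always_eventually allI)
    fix \<epsilon>
    have "(MAX i\<in>F. rep_gen (a i) \<epsilon>) \<in> (\<lambda>i. rep_gen (a i) \<epsilon>) ` F" using assms by (intro Max_in) auto
    then obtain i where i: "i \<in> F" "(MAX i\<in>F. rep_gen (a i) \<epsilon>) = rep_gen (a i) \<epsilon>" by auto
    have "norm (rep_gen (a i) \<epsilon>) \<le> (\<Sum>i\<in>F. norm (rep_gen (a i) \<epsilon>))"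
      by (rule member_le_sum) (use i assms in auto)
    then show "norm (norm (MAX i\<in>F. rep_gen (a i) \<epsilon>)) \<le> 1 * norm (\<Sum>i\<in>F. norm (rep_gen (a i) \<epsilon>))" using i by simp
  qed
  ultimately show ?thesis
    unfolding bigo_gen_iff[OF finite_gmax_represents[OF assms(1,2)]] by (blast intro: landau_o.big_trans)
qed

lemma greatest_element_eqI:
  assumes "r \<in> S" "\<And>t. t \<in> S \<Longrightarrow> t \<le> r"
  shows "greatest_element S = r"
  unfolding greatest_element_def using assms by (blast intro: gen_le_antisym)

section \<open>Iterated partial derivatives\<close>

lemma iter_partial_append: "iter_partial (is @ js) u = iter_partial is (iter_partial js u)"
  by (induction "is") auto

lemma partial_deriv_cong:
  assumes "open S" "x \<in> S" "\<And>y. y \<in> S \<Longrightarrow> u y = v y"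
  shows "partial_deriv i u x = partial_deriv i v x"
proof -
  have "(u has_derivative D) (at x) \<longleftrightarrow> (v has_derivative D) (at x)" for D
    using assms has_derivative_transform_within_open[of u D x UNIV S v]
      has_derivative_transform_within_open[of v D x UNIV S u] by auto
  then show ?thesis by (simp add: partial_deriv_def frechet_derivative_def)
qed

lemma smooth_onD: "smooth_on S u \<Longrightarrow> x \<in> S \<Longrightarrow> iter_partial is u differentiable (at x)"
  by (simp add: smooth_on_def)

lemma smooth_on_subset: "smooth_on S u \<Longrightarrow> T \<subseteq> S \<Longrightarrow> smooth_on T u"
  by (auto simp: smooth_on_def)

lemma smooth_on_iter_partial: "smooth_on S u \<Longrightarrow> smooth_on S (iter_partial is u)"
  unfolding smooth_on_def iter_partial_append[symmetric] by blast

lemma has_derivative_partial_deriv: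
  fixes u :: "real ^ 'n \<Rightarrow> real"
  assumes "u differentiable (at x)"
  shows "(u has_derivative (\<lambda>h. \<Sum>i\<in>UNIV. partial_deriv i u x * h $ i)) (at x)"
proof -
  let ?D = "frechet_derivative u (at x)"
  have D: "(u has_derivative ?D) (at x)" using assms frechet_derivative_works by blast
  then interpret bounded_linear ?D by (rule has_derivative_bounded_linear)
  have "?D h = (\<Sum>i\<in>UNIV. partial_deriv i u x * h $ i)" for h
  proof -
    have "?D h = ?D (\<Sum>i\<in>UNIV. (h $ i) *\<^sub>R axis i 1)"
      using basis_expansion[of h] by (simp add: scalar_mult_eq_scaleR)
    also have "\<dots> = (\<Sum>i\<in>UNIV. partial_deriv i u x * h $ i)"
      by (simp add: sum scale partial_deriv_def mult.commute)
    finally show ?thesis .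
  qed
  then show ?thesis using D by (metis (no_types, lifting) ext)
qed

lemma partial_deriv_eqI:
  fixes u :: "real ^ 'n \<Rightarrow> real"
  assumes "(u has_derivative D) (at x)"
  shows "partial_deriv i u x = D (axis i 1)"
  using frechet_derivative_at[OF assms] by (simp add: partial_deriv_def)

lemma iter_partial_lincomb:
  fixes u v :: "real ^ 'n \<Rightarrow> real"
  assumes "open S" "smooth_on S u" "smooth_on S v" "x \<in> S"
  shows "iter_partial is (\<lambda>y. a * u y + b * v y) x = a * iter_partial is u x + b * iter_partial is v x"
  using assms(4)
proof (induction "is" arbitrary: x)
  case (Cons i "is")
  have D: "(iter_partial is u has_derivative frechet_derivative (iter_partial is u) (at x)) (at x)"
    "(iter_partial is v has_derivative frechet_derivative (iter_partial is v) (at x)) (at x)"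
    using smooth_onD[OF assms(2) Cons.prems] smooth_onD[OF assms(3) Cons.prems]
    by (simp_all add: frechet_derivative_works)
  have "partial_deriv i (iter_partial is (\<lambda>y. a * u y + b * v y)) x =
      partial_deriv i (\<lambda>y. a * iter_partial is u y + b * iter_partial is v y) x"
    by (rule partial_deriv_cong[OF assms(1) Cons.prems Cons.IH])
  also have "\<dots> = a * partial_deriv i (iter_partial is u) x + b * partial_deriv i (iter_partial is v) x"
    unfolding partial_deriv_def[of i "iter_partial is u"] partial_deriv_def[of i "iter_partial is v"]
    by (rule partial_deriv_eqI) (intro has_derivative_add has_derivative_mult_right D)
  finally show ?case by simp
qed simp

lemma smooth_on_lincomb:
  fixes u v :: "real ^ 'n \<Rightarrow> real"
  assumes "open S" "smooth_on S u" "smooth_on S v"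
  shows "smooth_on S (\<lambda>y. a * u y + b * v y)"
  unfolding smooth_on_def
proof (intro allI ballI)
  fix "is" x assume x: "x \<in> S"
  have "(\<lambda>y. a * iter_partial is u y + b * iter_partial is v y) differentiable (at x)"
    using smooth_onD[OF assms(2) x] smooth_onD[OF assms(3) x] by (intro derivative_intros) auto
  then obtain D where "((\<lambda>y. a * iter_partial is u y + b * iter_partial is v y) has_derivative D) (at x)"
    by (auto simp: differentiable_def)
  then have "(iter_partial is (\<lambda>y. a * u y + b * v y) has_derivative D) (at x)"
    by (rule has_derivative_transform_within_open[OF _ assms(1) x])
      (simp add: iter_partial_lincomb[OF assms])
  then show "iter_partial is (\<lambda>y. a * u y + b * v y) differentiable (at x)"
    by (auto simp: differentiable_def)
qed

lemma DERIV_along_axis: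
  fixes u :: "real ^ 'n \<Rightarrow> real"
  assumes "u differentiable (at (x + t *\<^sub>R axis i 1))"
  shows "((\<lambda>t. u (x + t *\<^sub>R axis i 1)) has_real_derivative partial_deriv i u (x + t *\<^sub>R axis i 1)) (at t)"
proof -
  let ?D = "frechet_derivative u (at (x + t *\<^sub>R axis i 1))"
  have D: "(u has_derivative ?D) (at (x + t *\<^sub>R axis i 1))" using assms frechet_derivative_works by blast
  then interpret bounded_linear ?D by (rule has_derivative_bounded_linear)
  have "((\<lambda>t. x + t *\<^sub>R axis i 1) has_derivative (\<lambda>t. t *\<^sub>R axis i 1)) (at t)"
    by (auto intro!: derivative_eq_intros)
  from has_derivative_compose[OF this D]
  have "((\<lambda>t. u (x + t *\<^sub>R axis i 1)) has_derivative (\<lambda>t. ?D (t *\<^sub>R axis i 1))) (at t)" .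
  then show ?thesis
    by (simp add: has_field_derivative_def scale partial_deriv_def mult.commute[of _ "?D _"])
qed

text \<open>The mean value theorem is applied in direction i to a difference in direction j, and
  then in direction j to the resulting derivative. The second difference on the left is symmetric in
  i and j, which makes it the tool for Schwarz' theorem.\<close>

lemma mixed_difference:
  fixes f :: "real ^ 'n \<Rightarrow> real"
  assumes diff: "\<And>y. y \<in> ball x d \<Longrightarrow> f differentiable (at y)"
      "\<And>y. y \<in> ball x d \<Longrightarrow> partial_deriv i f differentiable (at y)"
    and h: "0 < h" "2 * h < d"
  shows "\<exists>y. dist x y < 2 * h \<and>
    f (x + h *\<^sub>R axis i 1 + h *\<^sub>R axis j 1) - f (x + h *\<^sub>R axis i 1) - f (x + h *\<^sub>R axis j 1) + f x
      = h * h * partial_deriv j (partial_deriv i f) y"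
proof -
  have near: "dist x (x + s *\<^sub>R axis i 1 + t *\<^sub>R axis j 1) \<le> s + t" if "0 \<le> s" "0 \<le> t" for s t
    using norm_triangle_ineq[of "s *\<^sub>R axis i (1::real)" "t *\<^sub>R axis j 1"] that
    by (simp add: dist_norm norm_minus_commute algebra_simps)
  have near2: "dist x (x + t *\<^sub>R axis j 1 + s *\<^sub>R axis i 1) \<le> s + t" if "0 \<le> s" "0 \<le> t" for s t
    using near[OF that] by (simp add: algebra_simps)
  let ?g = "\<lambda>s. f ((x + h *\<^sub>R axis j 1) + s *\<^sub>R axis i 1) - f (x + s *\<^sub>R axis i 1)"
  let ?g' = "\<lambda>s. partial_deriv i f ((x + h *\<^sub>R axis j 1) + s *\<^sub>R axis i 1) - partial_deriv i f (x + s *\<^sub>R axis i 1)"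
  have "\<exists>s>0. s < h \<and> ?g h - ?g 0 = (h - 0) * ?g' s"
  proof (rule MVT2[OF h(1)])
    fix s assume s: "0 \<le> s" "s \<le> h"
    have "f differentiable (at ((x + h *\<^sub>R axis j 1) + s *\<^sub>R axis i 1))"
      by (rule diff(1)) (use near2[of s h] s h in auto)
    moreover have "f differentiable (at (x + s *\<^sub>R axis i 1))"
      by (rule diff(1)) (use near[of s 0] s h in auto)
    ultimately show "(?g has_real_derivative ?g' s) (at s)"
      by (intro DERIV_diff DERIV_along_axis)
  qed
  then obtain s where s: "0 < s" "s < h" and 1: "?g h - ?g 0 = h * ?g' s" by auto
  let ?k = "\<lambda>t. partial_deriv i f (x + s *\<^sub>R axis i 1 + t *\<^sub>R axis j 1)"
  let ?k' = "\<lambda>t. partial_deriv j (partial_deriv i f) (x + s *\<^sub>R axis i 1 + t *\<^sub>R axis j 1)"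
  have "\<exists>t>0. t < h \<and> ?k h - ?k 0 = (h - 0) * ?k' t"
  proof (rule MVT2[OF h(1)])
    fix t assume t: "0 \<le> t" "t \<le> h"
    have "partial_deriv i f differentiable (at (x + s *\<^sub>R axis i 1 + t *\<^sub>R axis j 1))"
      by (rule diff(2)) (use near[of s t] s t h in auto)
    then show "(?k has_real_derivative ?k' t) (at t)" by (rule DERIV_along_axis)
  qed
  then obtain t where t: "0 < t" "t < h" and 2: "?k h - ?k 0 = h * ?k' t" by auto
  have "?g' s = ?k h - ?k 0" by (simp add: algebra_simps)
  with 1 2 have "?g h - ?g 0 = h * (h * ?k' t)" by simp
  moreover have "?g h - ?g 0 =
      f (x + h *\<^sub>R axis i 1 + h *\<^sub>R axis j 1) - f (x + h *\<^sub>R axis i 1) - f (x + h *\<^sub>R axis j 1) + f x"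
    by (simp add: algebra_simps)
  moreover have "dist x (x + s *\<^sub>R axis i 1 + t *\<^sub>R axis j 1) < 2 * h" using near[of s t] s t by auto
  ultimately show ?thesis by (auto simp: mult.assoc)
qed

text \<open>Both mixed derivatives take the same value, a normalized second difference, at points
  within 2h of x. As h tends to 0 their continuity at x, which comes from differentiability at the
  next order, gives equality at x.\<close>

lemma partial_deriv_commute:
  fixes f :: "real ^ 'n \<Rightarrow> real"
  assumes "open S" "x \<in> S" "smooth_on S f"
  shows "partial_deriv i (partial_deriv j f) x = partial_deriv j (partial_deriv i f) x"
proof -
  obtain d where d: "d > 0" "ball x d \<subseteq> S" using assms(1,2) openE by blast
  have diff: "f differentiable (at y)" "partial_deriv i f differentiable (at y)" "partial_deriv j f differentiable (at y)"
    if "y \<in> ball x d" for y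
    using assms(3) d that smooth_onD[of S f y "[]"] smooth_onD[of S f y "[i]"] smooth_onD[of S f y "[j]"] by auto
  let ?A = "partial_deriv i (partial_deriv j f)"
  let ?B = "partial_deriv j (partial_deriv i f)"
  have cont: "isCont ?A x" "isCont ?B x"
    using smooth_onD[OF assms(3,2), of "[i,j]"] smooth_onD[OF assms(3,2), of "[j,i]"]
    by (auto intro: differentiable_imp_continuous_within)
  have "dist (?A x) (?B x) \<le> e" if e: "e > 0" for e
  proof -
    obtain \<delta>1 where 1: "\<delta>1 > 0" "\<And>y. dist y x < \<delta>1 \<Longrightarrow> dist (?A y) (?A x) < e / 2"
      using cont(1) e unfolding continuous_at_eps_delta by (meson half_gt_zero)
    obtain \<delta>2 where 2: "\<delta>2 > 0" "\<And>y. dist y x < \<delta>2 \<Longrightarrow> dist (?B y) (?B x) < e / 2"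
      using cont(2) e unfolding continuous_at_eps_delta by (meson half_gt_zero)
    define h where "h = min d (min \<delta>1 \<delta>2) / 4"
    have h: "0 < h" "2 * h < d" "2 * h < \<delta>1" "2 * h < \<delta>2" using d 1 2 by (auto simp: h_def)
    obtain y z where yz: "dist x y < 2 * h" "dist x z < 2 * h"
      "f (x + h *\<^sub>R axis j 1 + h *\<^sub>R axis i 1) - f (x + h *\<^sub>R axis j 1) - f (x + h *\<^sub>R axis i 1) + f x = h * h * ?A y"
      "f (x + h *\<^sub>R axis i 1 + h *\<^sub>R axis j 1) - f (x + h *\<^sub>R axis i 1) - f (x + h *\<^sub>R axis j 1) + f x = h * h * ?B z"
      using mixed_difference[OF diff(1,3) h(1,2), where j = i] mixed_difference[OF diff(1,2) h(1,2), where j = j] by blast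
    have eq: "x + h *\<^sub>R axis j 1 + h *\<^sub>R axis i 1 = x + h *\<^sub>R axis i 1 + h *\<^sub>R axis j 1" by simp
    have "h * h * ?A y = h * h * ?B z"
      unfolding yz(3)[symmetric] yz(4)[symmetric] eq by (simp only: diff_right_commute)
    then have "?A y = ?B z" using h by simp
    moreover have "dist (?A y) (?A x) < e / 2" "dist (?B z) (?B x) < e / 2"
      using 1(2)[of y] 2(2)[of z] yz(1,2) h by (auto simp: dist_commute)
    ultimately show ?thesis by (simp add: dist_real_def abs_if split: if_splits)
  qed
  then have "dist (?A x) (?B x) \<le> 0" by (rule field_le_epsilon) simp
  then show ?thesis by simp
qed

lemma iter_partial_move:
  fixes u :: "real ^ 'n \<Rightarrow> real"
  assumes "open S" "smooth_on S u" "x \<in> S"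
  shows "iter_partial (js @ i # ks) u x = iter_partial (i # js @ ks) u x"
  using assms(3)
proof (induction js arbitrary: x)
  case (Cons a js)
  have "iter_partial ((a # js) @ i # ks) u x = partial_deriv a (iter_partial (i # js @ ks) u) x"
    using partial_deriv_cong[OF assms(1) Cons.prems Cons.IH] by simp
  also have "\<dots> = partial_deriv i (partial_deriv a (iter_partial (js @ ks) u)) x"
    using partial_deriv_commute[OF assms(1) Cons.prems smooth_on_iter_partial[OF assms(2)]] by simp
  finally show ?case by simp
qed simp

lemma iter_partial_mset:
  fixes u :: "real ^ 'n \<Rightarrow> real"
  assumes "open S" "smooth_on S u" "x \<in> S" "mset is = mset js"
  shows "iter_partial is u x = iter_partial js u x"
  using assms(3,4)
proof (induction "is" arbitrary: js x)
  case (Cons i "is")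
  then have "i \<in> set js" by (metis list.set_intros(1) set_mset_mset)
  then obtain as bs where js: "js = as @ i # bs" by (meson split_list)
  with Cons.prems(2) have "mset is = mset (as @ bs)" by simp
  then have "partial_deriv i (iter_partial is u) x = partial_deriv i (iter_partial (as @ bs) u) x"
    using Cons.IH by (intro partial_deriv_cong[OF assms(1) Cons.prems(1)]) blast
  then show ?case using iter_partial_move[OF assms(1,2) Cons.prems(1), of as i bs] js by simp
qed simp

text \<open>The list picked by \<^const>\<open>multi_deriv\<close> is unspecified; Schwarz' theorem makes the choice immaterial.\<close>

lemma multi_deriv_eq:
  fixes u :: "real ^ 'n \<Rightarrow> real"
  assumes "open S" "smooth_on S u" "x \<in> S"
  shows "multi_deriv (count_list is) u x = iter_partial is u x"
proof -
  have "\<forall>i. count_list (SOME js. \<forall>i. count_list js i = count_list is i) i = count_list is i"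
    by (rule someI[of "\<lambda>js. \<forall>i. count_list js i = count_list is i" "is"]) simp
  then have "mset (SOME js. \<forall>i. count_list js i = count_list is i) = mset is"
    by (intro multiset_eqI) (simp add: count_mset)
  then show ?thesis unfolding multi_deriv_def by (rule iter_partial_mset[OF assms])
qed

section \<open>Mean value estimates\<close>

lemma mvt_segment:
  fixes f :: "real ^ 'n \<Rightarrow> real"
  assumes "\<And>z. z \<in> closed_segment a b \<Longrightarrow> f differentiable (at z)"
  shows "\<exists>z\<in>closed_segment a b. f b - f a = (\<Sum>i\<in>UNIV. partial_deriv i f z * (b - a) $ i)"
proof -
  let ?p = "\<lambda>t. a + t *\<^sub>R (b - a)"
  have p: "?p t \<in> closed_segment a b" if "0 \<le> t" "t \<le> 1" for t
    unfolding in_segment using that by (intro exI[of _ t]) (simp add: algebra_simps)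
  have "\<exists>t>0. t < 1 \<and> f (?p 1) - f (?p 0) = (1 - 0) * (\<Sum>i\<in>UNIV. partial_deriv i f (?p t) * (b - a) $ i)"
  proof (rule MVT2)
    fix t :: real assume t: "0 \<le> t" "t \<le> 1"
    have "(?p has_derivative (\<lambda>t. t *\<^sub>R (b - a))) (at t)"
      by (auto intro!: derivative_eq_intros)
    from has_derivative_compose[OF this has_derivative_partial_deriv[OF assms[OF p[OF t]]]]
    have "((\<lambda>t. f (?p t)) has_derivative
      (\<lambda>s. \<Sum>i\<in>UNIV. partial_deriv i f (?p t) * (s *\<^sub>R (b - a)) $ i)) (at t)" .
    moreover have "(\<lambda>s. \<Sum>i\<in>UNIV. partial_deriv i f (?p t) * (s *\<^sub>R (b - a)) $ i) =
      (*) (\<Sum>i\<in>UNIV. partial_deriv i f (?p t) * (b - a) $ i)"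
      by (rule ext) (simp add: sum_distrib_left mult_ac)
    ultimately show "((\<lambda>t. f (?p t)) has_real_derivative (\<Sum>i\<in>UNIV. partial_deriv i f (?p t) * (b - a) $ i)) (at t)"
      by (simp only: has_field_derivative_def)
  qed simp
  then show ?thesis using p by force
qed

text \<open>The derivative at x differs from the difference quotient of step h by at most h times a
  bound on the second derivative. The free choice of h is what \<open>negligible_derivatives\<close>
  exploits.\<close>

lemma partial_deriv_bound:
  fixes f :: "real ^ 'n \<Rightarrow> real"
  assumes diff: "\<And>z. dist x z \<le> h \<Longrightarrow> f differentiable (at z)"
      "\<And>z. dist x z \<le> h \<Longrightarrow> partial_deriv i f differentiable (at z)"
    and B: "\<And>z. dist x z \<le> h \<Longrightarrow> \<bar>partial_deriv i (partial_deriv i f) z\<bar> \<le> B"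
    and h: "0 < h"
  shows "\<bar>partial_deriv i f x\<bar> \<le> \<bar>f (x + h *\<^sub>R axis i 1) - f x\<bar> / h + h * B"
proof -
  have near: "dist x (x + t *\<^sub>R axis i 1) \<le> h" if "0 \<le> t" "t \<le> h" for t
    using that by (simp add: dist_norm)
  have "\<exists>s>0. s < h \<and> f (x + h *\<^sub>R axis i 1) - f (x + 0 *\<^sub>R axis i 1) = (h - 0) * partial_deriv i f (x + s *\<^sub>R axis i 1)"
    by (rule MVT2[OF h], rule DERIV_along_axis, rule diff(1), rule near)
  then obtain s where s: "0 < s" "s < h" "f (x + h *\<^sub>R axis i 1) - f x = h * partial_deriv i f (x + s *\<^sub>R axis i 1)"
    by auto
  have "\<exists>t>0. t < s \<and> partial_deriv i f (x + s *\<^sub>R axis i 1) - partial_deriv i f (x + 0 *\<^sub>R axis i 1)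
      = (s - 0) * partial_deriv i (partial_deriv i f) (x + t *\<^sub>R axis i 1)"
    by (rule MVT2[OF s(1)], rule DERIV_along_axis, rule diff(2), rule near) (use s in auto)
  then obtain t where t: "0 < t" "t < s" "partial_deriv i f (x + s *\<^sub>R axis i 1) - partial_deriv i f x
      = s * partial_deriv i (partial_deriv i f) (x + t *\<^sub>R axis i 1)"
    by auto
  have "\<bar>s * partial_deriv i (partial_deriv i f) (x + t *\<^sub>R axis i 1)\<bar> \<le> h * B"
    unfolding abs_mult using s t B[OF near[of t]] by (intro mult_mono) auto
  moreover have "partial_deriv i f (x + s *\<^sub>R axis i 1) = (f (x + h *\<^sub>R axis i 1) - f x) / h"
    using s(3) h by simp
  moreover have "\<bar>(f (x + h *\<^sub>R axis i 1) - f x) / h\<bar> = \<bar>f (x + h *\<^sub>R axis i 1) - f x\<bar> / h"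
    using h by simp
  ultimately show ?thesis using t(3) by linarith
qed

section \<open>Strongly internal sets and generalized smooth functions\<close>

lemma strongly_internalD:
  "x \<in> strongly_internal_set A \<Longrightarrow> represents \<xi> x \<Longrightarrow> \<forall>\<^sub>F \<epsilon> in at_right 0. \<xi> \<epsilon> \<in> A \<epsilon>"
  by (auto simp: strongly_internal_set_def)

text \<open>Allows results on internal sets, in particular
  \<open>dist_complement_lower_bound\<close>, to be applied to a single point.\<close>

lemma internal_set_singleton:
  assumes "represents \<xi> x"
  shows "internal_set (\<lambda>\<epsilon>. {\<xi> \<epsilon>}) = {x}"
proof -
  have *: "y = x" if y: "represents \<eta> y" "\<forall>\<^sub>F \<epsilon> in at_right 0. \<eta> \<epsilon> = \<xi> \<epsilon>" for \<eta> y
  proof -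
    have "negligible_net (\<lambda>\<epsilon>. \<xi> \<epsilon> - \<eta> \<epsilon>)"
      by (rule negligible_net_eventually_le[OF negligible_net_zero[where ?'a = real]])
        (use y(2) in eventually_elim, simp)
    from represents_unique[OF represents_cong[OF assms this] y(1)] show ?thesis by simp
  qed
  show ?thesis
  proof (intro set_eqI iffI)
    fix y assume "y \<in> internal_set (\<lambda>\<epsilon>. {\<xi> \<epsilon>})"
    then obtain \<eta> where "represents \<eta> y" "\<forall>\<^sub>F \<epsilon> in at_right 0. \<eta> \<epsilon> = \<xi> \<epsilon>"
      unfolding internal_set_def by auto
    from *[OF this] show "y \<in> {x}" by simp
  next
    fix y assume "y \<in> {x}"
    then have "represents \<xi> y \<and> (\<forall>\<^sub>F \<epsilon> in at_right 0. \<xi> \<epsilon> \<in> {\<xi> \<epsilon>})" using assms by simp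
    then show "y \<in> internal_set (\<lambda>\<epsilon>. {\<xi> \<epsilon>})" unfolding internal_set_def by blast
  qed
qed

text \<open>Nonemptiness supplies the values of the glued net off S, and the norm bound makes the
  glued net moderate, so that it has a class at all.\<close>

lemma dist_complement_lower_bound:
  fixes Ue Le :: "real \<Rightarrow> 'a::real_normed_vector set"
  assumes sub: "internal_set Le \<subseteq> strongly_internal_set Ue" and ne: "internal_set Le \<noteq> {}"
    and bd: "\<forall>\<^sub>F \<epsilon> in at_right 0. \<forall>x\<in>Le \<epsilon>. norm x \<le> \<epsilon> powr (- M)"
  shows "\<exists>m::nat. \<forall>\<^sub>F \<epsilon> in at_right 0. \<forall>x\<in>Le \<epsilon>. \<forall>a. a \<notin> Ue \<epsilon> \<longrightarrow> \<epsilon> ^ m \<le> dist x a"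
proof (rule ccontr)
  define P where "P m \<epsilon> \<longleftrightarrow> (\<exists>x\<in>Le \<epsilon>. \<exists>a. a \<notin> Ue \<epsilon> \<and> dist x a < \<epsilon> ^ m)" for m :: nat and \<epsilon>
  assume no: "\<not> ?thesis"
  have "\<exists>\<^sub>F \<epsilon> in at_right 0. P m \<epsilon>" for m
  proof (rule ccontr)
    assume "\<not> (\<exists>\<^sub>F \<epsilon> in at_right 0. P m \<epsilon>)"
    then have "\<forall>\<^sub>F \<epsilon> in at_right 0. \<not> P m \<epsilon>" by (simp only: not_frequently)
    then have "\<forall>\<^sub>F \<epsilon> in at_right 0. \<forall>x\<in>Le \<epsilon>. \<forall>a. a \<notin> Ue \<epsilon> \<longrightarrow> \<epsilon> ^ m \<le> dist x a"
      by (rule eventually_mono) (unfold P_def, meson not_less)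
    with no show False by blast
  qed
  then obtain S k where S: "\<exists>\<^sub>F \<epsilon> in at_right 0. \<epsilon> \<in> S" "\<And>\<epsilon>. \<epsilon> \<in> S \<Longrightarrow> P (k \<epsilon>) \<epsilon>"
    "\<And>m::nat. \<forall>\<^sub>F \<epsilon> in at_right 0. \<epsilon> \<in> S \<longrightarrow> m \<le> k \<epsilon>" by (rule diagonal_subnet[of P]) blast
  have "\<forall>\<epsilon>\<in>S. \<exists>x a. x \<in> Le \<epsilon> \<and> a \<notin> Ue \<epsilon> \<and> dist x a < \<epsilon> ^ k \<epsilon>"
    using S(2) unfolding P_def by blast
  then obtain X A where XA: "\<And>\<epsilon>. \<epsilon> \<in> S \<Longrightarrow> X \<epsilon> \<in> Le \<epsilon> \<and> A \<epsilon> \<notin> Ue \<epsilon> \<and> dist (X \<epsilon>) (A \<epsilon>) < \<epsilon> ^ k \<epsilon>"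
    by metis
  obtain y \<eta> where \<eta>: "represents \<eta> y" "\<forall>\<^sub>F \<epsilon> in at_right 0. \<eta> \<epsilon> \<in> Le \<epsilon>"
    using ne by (auto simp: internal_set_def)
  \<comment> \<open>The net \<xi> stays in \<open>Le\<close>, so its class lies in the strongly
    internal set. The net \<xi>' leaves \<open>Ue\<close> on S, yet differs from \<xi> by less than
    \<epsilon>^k with k tending to infinity along S, and so represents the same class.\<close>
  define \<xi> where "\<xi> \<epsilon> = (if \<epsilon> \<in> S then X \<epsilon> else \<eta> \<epsilon>)" for \<epsilon>
  define \<xi>' where "\<xi>' \<epsilon> = (if \<epsilon> \<in> S then A \<epsilon> else \<eta> \<epsilon>)" for \<epsilon>
  have L: "\<forall>\<^sub>F \<epsilon> in at_right 0. \<xi> \<epsilon> \<in> Le \<epsilon>"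
    using \<eta>(2) by eventually_elim (use XA in \<open>auto simp: \<xi>_def\<close>)
  have "moderate \<xi>"
    by (rule moderate_eventually_le[OF moderate_powr[of "- M"]])
      (use L bd in eventually_elim, auto)
  then have \<xi>: "represents \<xi> (abs_gen \<xi>)" by (rule represents_abs)
  have "negligible_net (\<lambda>\<epsilon>. \<xi> \<epsilon> - \<xi>' \<epsilon>)"
    unfolding negligible_net_iff
  proof
    fix m
    show "\<forall>\<^sub>F \<epsilon> in at_right 0. norm (\<xi> \<epsilon> - \<xi>' \<epsilon>) \<le> \<epsilon> ^ m"
      using S(3)[of m] eventually_unit_interval
    proof eventually_elim
      case (elim \<epsilon>)
      show ?case
      proof (cases "\<epsilon> \<in> S")
        case True
        then have "norm (\<xi> \<epsilon> - \<xi>' \<epsilon>) < \<epsilon> ^ k \<epsilon>" using XA[of \<epsilon>] by (simp add: \<xi>_def \<xi>'_def dist_norm)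
        also have "\<epsilon> ^ k \<epsilon> \<le> \<epsilon> ^ m" using elim True by (intro power_decreasing) auto
        finally show ?thesis by simp
      qed (use elim in \<open>simp add: \<xi>_def \<xi>'_def\<close>)
    qed
  qed
  from represents_cong[OF \<xi> this] have "represents \<xi>' (abs_gen \<xi>)" .
  moreover have "abs_gen \<xi> \<in> strongly_internal_set Ue"
    using sub \<xi> L by (auto simp: internal_set_def)
  ultimately have "\<forall>\<^sub>F \<epsilon> in at_right 0. \<xi>' \<epsilon> \<in> Ue \<epsilon>" by (rule strongly_internalD[rotated])
  then have "\<exists>\<^sub>F \<epsilon> in at_right (0::real). False"
    by (intro frequently_rev_mp[OF S(1)], eventually_elim) (use XA in \<open>auto simp: \<xi>'_def\<close>)
  then show False by simp
qed

text \<open>Sharp openness in terms of nets, for use with nets of points chosen separately for each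
  \<epsilon>. It is the distance bound for a single point.\<close>

lemma strongly_internal_sharply_open:
  fixes Ue :: "real \<Rightarrow> 'a::real_normed_vector set"
  assumes x: "x \<in> strongly_internal_set Ue" "represents \<xi> x"
  shows "\<exists>m::nat. \<forall>\<zeta>. (\<forall>\<^sub>F \<epsilon> in at_right 0. dist (\<xi> \<epsilon>) (\<zeta> \<epsilon>) < \<epsilon> ^ m) \<longrightarrow>
    moderate \<zeta> \<and> abs_gen \<zeta> \<in> strongly_internal_set Ue"
proof -
  obtain M :: nat where M: "\<forall>\<^sub>F \<epsilon> in at_right 0. norm (\<xi> \<epsilon>) \<le> \<epsilon> powr (- real M)"
    using x(2) by (auto simp: represents_def moderate_iff)
  have "\<exists>m::nat. \<forall>\<^sub>F \<epsilon> in at_right 0. \<forall>x\<in>{\<xi> \<epsilon>}. \<forall>a. a \<notin> Ue \<epsilon> \<longrightarrow> \<epsilon> ^ m \<le> dist x a"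
    by (rule dist_complement_lower_bound[where M = "real M"]) (use x M in \<open>simp_all add: internal_set_singleton\<close>)
  then obtain m where m: "\<forall>\<^sub>F \<epsilon> in at_right 0. \<forall>a. a \<notin> Ue \<epsilon> \<longrightarrow> \<epsilon> ^ m \<le> dist (\<xi> \<epsilon>) a" by auto
  show ?thesis
  \<comment> \<open>The complement is at distance at least \<epsilon>^m. The smaller radius leaves
    room for a second error of the same size, caused by replacing \<zeta> with another
    representative.\<close>
  proof (rule exI[of _ "Suc m"], intro allI impI)
    fix \<zeta> assume \<zeta>: "\<forall>\<^sub>F \<epsilon> in at_right 0. dist (\<xi> \<epsilon>) (\<zeta> \<epsilon>) < \<epsilon> ^ Suc m"
    have "moderate (\<lambda>\<epsilon>. \<xi> \<epsilon> - \<zeta> \<epsilon>)"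
      by (rule moderate_eventually_le[OF moderate_const[of "1::real"]], use \<zeta> eventually_unit_interval in eventually_elim)
        (simp add: dist_norm[symmetric], meson less_eq_real_def less_trans mult_le_one order_trans power_le_one zero_le_power)
    from moderate_diff[OF represents_moderate[OF x(2)] this] have mod: "moderate \<zeta>" by simp
    have "\<forall>\<^sub>F \<epsilon> in at_right 0. \<zeta>' \<epsilon> \<in> Ue \<epsilon>" if "represents \<zeta>' (abs_gen \<zeta>)" for \<zeta>'
    proof -
      have "\<forall>\<^sub>F \<epsilon> in at_right 0. norm (\<zeta> \<epsilon> - \<zeta>' \<epsilon>) \<le> \<epsilon> ^ Suc m"
        using represents_negligible[OF represents_abs[OF mod] that] unfolding negligible_net_iff by blast
      moreover have "\<forall>\<^sub>F \<epsilon> in at_right 0. 0 < \<epsilon> \<and> \<epsilon> < (1/2 :: real)" by (rule eventually_small) simp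
      ultimately show ?thesis using \<zeta> m
      proof eventually_elim
        case (elim \<epsilon>)
        have "dist (\<xi> \<epsilon>) (\<zeta>' \<epsilon>) \<le> dist (\<xi> \<epsilon>) (\<zeta> \<epsilon>) + norm (\<zeta> \<epsilon> - \<zeta>' \<epsilon>)"
          unfolding dist_norm[symmetric] by (rule dist_triangle)
        also have "\<dots> < 2 * \<epsilon> ^ Suc m" using elim by linarith
        also have "\<dots> \<le> \<epsilon> ^ m" by (rule two_power_Suc_le) (use elim in auto)
        finally show ?case using elim by force
      qed
    qed
    then show "moderate \<zeta> \<and> abs_gen \<zeta> \<in> strongly_internal_set Ue"
      using mod by (auto simp: strongly_internal_set_def)
  qed
qed

text \<open>A point on the segment is no farther from \<xi> than \<xi>' is, so every net of such
  points is again a representative of x.\<close>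

lemma strongly_internal_segment:
  fixes A :: "real \<Rightarrow> 'a::real_normed_vector set"
  assumes "x \<in> strongly_internal_set A" "represents \<xi> x" "represents \<xi>' x"
  shows "\<forall>\<^sub>F \<epsilon> in at_right 0. closed_segment (\<xi> \<epsilon>) (\<xi>' \<epsilon>) \<subseteq> A \<epsilon>"
    and "(\<And>\<epsilon>. \<zeta> \<epsilon> \<in> closed_segment (\<xi> \<epsilon>) (\<xi>' \<epsilon>)) \<Longrightarrow> represents \<zeta> x"
proof -
  have *: "represents \<zeta> x" if \<zeta>: "\<And>\<epsilon>. \<zeta> \<epsilon> \<in> closed_segment (\<xi> \<epsilon>) (\<xi>' \<epsilon>)" for \<zeta>
  proof (rule represents_cong[OF assms(2)],
      rule negligible_net_eventually_le[OF represents_negligible[OF assms(2,3)]], intro always_eventually allI)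
    fix \<epsilon> show "norm (\<xi> \<epsilon> - \<zeta> \<epsilon>) \<le> norm (\<xi> \<epsilon> - \<xi>' \<epsilon>)"
      using segment_bound1[OF \<zeta>[of \<epsilon>]] by (simp add: norm_minus_commute)
  qed
  then show "(\<And>\<epsilon>. \<zeta> \<epsilon> \<in> closed_segment (\<xi> \<epsilon>) (\<xi>' \<epsilon>)) \<Longrightarrow> represents \<zeta> x" .
  \<comment> \<open>The point lies outside A wherever the segment is not contained in A. Being a
    representative of x, the net must lie in A for small \<epsilon>, and then so does the whole
    segment.\<close>
  define \<zeta> where "\<zeta> \<epsilon> = (SOME z. z \<in> closed_segment (\<xi> \<epsilon>) (\<xi>' \<epsilon>) \<and>
    (closed_segment (\<xi> \<epsilon>) (\<xi>' \<epsilon>) \<subseteq> A \<epsilon> \<or> z \<notin> A \<epsilon>))" for \<epsilon>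
  have \<zeta>: "\<zeta> \<epsilon> \<in> closed_segment (\<xi> \<epsilon>) (\<xi>' \<epsilon>) \<and>
    (closed_segment (\<xi> \<epsilon>) (\<xi>' \<epsilon>) \<subseteq> A \<epsilon> \<or> \<zeta> \<epsilon> \<notin> A \<epsilon>)" for \<epsilon>
    unfolding \<zeta>_def by (rule someI_ex) blast
  from * \<zeta> have "represents \<zeta> x" by blast
  from strongly_internalD[OF assms(1) this]
  show "\<forall>\<^sub>F \<epsilon> in at_right 0. closed_segment (\<xi> \<epsilon>) (\<xi>' \<epsilon>) \<subseteq> A \<epsilon>"
    by eventually_elim (use \<zeta> in blast)
qed

text \<open>The part of \<open>defining_net\<close> that does not refer to the values of a function,
  so that it also applies to differences of defining nets. Indexing derivatives by lists makes a
  further differentiation a mere \<open>i # is\<close>.\<close>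

definition moderate_smooth_net ::
  "(real \<Rightarrow> (real ^ 'n) set) \<Rightarrow> (real \<Rightarrow> real ^ 'n \<Rightarrow> real) \<Rightarrow> (real ^ 'n) gen set \<Rightarrow> bool" where
  "moderate_smooth_net \<Omega> w X \<longleftrightarrow>
    (\<forall>\<epsilon>\<in>{0<..1}. open (\<Omega> \<epsilon>) \<and> smooth_on (\<Omega> \<epsilon>) (w \<epsilon>)) \<and> X \<subseteq> strongly_internal_set \<Omega> \<and>
    (\<forall>x\<in>X. \<forall>\<xi>. represents \<xi> x \<longrightarrow> (\<forall>is. moderate (\<lambda>\<epsilon>. iter_partial is (w \<epsilon>) (\<xi> \<epsilon>))))"

lemma moderate_cong_ev:
  assumes "moderate x" "\<forall>\<^sub>F \<epsilon> in at_right 0. y \<epsilon> = x \<epsilon>"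
  shows "moderate y"
  by (rule moderate_eventually_le[OF assms(1)], use assms(2) in eventually_elim) simp

lemma negligible_cong_ev:
  assumes "negligible_net x" "\<forall>\<^sub>F \<epsilon> in at_right 0. y \<epsilon> = x \<epsilon>"
  shows "negligible_net y"
  by (rule negligible_net_eventually_le[OF assms(1)], use assms(2) in eventually_elim) simp

lemma represents_cong_ev:
  assumes "represents \<xi> x" "\<forall>\<^sub>F \<epsilon> in at_right 0. \<eta> \<epsilon> = \<xi> \<epsilon>"
  shows "represents \<eta> x"
  by (rule represents_cong[OF assms(1)], rule negligible_cong_ev[OF negligible_net_zero])
    (use assms(2) in eventually_elim, simp)

lemma defining_net_moderate:
  assumes "defining_net \<Omega> u X f"
  shows "moderate_smooth_net \<Omega> u X"
  unfolding moderate_smooth_net_def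
proof (intro conjI ballI allI impI)
  fix x \<xi> "is" assume x: "x \<in> X" "represents \<xi> x"
  from assms x have "\<forall>\<^sub>F \<epsilon> in at_right 0. \<xi> \<epsilon> \<in> \<Omega> \<epsilon>"
    by (auto simp: defining_net_def dest: strongly_internalD)
  then have "\<forall>\<^sub>F \<epsilon> in at_right 0. iter_partial is (u \<epsilon>) (\<xi> \<epsilon>) = multi_deriv (count_list is) (u \<epsilon>) (\<xi> \<epsilon>)"
    using eventually_unit_interval
  proof eventually_elim
    case (elim \<epsilon>)
    then have "open (\<Omega> \<epsilon>)" "smooth_on (\<Omega> \<epsilon>) (u \<epsilon>)" using assms by (auto simp: defining_net_def)
    from multi_deriv_eq[OF this elim(1), of "is"] show ?case by simp
  qed
  moreover have "moderate (\<lambda>\<epsilon>. multi_deriv (count_list is) (u \<epsilon>) (\<xi> \<epsilon>))"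
    using assms x by (auto simp: defining_net_def)
  ultimately show "moderate (\<lambda>\<epsilon>. iter_partial is (u \<epsilon>) (\<xi> \<epsilon>))" by (rule moderate_cong_ev[rotated])
qed (use assms in \<open>auto simp: defining_net_def\<close>)

text \<open>
  By the mean value theorem the increment is controlled at a net of points on the segments from \<open>\<xi>\<close> to
  \<open>\<xi>'\<close>; such a net again represents \<open>x\<close>, where the derivatives are moderate.
\<close>

lemma iter_partial_representative_independent:
  fixes w :: "real \<Rightarrow> real ^ 'n \<Rightarrow> real"
  assumes w: "moderate_smooth_net \<Omega> w X" and x: "x \<in> X" "represents \<xi> x" "represents \<xi>' x"
  shows "negligible_net (\<lambda>\<epsilon>. iter_partial is (w \<epsilon>) (\<xi>' \<epsilon>) - iter_partial is (w \<epsilon>) (\<xi> \<epsilon>))"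
proof -
  have xO: "x \<in> strongly_internal_set \<Omega>" using w x by (auto simp: moderate_smooth_net_def)
  let ?F = "\<lambda>\<epsilon>. iter_partial is (w \<epsilon>)"
  \<comment> \<open>The mean value identity is requested only under differentiability along the
    segment, which is known for small \<epsilon>. For the other parameters any point of the segment
    serves, so \<zeta> lies on the segment for every \<epsilon>.\<close>
  define \<zeta> where "\<zeta> \<epsilon> = (SOME z. z \<in> closed_segment (\<xi> \<epsilon>) (\<xi>' \<epsilon>) \<and>
    ((\<forall>z\<in>closed_segment (\<xi> \<epsilon>) (\<xi>' \<epsilon>). ?F \<epsilon> differentiable (at z)) \<longrightarrow>
      ?F \<epsilon> (\<xi>' \<epsilon>) - ?F \<epsilon> (\<xi> \<epsilon>) = (\<Sum>i\<in>UNIV. partial_deriv i (?F \<epsilon>) z * (\<xi>' \<epsilon> - \<xi> \<epsilon>) $ i)))" for \<epsilon>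
  have \<zeta>: "\<zeta> \<epsilon> \<in> closed_segment (\<xi> \<epsilon>) (\<xi>' \<epsilon>) \<and>
    ((\<forall>z\<in>closed_segment (\<xi> \<epsilon>) (\<xi>' \<epsilon>). ?F \<epsilon> differentiable (at z)) \<longrightarrow>
      ?F \<epsilon> (\<xi>' \<epsilon>) - ?F \<epsilon> (\<xi> \<epsilon>) = (\<Sum>i\<in>UNIV. partial_deriv i (?F \<epsilon>) (\<zeta> \<epsilon>) * (\<xi>' \<epsilon> - \<xi> \<epsilon>) $ i))" for \<epsilon>
    unfolding \<zeta>_def by (rule someI_ex) (use mvt_segment[of "\<xi> \<epsilon>" "\<xi>' \<epsilon>" "?F \<epsilon>"] in \<open>blast intro: ends_in_segment\<close>)
  have "represents \<zeta> x" by (rule strongly_internal_segment(2)[OF xO x(2,3)]) (use \<zeta> in blast)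
  then have mod: "moderate (\<lambda>\<epsilon>. partial_deriv i (?F \<epsilon>) (\<zeta> \<epsilon>))" for i
  proof -
    have "moderate (\<lambda>\<epsilon>. iter_partial (i # is) (w \<epsilon>) (\<zeta> \<epsilon>))"
      using w x(1) \<open>represents \<zeta> x\<close> unfolding moderate_smooth_net_def by blast
    then show ?thesis by simp
  qed
  have neg: "negligible_net (\<lambda>\<epsilon>. (\<xi>' \<epsilon> - \<xi> \<epsilon>) $ i)" for i
    by (rule negligible_net_eventually_le[OF represents_negligible[OF x(3,2)]], intro always_eventually allI)
      (simp only: real_norm_def component_le_norm_cart)
  have "negligible_net (\<lambda>\<epsilon>. \<Sum>i\<in>A. partial_deriv i (?F \<epsilon>) (\<zeta> \<epsilon>) * (\<xi>' \<epsilon> - \<xi> \<epsilon>) $ i)" if "finite A" for A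
    using that
  proof induction
    case (insert i A)
    then show ?case
      using negligible_net_add[OF negligible_net_mult[OF neg[of i] mod[of i]] insert.IH] by (simp add: mult.commute)
  qed (simp add: negligible_net_zero)
  from this[OF finite_class.finite_UNIV] show ?thesis
  proof (rule negligible_cong_ev)
    show "\<forall>\<^sub>F \<epsilon> in at_right 0. ?F \<epsilon> (\<xi>' \<epsilon>) - ?F \<epsilon> (\<xi> \<epsilon>) = (\<Sum>i\<in>UNIV. partial_deriv i (?F \<epsilon>) (\<zeta> \<epsilon>) * (\<xi>' \<epsilon> - \<xi> \<epsilon>) $ i)"
      using strongly_internal_segment(1)[OF xO x(2,3)] eventually_unit_interval
    proof eventually_elim
      case (elim \<epsilon>)
      then have "\<forall>z\<in>closed_segment (\<xi> \<epsilon>) (\<xi>' \<epsilon>). ?F \<epsilon> differentiable (at z)"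
        using w by (auto simp: moderate_smooth_net_def intro!: smooth_onD)
      then show ?case using \<zeta> by blast
    qed
  qed
qed

text \<open>Moderateness is given net by net. If no power bounded the derivative uniformly on the
  balls of radius \<epsilon>^m, points violating \<epsilon>^(-M) for larger and larger M could be
  glued into a net near \<xi>. Its class still belongs to X, but the derivative there would not be
  moderate.\<close>

lemma moderate_uniformly_near:
  fixes w :: "real \<Rightarrow> real ^ 'n \<Rightarrow> real"
  assumes X: "X = strongly_internal_set Ue" and w: "moderate_smooth_net \<Omega> w X" and x: "x \<in> X" "represents \<xi> x"
  shows "\<exists>m M. (\<forall>\<zeta>. (\<forall>\<^sub>F \<epsilon> in at_right 0. dist (\<xi> \<epsilon>) (\<zeta> \<epsilon>) < \<epsilon> ^ m) \<longrightarrow> moderate \<zeta> \<and> abs_gen \<zeta> \<in> X) \<and>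
    (\<forall>\<^sub>F \<epsilon> in at_right 0. \<forall>z. dist (\<xi> \<epsilon>) z < \<epsilon> ^ m \<longrightarrow>
      z \<in> \<Omega> \<epsilon> \<and> \<bar>iter_partial is (w \<epsilon>) z\<bar> \<le> \<epsilon> powr (- real M))"
proof -
  obtain m :: nat where m: "\<And>\<zeta>. \<forall>\<^sub>F \<epsilon> in at_right 0. dist (\<xi> \<epsilon>) (\<zeta> \<epsilon>) < \<epsilon> ^ m \<Longrightarrow> moderate \<zeta> \<and> abs_gen \<zeta> \<in> X"
    using strongly_internal_sharply_open[OF x[unfolded X]] unfolding X by blast
  \<comment> \<open>A point of the ball outside \<Omega> is picked whenever there is one. Since the
    class of this net lies in X, for small \<epsilon> there is none.\<close>
  define \<zeta> where "\<zeta> \<epsilon> = (if \<exists>z. dist (\<xi> \<epsilon>) z < \<epsilon> ^ m \<and> z \<notin> \<Omega> \<epsilon> then SOME z. dist (\<xi> \<epsilon>) z < \<epsilon> ^ m \<and> z \<notin> \<Omega> \<epsilon>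
    else \<xi> \<epsilon>)" for \<epsilon>
  have \<zeta>: "dist (\<xi> \<epsilon>) z < \<epsilon> ^ m \<and> z \<notin> \<Omega> \<epsilon> \<Longrightarrow> dist (\<xi> \<epsilon>) (\<zeta> \<epsilon>) < \<epsilon> ^ m \<and> \<zeta> \<epsilon> \<notin> \<Omega> \<epsilon>" for z \<epsilon>
    unfolding \<zeta>_def using someI[of "\<lambda>z. dist (\<xi> \<epsilon>) z < \<epsilon> ^ m \<and> z \<notin> \<Omega> \<epsilon>" z] by auto
  have "\<forall>\<^sub>F \<epsilon> in at_right 0. dist (\<xi> \<epsilon>) (\<zeta> \<epsilon>) < \<epsilon> ^ m"
    using eventually_unit_interval
  proof eventually_elim
    case (elim \<epsilon>)
    show ?case
    proof (cases "\<exists>z. dist (\<xi> \<epsilon>) z < \<epsilon> ^ m \<and> z \<notin> \<Omega> \<epsilon>")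
      case False
      then have "\<zeta> \<epsilon> = \<xi> \<epsilon>" unfolding \<zeta>_def by (rule if_not_P)
      then show ?thesis using elim by simp
    qed (use \<zeta> in blast)
  qed
  from m[OF this] have "represents \<zeta> (abs_gen \<zeta>)" "abs_gen \<zeta> \<in> strongly_internal_set \<Omega>"
    using w by (auto simp: moderate_smooth_net_def represents_abs)
  from strongly_internalD[OF this(2,1)]
  have in_O: "\<forall>\<^sub>F \<epsilon> in at_right 0. \<forall>z. dist (\<xi> \<epsilon>) z < \<epsilon> ^ m \<longrightarrow> z \<in> \<Omega> \<epsilon>"
    by eventually_elim (use \<zeta> in blast)
  have "\<exists>M::nat. \<forall>\<^sub>F \<epsilon> in at_right 0. \<forall>z. dist (\<xi> \<epsilon>) z < \<epsilon> ^ m \<longrightarrow> \<bar>iter_partial is (w \<epsilon>) z\<bar> \<le> \<epsilon> powr (- real M)"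
  proof (rule ccontr)
    define P where "P M \<epsilon> \<longleftrightarrow> (\<exists>z. dist (\<xi> \<epsilon>) z < \<epsilon> ^ m \<and> \<epsilon> powr (- real M) < \<bar>iter_partial is (w \<epsilon>) z\<bar>)"
      for M :: nat and \<epsilon>
    assume no: "\<not> ?thesis"
    have "\<exists>\<^sub>F \<epsilon> in at_right 0. P M \<epsilon>" for M
    proof (rule ccontr)
      assume "\<not> (\<exists>\<^sub>F \<epsilon> in at_right 0. P M \<epsilon>)"
      then have "\<forall>\<^sub>F \<epsilon> in at_right 0. \<not> P M \<epsilon>" by (simp only: not_frequently)
      then have "\<forall>\<^sub>F \<epsilon> in at_right 0. \<forall>z. dist (\<xi> \<epsilon>) z < \<epsilon> ^ m \<longrightarrow> \<bar>iter_partial is (w \<epsilon>) z\<bar> \<le> \<epsilon> powr (- real M)"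
        by (rule eventually_mono) (unfold P_def, meson not_less)
      with no show False by blast
    qed
    then obtain S k where S: "\<exists>\<^sub>F \<epsilon> in at_right 0. \<epsilon> \<in> S" "\<And>\<epsilon>. \<epsilon> \<in> S \<Longrightarrow> P (k \<epsilon>) \<epsilon>"
      "\<And>m::nat. \<forall>\<^sub>F \<epsilon> in at_right 0. \<epsilon> \<in> S \<longrightarrow> m \<le> k \<epsilon>" by (rule diagonal_subnet[of P]) blast
    have "\<forall>\<epsilon>\<in>S. \<exists>z. dist (\<xi> \<epsilon>) z < \<epsilon> ^ m \<and> \<epsilon> powr (- real (k \<epsilon>)) < \<bar>iter_partial is (w \<epsilon>) z\<bar>"
      using S(2) unfolding P_def by blast
    then obtain Z where Z: "\<And>\<epsilon>. \<epsilon> \<in> S \<Longrightarrow> dist (\<xi> \<epsilon>) (Z \<epsilon>) < \<epsilon> ^ m \<and> \<epsilon> powr (- real (k \<epsilon>)) < \<bar>iter_partial is (w \<epsilon>) (Z \<epsilon>)\<bar>"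
      by metis
    define \<eta> where "\<eta> \<epsilon> = (if \<epsilon> \<in> S then Z \<epsilon> else \<xi> \<epsilon>)" for \<epsilon>
    have "\<forall>\<^sub>F \<epsilon> in at_right 0. dist (\<xi> \<epsilon>) (\<eta> \<epsilon>) < \<epsilon> ^ m"
      using eventually_unit_interval by eventually_elim (use Z in \<open>auto simp: \<eta>_def\<close>)
    from m[OF this] have "moderate (\<lambda>\<epsilon>. iter_partial is (w \<epsilon>) (\<eta> \<epsilon>))"
      using w by (auto simp: moderate_smooth_net_def represents_abs)
    then obtain M :: nat where "\<forall>\<^sub>F \<epsilon> in at_right 0. norm (iter_partial is (w \<epsilon>) (\<eta> \<epsilon>)) \<le> \<epsilon> powr (- real M)"
      by (auto simp: moderate_iff)
    then have "\<forall>\<^sub>F \<epsilon> in at_right 0. \<epsilon> \<in> S \<longrightarrow> False"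
      using S(3)[of M] eventually_unit_interval
    proof eventually_elim
      case (elim \<epsilon>)
      show ?case
      proof
        assume "\<epsilon> \<in> S"
        with elim have "\<epsilon> powr (- real M) \<le> \<epsilon> powr (- real (k \<epsilon>))" by (intro powr_mono') auto
        with elim Z[OF \<open>\<epsilon> \<in> S\<close>] \<open>\<epsilon> \<in> S\<close> show False by (simp add: \<eta>_def)
      qed
    qed
    with S(1) have "\<exists>\<^sub>F \<epsilon> in at_right (0::real). False" by (rule frequently_rev_mp)
    then show False by simp
  qed
  then obtain M :: nat where
    M: "\<forall>\<^sub>F \<epsilon> in at_right 0. \<forall>z. dist (\<xi> \<epsilon>) z < \<epsilon> ^ m \<longrightarrow> \<bar>iter_partial is (w \<epsilon>) z\<bar> \<le> \<epsilon> powr (- real M)"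
    by blast
  show ?thesis
  proof (rule exI[of _ m], rule exI[of _ M], rule conjI)
    show "\<forall>\<^sub>F \<epsilon> in at_right 0. \<forall>z. dist (\<xi> \<epsilon>) z < \<epsilon> ^ m \<longrightarrow>
        z \<in> \<Omega> \<epsilon> \<and> \<bar>iter_partial is (w \<epsilon>) z\<bar> \<le> \<epsilon> powr (- real M)"
      using M in_O by eventually_elim blast
  qed (use m in blast)
qed

text \<open>
  A difference quotient with step \<open>\<epsilon>\<^sup>q\<close> is negligible for every \<open>q\<close>, while its distance to the
  derivative is \<open>O(\<epsilon>\<^bsup>q - M\<^esup>)\<close> with \<open>M\<close> not depending on \<open>q\<close>.
\<close>

lemma negligible_derivatives:
  fixes w :: "real \<Rightarrow> real ^ 'n \<Rightarrow> real"
  assumes X: "X = strongly_internal_set Ue" and w: "moderate_smooth_net \<Omega> w X"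
    and neg: "\<And>x \<xi>. x \<in> X \<Longrightarrow> represents \<xi> x \<Longrightarrow> negligible_net (\<lambda>\<epsilon>. w \<epsilon> (\<xi> \<epsilon>))"
    and x: "x \<in> X" "represents \<xi> x"
  shows "negligible_net (\<lambda>\<epsilon>. iter_partial is (w \<epsilon>) (\<xi> \<epsilon>))"
  using x
proof (induction "is" arbitrary: x \<xi>)
  case (Cons i "is")
  let ?F = "\<lambda>\<epsilon>. iter_partial is (w \<epsilon>)"
  obtain m M where m: "\<And>\<zeta>. \<forall>\<^sub>F \<epsilon> in at_right 0. dist (\<xi> \<epsilon>) (\<zeta> \<epsilon>) < \<epsilon> ^ m \<Longrightarrow> moderate \<zeta> \<and> abs_gen \<zeta> \<in> X"
    and M: "\<forall>\<^sub>F \<epsilon> in at_right 0. \<forall>z. dist (\<xi> \<epsilon>) z < \<epsilon> ^ m \<longrightarrow>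
      z \<in> \<Omega> \<epsilon> \<and> \<bar>iter_partial (i # i # is) (w \<epsilon>) z\<bar> \<le> \<epsilon> powr (- real M)"
    using moderate_uniformly_near[OF X w Cons.prems, of "i # i # is"] by blast
  show ?case unfolding negligible_net_iff
  proof
    fix p
    \<comment> \<open>Having q > m keeps the step inside the ball where the second derivative is
      bounded. Having q - M > p makes the error \<epsilon>^(q - M) of the difference quotient at
      most \<epsilon>^(p + 1).\<close>
    define q where "q = m + M + p + 1"
    define \<zeta> where "\<zeta> \<epsilon> = \<xi> \<epsilon> + \<epsilon> ^ q *\<^sub>R axis i 1" for \<epsilon>
    have qm: "\<forall>\<^sub>F \<epsilon> in at_right (0::real). 0 < \<epsilon> \<and> \<epsilon> < 1 \<and> \<epsilon> ^ q < \<epsilon> ^ m"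
      using eventually_unit_interval by eventually_elim (auto simp: q_def simp del: power_Suc intro!: power_strict_decreasing)
    then have "\<forall>\<^sub>F \<epsilon> in at_right 0. dist (\<xi> \<epsilon>) (\<zeta> \<epsilon>) < \<epsilon> ^ m"
      by eventually_elim (simp add: \<zeta>_def dist_norm)
    from m[OF this] have \<zeta>: "abs_gen \<zeta> \<in> X" "represents \<zeta> (abs_gen \<zeta>)" by (auto simp: represents_abs)
    \<comment> \<open>The order q + (p + 1) is chosen to survive division by the step
      \<epsilon>^q.\<close>
    have 1: "\<forall>\<^sub>F \<epsilon> in at_right 0. norm (?F \<epsilon> (\<zeta> \<epsilon>)) \<le> \<epsilon> ^ (q + (p + 1))"
      using Cons.IH[OF \<zeta>] unfolding negligible_net_iff by blast
    have 2: "\<forall>\<^sub>F \<epsilon> in at_right 0. norm (?F \<epsilon> (\<xi> \<epsilon>)) \<le> \<epsilon> ^ (q + (p + 1))"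
      using Cons.IH[OF Cons.prems] unfolding negligible_net_iff by blast
    \<comment> \<open>Three terms bounded by \<epsilon>^(p + 1), two from the difference quotient
      and one from its error, have to add up to at most \<epsilon>^p.\<close>
    have 3: "\<forall>\<^sub>F \<epsilon> in at_right 0. 0 < \<epsilon> \<and> \<epsilon> < (1/3 :: real)" by (rule eventually_small) simp
    show "\<forall>\<^sub>F \<epsilon> in at_right 0. norm (iter_partial (i # is) (w \<epsilon>) (\<xi> \<epsilon>)) \<le> \<epsilon> ^ p"
      using 1 2 3 qm M
    proof eventually_elim
      case (elim \<epsilon>)
      have near: "z \<in> \<Omega> \<epsilon> \<and> \<bar>iter_partial (i # i # is) (w \<epsilon>) z\<bar> \<le> \<epsilon> powr (- real M)"
        if "dist (\<xi> \<epsilon>) z \<le> \<epsilon> ^ q" for z using elim that by (meson le_less_trans)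
      have sm: "smooth_on (\<Omega> \<epsilon>) (w \<epsilon>)" using w elim by (auto simp: moderate_smooth_net_def)
      have "\<bar>partial_deriv i (?F \<epsilon>) (\<xi> \<epsilon>)\<bar> \<le>
          \<bar>?F \<epsilon> (\<xi> \<epsilon> + \<epsilon> ^ q *\<^sub>R axis i 1) - ?F \<epsilon> (\<xi> \<epsilon>)\<bar> / \<epsilon> ^ q + \<epsilon> ^ q * \<epsilon> powr (- real M)"
      proof (rule partial_deriv_bound)
        fix z assume "dist (\<xi> \<epsilon>) z \<le> \<epsilon> ^ q"
        note near[OF this]
        then show "?F \<epsilon> differentiable (at z)" "partial_deriv i (?F \<epsilon>) differentiable (at z)"
          "\<bar>partial_deriv i (partial_deriv i (?F \<epsilon>)) z\<bar> \<le> \<epsilon> powr (- real M)"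
          using smooth_onD[OF sm, of z "is"] smooth_onD[OF sm, of z "i # is"] by auto
      qed (use elim in simp)
      moreover have "\<bar>?F \<epsilon> (\<xi> \<epsilon> + \<epsilon> ^ q *\<^sub>R axis i 1) - ?F \<epsilon> (\<xi> \<epsilon>)\<bar> / \<epsilon> ^ q \<le> 2 * \<epsilon> ^ (p + 1)"
      proof -
        have "\<bar>?F \<epsilon> (\<xi> \<epsilon> + \<epsilon> ^ q *\<^sub>R axis i 1) - ?F \<epsilon> (\<xi> \<epsilon>)\<bar> \<le> 2 * (\<epsilon> ^ (q + (p + 1)))"
          using elim unfolding \<zeta>_def real_norm_def by linarith
        then show ?thesis using elim by (simp add: divide_le_eq power_add mult_ac)
      qed
      moreover have "\<epsilon> ^ q * \<epsilon> powr (- real M) \<le> \<epsilon> ^ (p + 1)"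
      proof -
        have "\<epsilon> ^ q = \<epsilon> ^ M * \<epsilon> ^ (q - M)" by (simp add: power_add[symmetric] q_def add_ac)
        then have "\<epsilon> ^ q * \<epsilon> powr (- real M) = \<epsilon> ^ (q - M)"
          using elim by (simp add: powr_minus powr_realpow)
        also have "\<dots> \<le> \<epsilon> ^ (p + 1)" using elim by (intro power_decreasing) (auto simp: q_def)
        finally show ?thesis .
      qed
      moreover have "3 * \<epsilon> ^ (p + 1) \<le> \<epsilon> ^ p" using elim mult_right_mono[of "3 * \<epsilon>" 1 "\<epsilon> ^ p"] by (simp add: mult.assoc)
      ultimately have "\<bar>partial_deriv i (?F \<epsilon>) (\<xi> \<epsilon>)\<bar> \<le> \<epsilon> ^ p" by linarith
      then show ?case by simp
    qed
  qed
qed (use neg in simp)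

text \<open>Uniqueness behind the definite description in \<open>gderiv\<close>. The difference of
  two defining nets is negligible at every point of X, hence so are its derivatives. Passing to
  another representative of x costs one more negligible net.\<close>

lemma represents_gderiv:
  fixes f :: "(real ^ 'n) gen \<Rightarrow> real gen"
  assumes X: "X = strongly_internal_set Ue" and u: "defining_net \<Omega> u X f" and x: "x \<in> X" "represents \<xi> x"
  shows "represents (\<lambda>\<epsilon>. multi_deriv \<alpha> (u \<epsilon>) (\<xi> \<epsilon>)) (gderiv X \<alpha> f x)"
proof -
  have unique: "abs_gen (\<lambda>\<epsilon>. multi_deriv \<alpha> (u \<epsilon>) (\<xi> \<epsilon>)) = abs_gen (\<lambda>\<epsilon>. multi_deriv \<alpha> (v \<epsilon>) (\<eta> \<epsilon>))"
    if v: "defining_net \<Omega>' v X f" and \<eta>: "represents \<eta> x" for \<Omega>' v \<eta>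
  proof -
    define L where "L = (SOME is. \<forall>i. count_list is i = \<alpha> i)"
    define w where "w \<epsilon> y = 1 * u \<epsilon> y + (- 1) * v \<epsilon> y" for \<epsilon> y
    note u' = defining_net_moderate[OF u] and v' = defining_net_moderate[OF v]
    have w_eq: "iter_partial is (w \<epsilon>) y = iter_partial is (u \<epsilon>) y - iter_partial is (v \<epsilon>) y"
      if "\<epsilon> \<in> {0<..1}" "y \<in> \<Omega> \<epsilon> \<inter> \<Omega>' \<epsilon>" for "is" \<epsilon> y
    proof -
      have "open (\<Omega> \<epsilon> \<inter> \<Omega>' \<epsilon>)" "smooth_on (\<Omega> \<epsilon> \<inter> \<Omega>' \<epsilon>) (u \<epsilon>)" "smooth_on (\<Omega> \<epsilon> \<inter> \<Omega>' \<epsilon>) (v \<epsilon>)"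
        using u' v' that(1) unfolding moderate_smooth_net_def by (auto intro: smooth_on_subset)
      from iter_partial_lincomb[OF this that(2), of "is" 1 "- 1"]
      show ?thesis unfolding w_def[abs_def] by simp
    qed
    have ev: "\<forall>\<^sub>F \<epsilon> in at_right 0. \<zeta> \<epsilon> \<in> \<Omega> \<epsilon> \<inter> \<Omega>' \<epsilon>" if "z \<in> X" "represents \<zeta> z" for z \<zeta>
    proof -
      have "z \<in> strongly_internal_set \<Omega>" "z \<in> strongly_internal_set \<Omega>'"
        using u' v' that by (auto simp: moderate_smooth_net_def)
      from this[THEN strongly_internalD[OF _ that(2)]] show ?thesis by eventually_elim simp
    qed
    have w_ev: "\<forall>\<^sub>F \<epsilon> in at_right 0. iter_partial is (w \<epsilon>) (\<zeta> \<epsilon>) = iter_partial is (u \<epsilon>) (\<zeta> \<epsilon>) - iter_partial is (v \<epsilon>) (\<zeta> \<epsilon>)"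
      if "z \<in> X" "represents \<zeta> z" for z \<zeta> "is"
      using ev[OF that] eventually_unit_interval by eventually_elim (simp add: w_eq)
    have w: "moderate_smooth_net (\<lambda>\<epsilon>. \<Omega> \<epsilon> \<inter> \<Omega>' \<epsilon>) w X"
      unfolding moderate_smooth_net_def
    proof (intro conjI ballI allI impI)
      fix \<epsilon> :: real assume "\<epsilon> \<in> {0<..1}"
      then have *: "open (\<Omega> \<epsilon> \<inter> \<Omega>' \<epsilon>)" "smooth_on (\<Omega> \<epsilon> \<inter> \<Omega>' \<epsilon>) (u \<epsilon>)" "smooth_on (\<Omega> \<epsilon> \<inter> \<Omega>' \<epsilon>) (v \<epsilon>)"
        using u' v' unfolding moderate_smooth_net_def by (auto intro: smooth_on_subset)
      show "smooth_on (\<Omega> \<epsilon> \<inter> \<Omega>' \<epsilon>) (w \<epsilon>)" "open (\<Omega> \<epsilon> \<inter> \<Omega>' \<epsilon>)"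
        unfolding w_def[abs_def] by (intro smooth_on_lincomb *)+
    next
      show "X \<subseteq> strongly_internal_set (\<lambda>\<epsilon>. \<Omega> \<epsilon> \<inter> \<Omega>' \<epsilon>)"
        using ev by (auto simp: strongly_internal_set_def)
    next
      fix z \<zeta> "is" assume z: "z \<in> X" "represents \<zeta> z"
      then have "moderate (\<lambda>\<epsilon>. iter_partial is (u \<epsilon>) (\<zeta> \<epsilon>) - iter_partial is (v \<epsilon>) (\<zeta> \<epsilon>))"
        using u' v' by (intro moderate_diff) (auto simp: moderate_smooth_net_def)
      then show "moderate (\<lambda>\<epsilon>. iter_partial is (w \<epsilon>) (\<zeta> \<epsilon>))" using w_ev[OF z] by (rule moderate_cong_ev)
    qed
    have "negligible_net (\<lambda>\<epsilon>. w \<epsilon> (\<zeta> \<epsilon>))" if z: "z \<in> X" "represents \<zeta> z" for z \<zeta>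
    proof -
      have "represents (\<lambda>\<epsilon>. u \<epsilon> (\<zeta> \<epsilon>)) (f z)" "represents (\<lambda>\<epsilon>. v \<epsilon> (\<zeta> \<epsilon>)) (f z)"
        using u v z by (auto simp: defining_net_def)
      from represents_negligible[OF this] show ?thesis by (simp add: w_def)
    qed
    from negligible_derivatives[OF X w this x] have "negligible_net (\<lambda>\<epsilon>. iter_partial L (w \<epsilon>) (\<xi> \<epsilon>))" .
    then have "negligible_net (\<lambda>\<epsilon>. iter_partial L (u \<epsilon>) (\<xi> \<epsilon>) - iter_partial L (v \<epsilon>) (\<xi> \<epsilon>))"
      by (rule negligible_cong_ev, use w_ev[OF x, of L] in eventually_elim) simp
    from negligible_net_add[OF this iter_partial_representative_independent[OF v' x(1) \<eta> x(2), of L]]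
    have "negligible_net (\<lambda>\<epsilon>. multi_deriv \<alpha> (u \<epsilon>) (\<xi> \<epsilon>) - multi_deriv \<alpha> (v \<epsilon>) (\<eta> \<epsilon>))"
      by (simp add: multi_deriv_def L_def)
    moreover have "moderate (\<lambda>\<epsilon>. multi_deriv \<alpha> (u \<epsilon>) (\<xi> \<epsilon>))" "moderate (\<lambda>\<epsilon>. multi_deriv \<alpha> (v \<epsilon>) (\<eta> \<epsilon>))"
      using u v x \<eta> by (auto simp: defining_net_def)
    ultimately show ?thesis using abs_gen_eq_iff by blast
  qed
  have "gderiv X \<alpha> f x = abs_gen (\<lambda>\<epsilon>. multi_deriv \<alpha> (u \<epsilon>) (\<xi> \<epsilon>))"
    unfolding gderiv_def
  proof (rule the_equality)
    fix y assume "\<exists>\<Omega> u \<xi>. defining_net \<Omega> u X f \<and> represents \<xi> x \<and> y = abs_gen (\<lambda>\<epsilon>. multi_deriv \<alpha> (u \<epsilon>) (\<xi> \<epsilon>))"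
    then obtain \<Omega>' v \<eta> where "defining_net \<Omega>' v X f" "represents \<eta> x"
      and y: "y = abs_gen (\<lambda>\<epsilon>. multi_deriv \<alpha> (v \<epsilon>) (\<eta> \<epsilon>))" by blast
    from unique[OF this(1,2)] y show "y = abs_gen (\<lambda>\<epsilon>. multi_deriv \<alpha> (u \<epsilon>) (\<xi> \<epsilon>))" by simp
  qed (use u x in blast)
  moreover have "moderate (\<lambda>\<epsilon>. multi_deriv \<alpha> (u \<epsilon>) (\<xi> \<epsilon>))"
    using u x by (auto simp: defining_net_def)
  ultimately show ?thesis by (simp add: represents_abs)
qed

section \<open>Compactly supported generalized smooth functions\<close>

lemma GD_onE:
  assumes "f \<in> GD_on U K"
  obtains u where "defining_net (\<lambda>_. UNIV) u U f"
    "\<And>x \<xi> \<alpha>. x \<in> ext K \<Longrightarrow> represents \<xi> x \<Longrightarrow> negligible_net (\<lambda>\<epsilon>. multi_deriv \<alpha> (u \<epsilon>) (\<xi> \<epsilon>))"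
  using assms by (auto simp: GD_on_def represents_0_iff)

lemma GD_on_outside: "f \<in> GD_on U K \<Longrightarrow> x \<notin> U \<Longrightarrow> f x = 0"
  by (auto simp: GD_on_def gsf_def)

lemma GD_onI:
  assumes "defining_net (\<lambda>_. UNIV) u U f" "\<And>x. x \<notin> U \<Longrightarrow> f x = 0"
    "\<And>x \<xi> \<alpha>. x \<in> ext K \<Longrightarrow> represents \<xi> x \<Longrightarrow> negligible_net (\<lambda>\<epsilon>. multi_deriv \<alpha> (u \<epsilon>) (\<xi> \<epsilon>))"
  shows "f \<in> GD_on U K"
  using assms unfolding GD_on_def gsf_def represents_0_iff by blast

lemma multi_deriv_lincomb:
  fixes u v :: "real ^ 'n \<Rightarrow> real"
  assumes "smooth_on UNIV u" "smooth_on UNIV v"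
  shows "multi_deriv \<alpha> (\<lambda>y. a * u y + b * v y) x = a * multi_deriv \<alpha> u x + b * multi_deriv \<alpha> v x"
  unfolding multi_deriv_def by (rule iter_partial_lincomb[OF open_UNIV assms UNIV_I])

text \<open>Coefficients in \<open>real gen\<close> act through representatives, so the defining net
  of the combination has coefficients depending on \<epsilon>. Addition and scalar multiplication
  are both read off from this one form.\<close>

lemma GD_on_lincomb:
  fixes f g :: "(real ^ 'n) gen \<Rightarrow> real gen"
  assumes U: "U = strongly_internal_set Ue" and f: "f \<in> GD_on U K" and g: "g \<in> GD_on U K"
  shows "(\<lambda>x. c * f x + d * g x) \<in> GD_on U K" (is ?mem)
    and "x \<in> U \<Longrightarrow> gderiv U \<alpha> (\<lambda>x. c * f x + d * g x) x = c * gderiv U \<alpha> f x + d * gderiv U \<alpha> g x"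
proof -
  obtain u where u: "defining_net (\<lambda>_. UNIV) u U f"
    "\<And>x \<xi> \<alpha>. x \<in> ext K \<Longrightarrow> represents \<xi> x \<Longrightarrow> negligible_net (\<lambda>\<epsilon>. multi_deriv \<alpha> (u \<epsilon>) (\<xi> \<epsilon>))"
    by (rule GD_onE[OF f]) blast
  obtain v where v: "defining_net (\<lambda>_. UNIV) v U g"
    "\<And>x \<xi> \<alpha>. x \<in> ext K \<Longrightarrow> represents \<xi> x \<Longrightarrow> negligible_net (\<lambda>\<epsilon>. multi_deriv \<alpha> (v \<epsilon>) (\<xi> \<epsilon>))"
    by (rule GD_onE[OF g]) blast
  obtain \<gamma> \<delta> where cd: "represents \<gamma> c" "represents \<delta> d" by (meson represents_rep)
  define w where "w \<epsilon> y = \<gamma> \<epsilon> * u \<epsilon> y + \<delta> \<epsilon> * v \<epsilon> y" for \<epsilon> y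
  have sm: "smooth_on UNIV (u \<epsilon>)" "smooth_on UNIV (v \<epsilon>)" if "\<epsilon> \<in> {0<..1}" for \<epsilon>
    using u(1) v(1) that by (auto simp: defining_net_def)
  have "\<forall>\<^sub>F \<epsilon> in at_right 0. multi_deriv \<alpha> (w \<epsilon>) (\<xi> \<epsilon>) = \<gamma> \<epsilon> * multi_deriv \<alpha> (u \<epsilon>) (\<xi> \<epsilon>) + \<delta> \<epsilon> * multi_deriv \<alpha> (v \<epsilon>) (\<xi> \<epsilon>)" for \<alpha> \<xi>
    using eventually_unit_interval
    by eventually_elim (simp add: w_def[abs_def] multi_deriv_lincomb sm)
  note md = this
  have w: "defining_net (\<lambda>_. UNIV) w U (\<lambda>x. c * f x + d * g x)"
    unfolding defining_net_def
  proof (intro conjI ballI allI impI)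
    show "smooth_on UNIV (w \<epsilon>)" if "\<epsilon> \<in> {0<..1}" for \<epsilon>
      unfolding w_def[abs_def] by (intro smooth_on_lincomb open_UNIV sm that)
    show "represents (\<lambda>\<epsilon>. w \<epsilon> (\<xi> \<epsilon>)) (c * f x + d * g x)" if "x \<in> U" "represents \<xi> x" for x \<xi>
      unfolding w_def using u(1) v(1) that by (intro represents_add represents_mult cd) (auto simp: defining_net_def)
    show "moderate (\<lambda>\<epsilon>. multi_deriv \<alpha> (w \<epsilon>) (\<xi> \<epsilon>))" if "x \<in> U" "represents \<xi> x" for x \<xi> \<alpha>
      by (rule moderate_cong_ev[OF _ md], intro moderate_add moderate_mult represents_moderate[OF cd(1)] represents_moderate[OF cd(2)])
        (use u(1) v(1) that in \<open>auto simp: defining_net_def\<close>)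
  qed (auto simp: strongly_internal_set_def)
  show ?mem
  proof (rule GD_onI[OF w])
    show "c * f x + d * g x = 0" if "x \<notin> U" for x
      using f g that by (simp add: GD_on_outside)
    show "negligible_net (\<lambda>\<epsilon>. multi_deriv \<alpha> (w \<epsilon>) (\<xi> \<epsilon>))" if "x \<in> ext K" "represents \<xi> x" for x \<xi> \<alpha>
      using negligible_net_mult[OF u(2)[OF that, of \<alpha>] represents_moderate[OF cd(1)]]
        negligible_net_mult[OF v(2)[OF that, of \<alpha>] represents_moderate[OF cd(2)]]
      by (intro negligible_cong_ev[OF negligible_net_add md]) (simp_all add: mult.commute)
  qed
  show "gderiv U \<alpha> (\<lambda>x. c * f x + d * g x) x = c * gderiv U \<alpha> f x + d * gderiv U \<alpha> g x" if x: "x \<in> U"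
  proof -
    obtain \<xi> where \<xi>: "represents \<xi> x" by (meson represents_rep)
    have "represents (\<lambda>\<epsilon>. \<gamma> \<epsilon> * multi_deriv \<alpha> (u \<epsilon>) (\<xi> \<epsilon>) + \<delta> \<epsilon> * multi_deriv \<alpha> (v \<epsilon>) (\<xi> \<epsilon>))
        (c * gderiv U \<alpha> f x + d * gderiv U \<alpha> g x)"
      by (intro represents_add represents_mult cd represents_gderiv[OF U u(1) x \<xi>] represents_gderiv[OF U v(1) x \<xi>])
    from represents_unique[OF represents_gderiv[OF U w x \<xi>] represents_cong_ev[OF this md]] show ?thesis .
  qed
qed

lemma iter_partial_zero: "iter_partial is (\<lambda>_ :: real ^ 'n. 0 :: real) = (\<lambda>_. 0)"
proof (induction "is")
  case (Cons i "is")
  have "partial_deriv i (\<lambda>_ :: real ^ 'n. 0 :: real) = (\<lambda>_. 0)"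
    by (rule ext) (rule partial_deriv_eqI[OF has_derivative_const])
  then show ?case using Cons by simp
qed simp

lemma GD_on_zero: "(0 :: (real ^ 'n) gen \<Rightarrow> real gen) \<in> GD_on U K"
proof (rule GD_onI)
  have "smooth_on UNIV (\<lambda>_ :: real ^ 'n. 0 :: real)" by (simp add: smooth_on_def iter_partial_zero)
  then show "defining_net (\<lambda>_. UNIV) (\<lambda>_ _. 0 :: real) U 0"
    by (auto simp: defining_net_def strongly_internal_set_def multi_deriv_def iter_partial_zero represents_0_iff
      negligible_net_zero moderate_const)
qed (auto simp: multi_deriv_def iter_partial_zero negligible_net_zero)

text \<open>Enlarging K shrinks its exterior, where the derivatives have to be negligible.\<close>

lemma GD_on_mono: "K \<subseteq> K' \<Longrightarrow> GD_on U K \<subseteq> GD_on U K'"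
  unfolding GD_on_def ext_def by blast

lemma fcompactsE:
  fixes U :: "(real ^ 'n) gen set"
  assumes "K \<in> fcompacts U"
  obtains Ke M where "K = internal_set Ke" "K \<subseteq> U"
    "\<forall>\<^sub>F \<epsilon> in at_right 0. compact (Ke \<epsilon>) \<and> Ke \<epsilon> \<noteq> {} \<and> (\<forall>x\<in>Ke \<epsilon>. norm x \<le> \<epsilon> powr (- M))"
proof -
  have K: "K \<noteq> {}" "functionally_compact K" "K \<subseteq> U" using assms by (auto simp: fcompacts_def)
  from K(2) obtain Ke M where Ke: "\<forall>\<epsilon>\<in>{0<..1}. compact (Ke \<epsilon>)" "K = internal_set Ke"
    "\<forall>\<^sub>F \<epsilon> in at_right 0. \<forall>x\<in>Ke \<epsilon>. norm x \<le> \<epsilon> powr (- M)"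
    unfolding functionally_compact_def by blast
  \<comment> \<open>A single net with values eventually in \<open>Ke\<close> shows that these sets
    are nonempty for small \<epsilon>.\<close>
  obtain y \<eta> where "\<forall>\<^sub>F \<epsilon> in at_right 0. \<eta> \<epsilon> \<in> Ke \<epsilon>" using K(1) unfolding Ke(2) internal_set_def by blast
  then have "\<forall>\<^sub>F \<epsilon> in at_right 0. compact (Ke \<epsilon>) \<and> Ke \<epsilon> \<noteq> {} \<and> (\<forall>x\<in>Ke \<epsilon>. norm x \<le> \<epsilon> powr (- M))"
    using Ke(3) eventually_unit_interval by eventually_elim (use Ke(1) in auto)
  with that Ke(2) K(3) show thesis by blast
qed

lemma internal_setI:
  assumes "\<forall>\<^sub>F \<epsilon> in at_right 0. \<xi> \<epsilon> \<in> A \<epsilon>" "\<forall>\<^sub>F \<epsilon> in at_right 0. \<forall>x\<in>A \<epsilon>. norm x \<le> \<epsilon> powr (- M)"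
  shows "represents \<xi> (abs_gen \<xi>)" "abs_gen \<xi> \<in> internal_set A"
proof -
  have "moderate \<xi>"
    by (rule moderate_eventually_le[OF moderate_powr[of "- M"]]) (use assms in eventually_elim, auto)
  then show "represents \<xi> (abs_gen \<xi>)" by (rule represents_abs)
  with assms(1) show "abs_gen \<xi> \<in> internal_set A" unfolding internal_set_def by blast
qed

text \<open>Compactness gives a maximum point for each small \<epsilon>. These points are bounded by
  \<epsilon>^(-M), so they form a moderate net with class in K. In a partial order this is what
  gives \<open>greatest_element\<close> a value.\<close>

lemma gderiv_max_attained:
  fixes f :: "(real ^ 'n) gen \<Rightarrow> real gen"
  assumes U: "U = strongly_internal_set Ue" and K: "K \<in> fcompacts U" and f: "f \<in> GD_on U K"
  shows "\<exists>y\<in>K. \<forall>z\<in>K. gabs (gderiv U \<alpha> f z) \<le> gabs (gderiv U \<alpha> f y)"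
proof -
  obtain Ke M where Ke: "K = internal_set Ke" "K \<subseteq> U"
    "\<forall>\<^sub>F \<epsilon> in at_right 0. compact (Ke \<epsilon>) \<and> Ke \<epsilon> \<noteq> {} \<and> (\<forall>x\<in>Ke \<epsilon>. norm x \<le> \<epsilon> powr (- M))"
    using fcompactsE[OF K] by blast
  obtain u where u: "defining_net (\<lambda>_. UNIV) u U f" by (rule GD_onE[OF f]) blast
  let ?D = "\<lambda>\<epsilon>. multi_deriv \<alpha> (u \<epsilon>)"
  define Y where "Y \<epsilon> = (SOME y. y \<in> Ke \<epsilon> \<and> (\<forall>z\<in>Ke \<epsilon>. norm (?D \<epsilon> z) \<le> norm (?D \<epsilon> y)))" for \<epsilon>
  have Y: "\<forall>\<^sub>F \<epsilon> in at_right 0. Y \<epsilon> \<in> Ke \<epsilon> \<and> (\<forall>z\<in>Ke \<epsilon>. norm (?D \<epsilon> z) \<le> norm (?D \<epsilon> (Y \<epsilon>)))"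
    using Ke(3) eventually_unit_interval
  proof eventually_elim
    case (elim \<epsilon>)
    have "smooth_on UNIV (u \<epsilon>)" using u elim by (auto simp: defining_net_def)
    then have "continuous_on (Ke \<epsilon>) (?D \<epsilon>)"
      unfolding multi_deriv_def
      by (intro differentiable_imp_continuous_on) (auto simp: differentiable_on_def intro: smooth_onD differentiable_at_withinI)
    then have "\<exists>y\<in>Ke \<epsilon>. \<forall>z\<in>Ke \<epsilon>. norm (?D \<epsilon> z) \<le> norm (?D \<epsilon> y)"
      by (intro continuous_attains_sup continuous_on_norm) (use elim in auto)
    then have "\<exists>y. y \<in> Ke \<epsilon> \<and> (\<forall>z\<in>Ke \<epsilon>. norm (?D \<epsilon> z) \<le> norm (?D \<epsilon> y))" by blast
    from someI_ex[OF this] show ?case unfolding Y_def .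
  qed
  have "\<forall>\<^sub>F \<epsilon> in at_right 0. Y \<epsilon> \<in> Ke \<epsilon>" "\<forall>\<^sub>F \<epsilon> in at_right 0. \<forall>x\<in>Ke \<epsilon>. norm x \<le> \<epsilon> powr (- M)"
    using Y Ke(3) by (auto elim: eventually_mono)
  from internal_setI[OF this] have y: "represents Y (abs_gen Y)" "abs_gen Y \<in> K" unfolding Ke(1) by auto
  show ?thesis
  proof (rule bexI[OF _ y(2)], rule ballI)
    fix z assume z: "z \<in> K"
    then obtain \<zeta> where \<zeta>: "represents \<zeta> z" "\<forall>\<^sub>F \<epsilon> in at_right 0. \<zeta> \<epsilon> \<in> Ke \<epsilon>"
      unfolding Ke(1) internal_set_def by blast
    have zU: "z \<in> U" "abs_gen Y \<in> U" using z y Ke(2) by auto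
    show "gabs (gderiv U \<alpha> f z) \<le> gabs (gderiv U \<alpha> f (abs_gen Y))"
      by (rule gen_leI[OF represents_gabs[OF represents_gderiv[OF U u zU(1) \<zeta>(1)]]
          represents_gabs[OF represents_gderiv[OF U u zU(2) y(1)]]])
        (use \<zeta>(2) Y in eventually_elim, blast)
  qed
qed

text \<open>The exterior asks for |x - a| to be invertible for each a, and the uniform gap
  \<epsilon>^p provides this for all a at once.\<close>

lemma extI:
  fixes x :: "'a::real_normed_vector gen"
  assumes "represents \<xi> x" "\<forall>\<^sub>F \<epsilon> in at_right 0. \<forall>a\<in>A \<epsilon>. \<epsilon> ^ p \<le> dist (\<xi> \<epsilon>) a"
  shows "x \<in> ext (internal_set A)"
  unfolding ext_def
proof (intro CollectI ballI)
  fix a assume "a \<in> internal_set A"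
  then obtain \<eta> where \<eta>: "represents \<eta> a" "\<forall>\<^sub>F \<epsilon> in at_right 0. \<eta> \<epsilon> \<in> A \<epsilon>"
    unfolding internal_set_def by blast
  have 0: "represents (\<lambda>_. 0) (0 :: real gen)" by (simp add: represents_0_iff negligible_net_zero)
  show "0 < gabs (x - a)"
    by (rule gen_lessI[OF 0 represents_gabs[OF represents_diff[OF assms(1) \<eta>(1)]], of "real p"],
        use assms(2) \<eta>(2) eventually_unit_interval in eventually_elim)
      (simp add: powr_realpow dist_norm)
qed

text \<open>
  Where \<open>f\<close> is larger than \<open>O(\<epsilon>\<^sup>q)\<close> at \<open>x\<close>, the point is either at distance at least \<open>\<epsilon>\<^sup>p\<close> from \<open>K\<close>,
  and gluing with a far away point gives an element of the exterior, or it is infinitely close to \<open>K\<close>,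
  and gluing with the nearest points gives an element of \<open>K\<close>.
\<close>

lemma gderiv_bigo_extend:
  fixes f :: "(real ^ 'n) gen \<Rightarrow> real gen"
  assumes U: "U = strongly_internal_set Ue" and K: "K \<in> fcompacts U" and f: "f \<in> GD_on U K"
    and bd: "\<And>y. y \<in> K \<Longrightarrow> gderiv U \<alpha> f y \<in> bigo_gen q" and x: "x \<in> U"
  shows "gderiv U \<alpha> f x \<in> bigo_gen q"
proof (rule ccontr)
  assume no: "gderiv U \<alpha> f x \<notin> bigo_gen q"
  obtain Ke M where Ke: "K = internal_set Ke" "K \<subseteq> U"
    "\<forall>\<^sub>F \<epsilon> in at_right 0. compact (Ke \<epsilon>) \<and> Ke \<epsilon> \<noteq> {} \<and> (\<forall>x\<in>Ke \<epsilon>. norm x \<le> \<epsilon> powr (- M))"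
    using fcompactsE[OF K] by blast
  from Ke(3) have Ke_bd: "\<forall>\<^sub>F \<epsilon> in at_right 0. \<forall>x\<in>Ke \<epsilon>. norm x \<le> \<epsilon> powr (- M)"
    by (rule eventually_mono) blast
  obtain u where u: "defining_net (\<lambda>_. UNIV) u U f"
    and ext: "\<And>x \<xi> \<alpha>. x \<in> ext K \<Longrightarrow> represents \<xi> x \<Longrightarrow> negligible_net (\<lambda>\<epsilon>. multi_deriv \<alpha> (u \<epsilon>) (\<xi> \<epsilon>))"
    by (rule GD_onE[OF f]) blast
  obtain \<xi> where \<xi>: "represents \<xi> x" by (meson represents_rep)
  let ?F = "\<lambda>\<epsilon>. multi_deriv \<alpha> (u \<epsilon>)"
  \<comment> \<open>Failure of the O-bound is the failure of every constant m. Along the diagonal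
    set S the ratio of the derivative to \<epsilon>^q then tends to infinity.\<close>
  define P where "P m \<epsilon> \<longleftrightarrow> real m * \<epsilon> powr q < norm (?F \<epsilon> (\<xi> \<epsilon>))" for m :: nat and \<epsilon>
  have "\<exists>\<^sub>F \<epsilon> in at_right 0. P m \<epsilon>" for m
  proof (rule ccontr)
    assume "\<not> (\<exists>\<^sub>F \<epsilon> in at_right 0. P m \<epsilon>)"
    then have "\<forall>\<^sub>F \<epsilon> in at_right 0. \<not> P m \<epsilon>" by (simp only: not_frequently)
    then have "(\<lambda>\<epsilon>. norm (?F \<epsilon> (\<xi> \<epsilon>))) \<in> O[at_right 0](\<lambda>\<epsilon>. \<epsilon> powr q)"
      by (intro bigoI[where c = "real m"], eventually_elim) (simp add: P_def not_less)
    with no show False by (simp add: bigo_gen_iff[OF represents_gderiv[OF U u x \<xi>]])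
  qed
  then obtain S k where S: "\<exists>\<^sub>F \<epsilon> in at_right 0. \<epsilon> \<in> S" "\<And>\<epsilon>. \<epsilon> \<in> S \<Longrightarrow> P (k \<epsilon>) \<epsilon>"
    "\<And>m::nat. \<forall>\<^sub>F \<epsilon> in at_right 0. \<epsilon> \<in> S \<longrightarrow> m \<le> k \<epsilon>" by (rule diagonal_subnet[of P]) blast
  \<comment> \<open>Both gluings end here: a net that agrees with \<xi> on a part T of S still
    accumulating at 0 cannot satisfy the O-bound.\<close>
  have contra: False if T: "\<exists>\<^sub>F \<epsilon> in at_right 0. \<epsilon> \<in> T" "T \<subseteq> S" "\<And>\<epsilon>. \<epsilon> \<in> T \<Longrightarrow> \<zeta> \<epsilon> = \<xi> \<epsilon>"
    and \<zeta>: "(\<lambda>\<epsilon>. norm (?F \<epsilon> (\<zeta> \<epsilon>))) \<in> O[at_right 0](\<lambda>\<epsilon>. \<epsilon> powr q)" for T \<zeta>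
  proof -
    obtain c where c: "\<forall>\<^sub>F \<epsilon> in at_right 0. norm (norm (?F \<epsilon> (\<zeta> \<epsilon>))) \<le> c * norm (\<epsilon> powr q)"
      using landau_o.bigE[OF \<zeta>] by blast
    obtain m where m: "c \<le> real m" using real_arch_simple by blast
    have "\<forall>\<^sub>F \<epsilon> in at_right 0. \<epsilon> \<in> T \<longrightarrow> False"
      using c S(3)[of m] eventually_unit_interval
    proof eventually_elim
      case (elim \<epsilon>)
      show ?case
      proof
        assume \<epsilon>: "\<epsilon> \<in> T"
        then have "real (k \<epsilon>) * \<epsilon> powr q < norm (?F \<epsilon> (\<xi> \<epsilon>))" using S(2) T(2) by (auto simp: P_def)
        also have "\<dots> \<le> c * \<epsilon> powr q" using elim T(3)[OF \<epsilon>] by simp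
        also have "\<dots> \<le> real (k \<epsilon>) * \<epsilon> powr q"
          using elim \<epsilon> T(2) m by (intro mult_right_mono) auto
        finally show False by simp
      qed
    qed
    from frequently_rev_mp[OF T(1) this] show False by simp
  qed
  show False
  proof (cases "\<exists>p::nat. \<exists>\<^sub>F \<epsilon> in at_right 0. \<epsilon> \<in> S \<and> (\<forall>a\<in>Ke \<epsilon>. \<epsilon> ^ p \<le> dist (\<xi> \<epsilon>) a)")
    case True
    then obtain p :: nat where p: "\<exists>\<^sub>F \<epsilon> in at_right 0. \<epsilon> \<in> S \<and> (\<forall>a\<in>Ke \<epsilon>. \<epsilon> ^ p \<le> dist (\<xi> \<epsilon>) a)" by blast
    define T where "T = {\<epsilon>\<in>S. \<forall>a\<in>Ke \<epsilon>. \<epsilon> ^ p \<le> dist (\<xi> \<epsilon>) a}"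
    fix i :: 'n
    \<comment> \<open>Off T the point has norm \<epsilon>^(-M) + 1 and hence distance at least 1
      from \<open>Ke\<close>. The class may lie outside U: the net u is global, and its derivatives
      are negligible on all of \<open>ext K\<close>.\<close>
    define \<zeta> where "\<zeta> \<epsilon> = (if \<epsilon> \<in> T then \<xi> \<epsilon> else (\<epsilon> powr (- M) + 1) *\<^sub>R axis i 1)" for \<epsilon>
    have "moderate \<zeta>"
      by (rule moderate_dominated[OF represents_moderate[OF \<xi>] moderate_add[OF moderate_powr[of "- M"] moderate_const[of 1]]])
        (simp add: \<zeta>_def)
    then have \<zeta>: "represents \<zeta> (abs_gen \<zeta>)" by (rule represents_abs)
    have "\<forall>\<^sub>F \<epsilon> in at_right 0. \<forall>a\<in>Ke \<epsilon>. \<epsilon> ^ p \<le> dist (\<zeta> \<epsilon>) a"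
      using Ke_bd eventually_unit_interval
    proof eventually_elim
      case (elim \<epsilon>)
      show ?case
      proof
        fix a assume a: "a \<in> Ke \<epsilon>"
        show "\<epsilon> ^ p \<le> dist (\<zeta> \<epsilon>) a"
        proof (cases "\<epsilon> \<in> T")
          case False
          have "\<epsilon> ^ p \<le> 1" using elim by (intro power_le_one) auto
          also have "1 \<le> norm (\<zeta> \<epsilon>) - norm a" using False elim a by (auto simp: \<zeta>_def)
          also have "\<dots> \<le> dist (\<zeta> \<epsilon>) a" unfolding dist_norm by (rule norm_triangle_ineq2)
          finally show ?thesis .
        qed (use a in \<open>simp add: T_def \<zeta>_def\<close>)
      qed
    qed
    from extI[OF \<zeta> this] have "negligible_net (\<lambda>\<epsilon>. ?F \<epsilon> (\<zeta> \<epsilon>))"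
      unfolding Ke(1)[symmetric] by (rule ext[OF _ \<zeta>])
    then have "(\<lambda>\<epsilon>. norm (?F \<epsilon> (\<zeta> \<epsilon>))) \<in> O[at_right 0](\<lambda>\<epsilon>. \<epsilon> powr q)"
      by (rule negligible_net_bigo_powr)
    then show False by (rule contra[of T, rotated 3]) (use p in \<open>auto simp: T_def \<zeta>_def\<close>)
  next
    case False
    define A where "A \<epsilon> = (SOME a. a \<in> Ke \<epsilon> \<and> (\<forall>b\<in>Ke \<epsilon>. dist (\<xi> \<epsilon>) a \<le> dist (\<xi> \<epsilon>) b))" for \<epsilon>
    have A: "\<forall>\<^sub>F \<epsilon> in at_right 0. A \<epsilon> \<in> Ke \<epsilon> \<and> (\<forall>b\<in>Ke \<epsilon>. dist (\<xi> \<epsilon>) (A \<epsilon>) \<le> dist (\<xi> \<epsilon>) b)"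
      using Ke(3)
    proof eventually_elim
      case (elim \<epsilon>)
      then have "\<exists>a. a \<in> Ke \<epsilon> \<and> (\<forall>b\<in>Ke \<epsilon>. dist (\<xi> \<epsilon>) a \<le> dist (\<xi> \<epsilon>) b)"
        using distance_attains_inf[of "Ke \<epsilon>" "\<xi> \<epsilon>"] compact_imp_closed by metis
      from someI_ex[OF this] show ?case unfolding A_def .
    qed
    then have "\<forall>\<^sub>F \<epsilon> in at_right 0. A \<epsilon> \<in> Ke \<epsilon>" by (rule eventually_mono) blast
    from internal_setI[OF this Ke_bd] have y: "represents A (abs_gen A)" "abs_gen A \<in> K" unfolding Ke(1) by auto
    \<comment> \<open>In this case, for every p, the nearest point of \<open>Ke\<close> is within
      \<epsilon>^p of \<xi> for small \<epsilon> in S. So \<zeta> agrees with \<xi> on S and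
      represents the same point of K as the net of nearest points, and there the bound is
      assumed.\<close>
    define \<zeta> where "\<zeta> \<epsilon> = (if \<epsilon> \<in> S then \<xi> \<epsilon> else A \<epsilon>)" for \<epsilon>
    have "negligible_net (\<lambda>\<epsilon>. A \<epsilon> - \<zeta> \<epsilon>)"
      unfolding negligible_net_iff
    proof
      fix p
      have "\<not> (\<exists>\<^sub>F \<epsilon> in at_right 0. \<epsilon> \<in> S \<and> (\<forall>a\<in>Ke \<epsilon>. \<epsilon> ^ p \<le> dist (\<xi> \<epsilon>) a))" using False by blast
      then have "\<forall>\<^sub>F \<epsilon> in at_right 0. \<not> (\<epsilon> \<in> S \<and> (\<forall>a\<in>Ke \<epsilon>. \<epsilon> ^ p \<le> dist (\<xi> \<epsilon>) a))"
        by (simp only: not_frequently)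
      then show "\<forall>\<^sub>F \<epsilon> in at_right 0. norm (A \<epsilon> - \<zeta> \<epsilon>) \<le> \<epsilon> ^ p"
        using A eventually_unit_interval
      proof eventually_elim
        case (elim \<epsilon>)
        show ?case
        proof (cases "\<epsilon> \<in> S")
          case True
          then obtain a where "a \<in> Ke \<epsilon>" "dist (\<xi> \<epsilon>) a < \<epsilon> ^ p" using elim by (auto simp: not_le)
          with elim have "dist (\<xi> \<epsilon>) (A \<epsilon>) \<le> \<epsilon> ^ p" by fastforce
          then show ?thesis using True by (simp add: \<zeta>_def dist_norm norm_minus_commute)
        qed (use elim in \<open>simp add: \<zeta>_def\<close>)
      qed
    qed
    from represents_cong[OF y(1) this] have \<zeta>: "represents \<zeta> (abs_gen A)" .
    have "abs_gen A \<in> U" using y(2) Ke(2) by blast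
    from bigo_gen_iff[OF represents_gderiv[OF U u this \<zeta>]] bd[OF y(2)]
    have "(\<lambda>\<epsilon>. norm (?F \<epsilon> (\<zeta> \<epsilon>))) \<in> O[at_right 0](\<lambda>\<epsilon>. \<epsilon> powr q)" by blast
    then show False by (rule contra[OF S(1) order_refl, rotated]) (simp add: \<zeta>_def)
  qed
qed

section \<open>Seminorm balls and neighborhoods independent of K\<close>

lemma finite_multi_indices: "finite {\<alpha> :: 'n::finite \<Rightarrow> nat. (\<Sum>i\<in>UNIV. \<alpha> i) \<le> m}"
proof (rule finite_subset)
  show "{\<alpha> :: 'n \<Rightarrow> nat. (\<Sum>i\<in>UNIV. \<alpha> i) \<le> m} \<subseteq> (\<Pi>\<^sub>E i\<in>UNIV. {..m})"
  proof
    fix \<alpha> :: "'n \<Rightarrow> nat" assume "\<alpha> \<in> {\<alpha>. (\<Sum>i\<in>UNIV. \<alpha> i) \<le> m}"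
    moreover have "\<alpha> i \<le> (\<Sum>i\<in>UNIV. \<alpha> i)" for i by (rule member_le_sum) auto
    ultimately have "\<alpha> i \<le> m" for i by (metis mem_Collect_eq order_trans)
    then show "\<alpha> \<in> (\<Pi>\<^sub>E i\<in>UNIV. {..m})" by (simp add: PiE_def extensional_def)
  qed
qed (intro finite_PiE; simp)

text \<open>
  These neighborhoods of \<open>0\<close> do not mention \<open>K\<close>: this is the independence of \<open>\<parallel>f\<parallel>\<^sub>m\<close> from \<open>K\<close>, and
  what makes the inductive limit strict.
\<close>

definition GD_nbhd :: "(real ^ 'n) gen set \<Rightarrow> nat \<Rightarrow> ((real ^ 'n) gen \<Rightarrow> real gen) set" where
  "GD_nbhd U k = {f. \<forall>x\<in>U. \<forall>\<alpha>. (\<Sum>i\<in>UNIV. \<alpha> i) \<le> k \<longrightarrow> gderiv U \<alpha> f x \<in> bigo_gen (real k)}"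

text \<open>The radius \<open>deps k\<close> yields order k on K through the maximum points, and
  \<open>gderiv_bigo_extend\<close> carries it to all of U. Together with the next lemma, seminorm
  balls and the sets \<open>GD_nbhd\<close> give the same neighborhoods of 0 in
  \<open>GD_on U K\<close>.\<close>

lemma GD_norm_less_imp_nbhd:
  fixes f :: "(real ^ 'n) gen \<Rightarrow> real gen"
  assumes U: "U = strongly_internal_set Ue" and K: "K \<in> fcompacts U" and f: "f \<in> GD_on U K"
    and less: "GD_norm U K k f < deps (real k)"
  shows "f \<in> GD_nbhd U k"
  unfolding GD_nbhd_def
proof (intro CollectI ballI allI impI)
  fix x and \<alpha> :: "'n \<Rightarrow> nat" assume x: "x \<in> U" and \<alpha>: "(\<Sum>i\<in>UNIV. \<alpha> i :: nat) \<le> k"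
  show "gderiv U \<alpha> f x \<in> bigo_gen (real k)"
  proof (rule gderiv_bigo_extend[OF U K f _ x])
    fix z assume z: "z \<in> K"
    obtain y where y: "y \<in> K" "\<forall>z\<in>K. gabs (gderiv U \<alpha> f z) \<le> gabs (gderiv U \<alpha> f y)"
      using gderiv_max_attained[OF U K f] by blast
    have "greatest_element ((\<lambda>x. gabs (gderiv U \<alpha> f x)) ` K) = gabs (gderiv U \<alpha> f y)"
      by (rule greatest_element_eqI) (use y in auto)
    then have "gabs (gderiv U \<alpha> f y) \<le> GD_norm U K k f"
      unfolding GD_norm_def using finite_gmax_ge[OF finite_multi_indices, of \<alpha> k
        "\<lambda>\<alpha>. greatest_element ((\<lambda>x. gabs (gderiv U \<alpha> f x)) ` K)"] \<alpha> by simp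
    moreover have "gabs (gderiv U \<alpha> f z) \<le> gabs (gderiv U \<alpha> f y)" using y z by blast
    moreover have "GD_norm U K k f \<le> deps (real k)" using less by (simp add: less_gen_def)
    ultimately have "gabs (gderiv U \<alpha> f z) \<le> deps (real k)" by (meson gen_le_trans)
    then show "gderiv U \<alpha> f z \<in> bigo_gen (real k)" by (rule bigo_gen_le[OF _ deps_bigo_gen])
  qed
qed

lemma GD_norm_less_if_nbhd:
  fixes U :: "(real ^ 'n) gen set"
  assumes U: "U = strongly_internal_set Ue" and K: "K \<in> fcompacts U" and \<rho>: "0 < \<rho>"
  shows "\<exists>k. \<forall>f\<in>GD_on U K \<inter> GD_nbhd U k. GD_norm U K m f < \<rho>"
proof -
  obtain r :: nat where r: "\<forall>x\<in>bigo_gen (real r). x < \<rho>" using bigo_gen_less[OF \<rho>] by blast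
  \<comment> \<open>One index of \<open>GD_nbhd\<close> governs both the number of derivatives and
    their order of smallness, hence the maximum of m and r.\<close>
  have "GD_norm U K m f \<in> bigo_gen (real r)" if f: "f \<in> GD_on U K" "f \<in> GD_nbhd U (max m r)" for f
    unfolding GD_norm_def
  proof (rule finite_gmax_bigo_gen[OF finite_multi_indices])
    show "{\<alpha> :: 'n \<Rightarrow> nat. (\<Sum>i\<in>UNIV. \<alpha> i) \<le> m} \<noteq> {}" by (auto intro: exI[of _ "\<lambda>_. 0"])
    fix \<alpha> :: "'n \<Rightarrow> nat" assume \<alpha>: "\<alpha> \<in> {\<alpha>. (\<Sum>i\<in>UNIV. \<alpha> i) \<le> m}"
    obtain y where y: "y \<in> K" "\<forall>z\<in>K. gabs (gderiv U \<alpha> f z) \<le> gabs (gderiv U \<alpha> f y)"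
      using gderiv_max_attained[OF U K f(1)] by blast
    have "greatest_element ((\<lambda>x. gabs (gderiv U \<alpha> f x)) ` K) = gabs (gderiv U \<alpha> f y)"
      by (rule greatest_element_eqI) (use y in auto)
    moreover have "y \<in> U" using y(1) K by (auto simp: fcompacts_def)
    then have "gderiv U \<alpha> f y \<in> bigo_gen (real (max m r))"
      using f(2) \<alpha> unfolding GD_nbhd_def by (simp add: le_max_iff_disj)
    then have "gderiv U \<alpha> f y \<in> bigo_gen (real r)" by (rule bigo_gen_mono) simp
    ultimately show "greatest_element ((\<lambda>x. gabs (gderiv U \<alpha> f x)) ` K) \<in> bigo_gen (real r)"
      by (simp add: bigo_gen_gabs)
  qed
  with r show ?thesis by (intro exI[of _ "max m r"]) blast
qed

text \<open>Each derivative has on K the order of its largest value, this order extends to U, and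
  only finitely many multi-indices occur. The uniform bound is what lets every neighborhood of 0
  absorb f.\<close>

lemma gderiv_bounded:
  fixes f :: "(real ^ 'n) gen \<Rightarrow> real gen"
  assumes U: "U = strongly_internal_set Ue" and K: "K \<in> fcompacts U" and f: "f \<in> GD_on U K"
  shows "\<exists>M::nat. \<forall>x\<in>U. \<forall>\<alpha>. (\<Sum>i\<in>UNIV. \<alpha> i) \<le> k \<longrightarrow> gderiv U \<alpha> f x \<in> bigo_gen (- real M)"
proof -
  have "\<exists>M::nat. \<forall>x\<in>U. gderiv U \<alpha> f x \<in> bigo_gen (- real M)" for \<alpha>
  proof -
    obtain y where y: "y \<in> K" "\<forall>z\<in>K. gabs (gderiv U \<alpha> f z) \<le> gabs (gderiv U \<alpha> f y)"
      using gderiv_max_attained[OF U K f] by blast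
    obtain M :: nat where "gabs (gderiv U \<alpha> f y) \<in> bigo_gen (- real M)" using bigo_gen_ex by blast
    with y(2) have "gderiv U \<alpha> f z \<in> bigo_gen (- real M)" if "z \<in> K" for z using bigo_gen_le that by blast
    from gderiv_bigo_extend[OF U K f this] show ?thesis by blast
  qed
  then obtain M :: "('n \<Rightarrow> nat) \<Rightarrow> nat" where M: "\<And>\<alpha> x. x \<in> U \<Longrightarrow> gderiv U \<alpha> f x \<in> bigo_gen (- real (M \<alpha>))"
    by metis
  show ?thesis
  proof (intro exI[of _ "MAX \<alpha>\<in>{\<alpha>. (\<Sum>i\<in>UNIV. \<alpha> i) \<le> k}. M \<alpha>"] ballI allI impI)
    fix x and \<alpha> :: "'n \<Rightarrow> nat" assume "x \<in> U" and \<alpha>: "(\<Sum>i\<in>UNIV. \<alpha> i :: nat) \<le> k"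
    then show "gderiv U \<alpha> f x \<in> bigo_gen (- real (MAX \<alpha>\<in>{\<alpha>. (\<Sum>i\<in>UNIV. \<alpha> i) \<le> k}. M \<alpha>))"
      by (intro bigo_gen_mono[OF M]) (auto intro!: Max_ge finite_imageI finite_multi_indices)
  qed
qed

section \<open>Linear topologies and inductive limits\<close>

text \<open>The neighborhoods of 0 of a linear topology: subgroups stable under bounded scalars. The
  last two conditions supply continuity of scalar multiplication, namely for large scalars near the
  zero vector and for a fixed vector near the zero scalar.\<close>

definition linear_nbhd_base :: "(real gen \<Rightarrow> 'b::ab_group_add \<Rightarrow> 'b) \<Rightarrow> 'b set \<Rightarrow> 'b set set \<Rightarrow> bool" where
  "linear_nbhd_base s M \<B> \<longleftrightarrow> \<B> \<noteq> {} \<and>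
    (\<forall>V\<in>\<B>. V \<subseteq> M \<and> 0 \<in> V \<and> (\<forall>x\<in>V. \<forall>y\<in>V. x + y \<in> V) \<and> (\<forall>c\<in>bigo_gen 0. \<forall>x\<in>V. s c x \<in> V)) \<and>
    (\<forall>V\<in>\<B>. \<forall>W\<in>\<B>. \<exists>X\<in>\<B>. X \<subseteq> V \<inter> W) \<and>
    (\<forall>V\<in>\<B>. \<forall>r::nat. \<exists>W\<in>\<B>. \<forall>x\<in>W. s (deps (- real r)) x \<in> V) \<and>
    (\<forall>V\<in>\<B>. \<forall>x\<in>M. \<exists>r::nat. \<forall>c\<in>bigo_gen (real r). s c x \<in> V)"

lemma linear_nbhd_baseI:
  assumes "\<B> \<noteq> {}" "\<And>V. V \<in> \<B> \<Longrightarrow> V \<subseteq> M" "\<And>V. V \<in> \<B> \<Longrightarrow> 0 \<in> V"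
    "\<And>V x y. V \<in> \<B> \<Longrightarrow> x \<in> V \<Longrightarrow> y \<in> V \<Longrightarrow> x + y \<in> V"
    "\<And>V c x. V \<in> \<B> \<Longrightarrow> c \<in> bigo_gen 0 \<Longrightarrow> x \<in> V \<Longrightarrow> s c x \<in> V"
    "\<And>V W. V \<in> \<B> \<Longrightarrow> W \<in> \<B> \<Longrightarrow> \<exists>X\<in>\<B>. X \<subseteq> V \<inter> W"
    "\<And>V r. V \<in> \<B> \<Longrightarrow> \<exists>W\<in>\<B>. \<forall>x\<in>W. s (deps (- real r)) x \<in> V"
    "\<And>V x. V \<in> \<B> \<Longrightarrow> x \<in> M \<Longrightarrow> \<exists>r::nat. \<forall>c\<in>bigo_gen (real r). s c x \<in> V"
  shows "linear_nbhd_base s M \<B>"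
  using assms by (simp add: linear_nbhd_base_def)

lemma linear_nbhd_baseD:
  assumes "linear_nbhd_base s M \<B>" "V \<in> \<B>"
  shows "V \<subseteq> M" "0 \<in> V" "x \<in> V \<Longrightarrow> y \<in> V \<Longrightarrow> x + y \<in> V"
    "c \<in> bigo_gen 0 \<Longrightarrow> x \<in> V \<Longrightarrow> s c x \<in> V"
    "W \<in> \<B> \<Longrightarrow> \<exists>X\<in>\<B>. X \<subseteq> V \<inter> W"
    "\<exists>W\<in>\<B>. \<forall>x\<in>W. s (deps (- real r)) x \<in> V"
    "x \<in> M \<Longrightarrow> \<exists>r::nat. \<forall>c\<in>bigo_gen (real r). s c x \<in> V"
  using assms by (simp_all add: linear_nbhd_base_def)

definition linear_topology :: "'b::ab_group_add set \<Rightarrow> 'b set set \<Rightarrow> 'b topology" where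
  "linear_topology M \<B> = topology (\<lambda>V. V \<subseteq> M \<and> (\<forall>v\<in>V. \<exists>W\<in>\<B>. \<forall>w\<in>W. v + w \<in> V))"

lemma openin_linear_topology:
  assumes "linear_nbhd_base s M \<B>"
  shows "openin (linear_topology M \<B>) V \<longleftrightarrow> V \<subseteq> M \<and> (\<forall>v\<in>V. \<exists>W\<in>\<B>. \<forall>w\<in>W. v + w \<in> V)"
proof -
  have "istopology (\<lambda>V. V \<subseteq> M \<and> (\<forall>v\<in>V. \<exists>W\<in>\<B>. \<forall>w\<in>W. v + w \<in> V))"
    unfolding istopology_def
  proof (intro conjI allI impI)
    fix S T assume S: "S \<subseteq> M \<and> (\<forall>v\<in>S. \<exists>W\<in>\<B>. \<forall>w\<in>W. v + w \<in> S)"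
      and T: "T \<subseteq> M \<and> (\<forall>v\<in>T. \<exists>W\<in>\<B>. \<forall>w\<in>W. v + w \<in> T)"
    show "S \<inter> T \<subseteq> M" using S by blast
    show "\<forall>v\<in>S \<inter> T. \<exists>W\<in>\<B>. \<forall>w\<in>W. v + w \<in> S \<inter> T"
    proof
      fix v assume "v \<in> S \<inter> T"
      then obtain A B where "A \<in> \<B>" "B \<in> \<B>" "\<forall>w\<in>A. v + w \<in> S" "\<forall>w\<in>B. v + w \<in> T"
        using S T by blast
      moreover from linear_nbhd_baseD(5)[OF assms this(1,2)] obtain X where "X \<in> \<B>" "X \<subseteq> A \<inter> B"
        by blast
      ultimately show "\<exists>W\<in>\<B>. \<forall>w\<in>W. v + w \<in> S \<inter> T" by blast
    qed
  next
    fix \<K> assume K: "\<forall>V\<in>\<K>. V \<subseteq> M \<and> (\<forall>v\<in>V. \<exists>W\<in>\<B>. \<forall>w\<in>W. v + w \<in> V)"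
    show "\<Union>\<K> \<subseteq> M" using K by blast
    show "\<forall>v\<in>\<Union>\<K>. \<exists>W\<in>\<B>. \<forall>w\<in>W. v + w \<in> \<Union>\<K>"
    proof
      fix v assume "v \<in> \<Union>\<K>"
      then obtain V where V: "V \<in> \<K>" "v \<in> V" by blast
      with K obtain W where "W \<in> \<B>" "\<forall>w\<in>W. v + w \<in> V" by blast
      with V(1) show "\<exists>W\<in>\<B>. \<forall>w\<in>W. v + w \<in> \<Union>\<K>" by blast
    qed
  qed
  then show ?thesis unfolding linear_topology_def by (simp add: topology_inverse')
qed

lemma one_bigo_gen: "(1 :: real gen) \<in> bigo_gen 0"
  using deps_bigo_gen[of 0] by (simp add: deps_zero)

lemma openin_linear_topology_coset:
  assumes B: "linear_nbhd_base s M \<B>" and M: "module s" "module.subspace s M" and W: "W \<in> \<B>"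
  shows "openin (linear_topology M \<B>) {z \<in> M. z - x \<in> W}"
  unfolding openin_linear_topology[OF B]
proof (intro conjI ballI)
  fix v assume v: "v \<in> {z \<in> M. z - x \<in> W}"
  interpret module s by fact
  have "v + w \<in> {z \<in> M. z - x \<in> W}" if w: "w \<in> W" for w
  proof -
    have "w \<in> M" "(v - x) + w \<in> W"
      using linear_nbhd_baseD(1)[OF B W] linear_nbhd_baseD(3)[OF B W _ w] w v by auto
    then show ?thesis using v subspace_add[OF M(2)] by (simp add: algebra_simps)
  qed
  with W show "\<exists>W'\<in>\<B>. \<forall>w\<in>W'. v + w \<in> {z \<in> M. z - x \<in> W}" by blast
qed auto

text \<open>In d = (d \<epsilon>^r) \<epsilon>^(-r) the first factor is bounded. Stability under
  \<open>bigo_gen 0\<close> and the single dilation by \<open>deps (- r)\<close> therefore control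
  all scalars of order -r.\<close>

lemma bigo_gen_scale_decomp:
  assumes "module s" "d \<in> bigo_gen (- real r)"
  shows "\<exists>c\<in>bigo_gen 0. \<forall>x. s d x = s c (s (deps (- real r)) x)"
proof -
  interpret module s by fact
  have "d * deps (real r) \<in> bigo_gen (- real r + real r)"
    by (rule bigo_gen_mult[OF assms(2) deps_bigo_gen])
  moreover have "s d x = s (d * deps (real r)) (s (deps (- real r)) x)" for x
    by (simp add: mult.assoc deps_add deps_zero)
  ultimately show ?thesis by auto
qed

lemma locally_convex_linear_topology:
  assumes B: "linear_nbhd_base s M \<B>" and M: "module s" "module.subspace s M"
  shows "locally_convex_gmodule s M (linear_topology M \<B>)"
proof -
  interpret module s by fact
  let ?T = "linear_topology M \<B>"
  note op = openin_linear_topology[OF B]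
  have sub: "V \<subseteq> M" and zero: "0 \<in> V" and add: "x \<in> V \<Longrightarrow> y \<in> V \<Longrightarrow> x + y \<in> V"
    and scl: "c \<in> bigo_gen 0 \<Longrightarrow> x \<in> V \<Longrightarrow> s c x \<in> V" if "V \<in> \<B>" for V x y c
    by (fact linear_nbhd_baseD(1-4)[OF B that])+
  note coset = openin_linear_topology_coset[OF B M]
  have "openin ?T M"
    unfolding op
  proof (intro conjI ballI order_refl)
    fix v assume v: "v \<in> M"
    obtain W where W: "W \<in> \<B>" using B by (auto simp: linear_nbhd_base_def)
    have "\<forall>w\<in>W. v + w \<in> M" using sub[OF W] subspace_add[OF M(2) v] by blast
    with W show "\<exists>W\<in>\<B>. \<forall>w\<in>W. v + w \<in> M" by blast
  qed
  then have "M \<subseteq> topspace ?T" by (rule openin_subset)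
  moreover have "topspace ?T \<subseteq> M" using openin_topspace[of ?T] unfolding op by (rule conjunct1)
  ultimately have top: "topspace ?T = M" by (rule subset_antisym[rotated])
  have cont_add: "continuous_map (prod_topology ?T ?T) ?T (\<lambda>(x, y). x + y)"
    unfolding continuous_map_def
  proof (intro conjI allI impI)
    show "(\<lambda>(x, y). x + y) \<in> topspace (prod_topology ?T ?T) \<rightarrow> topspace ?T"
      using subspace_add[OF M(2)] by (auto simp: top)
    fix V assume V: "openin ?T V"
    show "openin (prod_topology ?T ?T) {p \<in> topspace (prod_topology ?T ?T). (case p of (x, y) \<Rightarrow> x + y) \<in> V}"
      unfolding openin_prod_topology_alt
    proof (intro allI impI)
      fix x y assume "(x, y) \<in> {p \<in> topspace (prod_topology ?T ?T). (case p of (x, y) \<Rightarrow> x + y) \<in> V}"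
      then have xy: "x \<in> M" "y \<in> M" "x + y \<in> V" by (auto simp: top)
      then obtain W where W: "W \<in> \<B>" "\<forall>w\<in>W. x + y + w \<in> V" using V op by blast
      have "z + z' \<in> V" if "z - x \<in> W" "z' - y \<in> W" for z z'
      proof -
        have "x + y + ((z - x) + (z' - y)) \<in> V" using W add[OF W(1) that] by blast
        then show ?thesis by (simp add: algebra_simps)
      qed
      then show "\<exists>A B. openin ?T A \<and> openin ?T B \<and> x \<in> A \<and> y \<in> B \<and>
          A \<times> B \<subseteq> {p \<in> topspace (prod_topology ?T ?T). (case p of (x, y) \<Rightarrow> x + y) \<in> V}"
        using coset[OF W(1), of x] coset[OF W(1), of y] xy zero[OF W(1)]
        by (intro exI[of _ "{z \<in> M. z - x \<in> W}"] exI[of _ "{z \<in> M. z - y \<in> W}"]) (auto simp: top)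
    qed
  qed
  have cont_scale: "continuous_map (prod_topology euclidean ?T) ?T (\<lambda>(c, x). s c x)"
    unfolding continuous_map_def
  proof (intro conjI allI impI)
    show "(\<lambda>(c, x). s c x) \<in> topspace (prod_topology euclidean ?T) \<rightarrow> topspace ?T"
      using subspace_scale[OF M(2)] by (auto simp: top)
    fix V assume V: "openin ?T V"
    show "openin (prod_topology euclidean ?T) {p \<in> topspace (prod_topology euclidean ?T). (case p of (c, x) \<Rightarrow> s c x) \<in> V}"
      unfolding openin_prod_topology_alt
    proof (intro allI impI)
      fix c x assume "(c, x) \<in> {p \<in> topspace (prod_topology euclidean ?T). (case p of (c, x) \<Rightarrow> s c x) \<in> V}"
      then have cx: "x \<in> M" "s c x \<in> V" by (auto simp: top)
      then obtain W where W: "W \<in> \<B>" "\<forall>w\<in>W. s c x + w \<in> V" using V op by blast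
      obtain r :: nat where r: "c \<in> bigo_gen (- real r)" using bigo_gen_ex by blast
      obtain W' where W': "W' \<in> \<B>" "\<forall>x\<in>W'. s (deps (- real r)) x \<in> W"
        using linear_nbhd_baseD(6)[OF B W(1)] by blast
      obtain r2 :: nat where r2: "\<forall>c\<in>bigo_gen (real r2). s c x \<in> W"
        using linear_nbhd_baseD(7)[OF B W(1) cx(1)] by blast
      \<comment> \<open>Split d z = c x + d (z - x) + (d - c) x. The scalar d has order -r like c,
        so W' takes care of the second term, and r2 was chosen for the third.\<close>
      have "s d z \<in> V" if d: "d - c \<in> bigo_gen (real r2)" and z: "z - x \<in> W'" for d z
      proof -
        have "d - c \<in> bigo_gen (- real r)" by (rule bigo_gen_mono[OF d]) simp
        from bigo_gen_add[OF this r] have "d \<in> bigo_gen (- real r)" by simp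
        then obtain c' where c': "c' \<in> bigo_gen 0" "\<forall>x. s d x = s c' (s (deps (- real r)) x)"
          using bigo_gen_scale_decomp[OF M(1)] by blast
        have "s d (z - x) \<in> W" unfolding c'(2)[rule_format] using W' z scl[OF W(1) c'(1)] by blast
        from add[OF W(1) this] r2 d have "s d (z - x) + s (d - c) x \<in> W" by blast
        then have "s c x + (s d (z - x) + s (d - c) x) \<in> V" using W(2) by blast
        then show ?thesis by (simp add: scale_right_diff_distrib scale_left_diff_distrib)
      qed
      then show "\<exists>A B. openin euclidean A \<and> openin ?T B \<and> c \<in> A \<and> x \<in> B \<and>
          A \<times> B \<subseteq> {p \<in> topspace (prod_topology euclidean ?T). (case p of (c, x) \<Rightarrow> s c x) \<in> V}"
        using coset[OF W'(1), of x] open_gen_coset[of c "real r2"] cx zero[OF W'(1)] bigo_gen_0[of "real r2"]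
        by (intro exI[of _ "{d. d - c \<in> bigo_gen (real r2)}"] exI[of _ "{z \<in> M. z - x \<in> W'}"])
          (auto simp: top open_openin[symmetric])
    qed
  qed
  have "\<exists>V\<subseteq>W. gconvex s V \<and> (\<exists>O'. openin ?T O' \<and> 0 \<in> O' \<and> O' \<subseteq> V)" if W: "openin ?T W" "0 \<in> W" for W
  proof -
    obtain V where V: "V \<in> \<B>" "\<forall>w\<in>V. 0 + w \<in> W" using W op by blast
    \<comment> \<open>A member of the base is its own convex neighborhood: it is a subgroup, hence
      open, and d\<epsilon>^b is bounded for b \<ge> 0.\<close>
    have "gconvex s V"
      unfolding gconvex_def using add[OF V(1)] scl[OF V(1)] bigo_gen_mono[OF deps_bigo_gen] by blast
    moreover have "{z \<in> M. z - 0 \<in> V} = V" using sub[OF V(1)] by auto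
    then have "openin ?T V" using coset[OF V(1), of 0] by simp
    ultimately show ?thesis using V zero[OF V(1)] by (intro exI[of _ V]) auto
  qed
  then show ?thesis
    unfolding locally_convex_gmodule_def topological_gmodule_def
    using M top cont_add cont_scale by blast
qed

section \<open>Scaling, translation and balanced neighborhoods in topological modules\<close>

lemma topological_gmodule_scale:
  assumes "topological_gmodule s M T"
  shows "continuous_map T T (s c)" "x \<in> M \<Longrightarrow> continuous_map euclidean T (\<lambda>c. s c x)"
proof -
  have T: "continuous_map (prod_topology euclidean T) T (\<lambda>(c, x). s c x)" "topspace T = M"
    using assms by (auto simp: topological_gmodule_def)
  have "continuous_map T (prod_topology euclidean T) (\<lambda>x. (c, x))"
    by (intro continuous_map_pairedI) (auto simp: continuous_map_id[unfolded id_def])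
  from continuous_map_compose[OF this T(1)] show "continuous_map T T (s c)" by (simp add: o_def)
  assume "x \<in> M"
  then have "continuous_map euclidean (prod_topology euclidean T) (\<lambda>c. (c, x))"
    by (intro continuous_map_pairedI) (auto simp: continuous_map_id[unfolded id_def] T(2))
  from continuous_map_compose[OF this T(1)] show "continuous_map euclidean T (\<lambda>c. s c x)" by (simp add: o_def)
qed

lemma topological_gmodule_translation:
  assumes T: "topological_gmodule s M T" and V: "openin T V" and v: "v \<in> M"
  shows "openin T {x \<in> M. x + v \<in> V}"
proof -
  have *: "continuous_map (prod_topology T T) T (\<lambda>(x, y). x + y)" "topspace T = M"
    using T by (auto simp: topological_gmodule_def)
  have "continuous_map T (prod_topology T T) (\<lambda>x. (x, v))"
    by (intro continuous_map_pairedI) (use v in \<open>auto simp: continuous_map_id[unfolded id_def] *(2)\<close>)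
  from continuous_map_compose[OF this *(1)] have "continuous_map T T (\<lambda>x. x + v)" by (simp add: o_def)
  from openin_continuous_map_preimage[OF this V] show ?thesis by (simp add: *(2))
qed

text \<open>
  Take for \<open>W\<close> the largest balanced subset of a convex neighborhood: since \<open>d\<epsilon>\<^sup>r\<close> is invertible, joint continuity
  of the scalar multiplication at \<open>(0, 0)\<close> shows that \<open>W\<close> is still a neighborhood of \<open>0\<close>.
\<close>

lemma locally_convex_balanced_nbhd:
  assumes T: "locally_convex_gmodule s M T" and V: "openin T V" "0 \<in> V"
  shows "\<exists>W\<subseteq>V. W \<subseteq> M \<and> 0 \<in> W \<and> (\<forall>x\<in>W. \<forall>y\<in>W. x + y \<in> W) \<and> (\<forall>c\<in>bigo_gen 0. \<forall>x\<in>W. s c x \<in> W) \<and>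
    (\<exists>O'. openin T O' \<and> 0 \<in> O' \<and> O' \<subseteq> W)"
proof -
  have tm: "topological_gmodule s M T" using T by (simp add: locally_convex_gmodule_def)
  have M: "module s" "module.subspace s M" "topspace T = M"
    and cs: "continuous_map (prod_topology euclidean T) T (\<lambda>(c, x). s c x)"
    using tm by (auto simp: topological_gmodule_def)
  interpret module s by fact
  obtain V0 O1 where V0: "V0 \<subseteq> V" "gconvex s V0" and O1: "openin T O1" "0 \<in> O1" "O1 \<subseteq> V0"
    using T[unfolded locally_convex_gmodule_def, THEN conjunct2, rule_format, of V] V by blast
  define W where "W = {x \<in> M. \<forall>c\<in>bigo_gen 0. s c x \<in> V0}"
  note pre = openin_continuous_map_preimage[OF cs O1(1)]
  have "(0, 0) \<in> {p \<in> topspace (prod_topology euclidean T). (case p of (c, x) \<Rightarrow> s c x) \<in> O1}"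
    using O1 subspace_0[OF M(2)] by (simp add: M(3))
  from pre[unfolded openin_prod_topology_alt, rule_format, OF this] obtain C O2 where C: "openin euclidean C" "openin T O2" "0 \<in> C" "0 \<in> O2"
    and CO: "C \<times> O2 \<subseteq> {p \<in> topspace (prod_topology euclidean T). (case p of (c, x) \<Rightarrow> s c x) \<in> O1}"
    by (elim exE conjE) (rule that)
  have "open C" using C(1) by (rule open_openin[THEN iffD2])
  from open_gen_ball[OF this C(3)] obtain r :: nat where r: "\<And>c. c \<in> bigo_gen (real r) \<Longrightarrow> c \<in> C"
    by auto
  \<comment> \<open>For bounded c write c x = (c \<epsilon>^r)(\<epsilon>^(-r) x). The scalar c
    \<epsilon>^r lies in C, and for x in O3 the vector \<epsilon>^(-r) x lies in O2, so c x stays in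
    the convex neighborhood V0.\<close>
  define O3 where "O3 = {x \<in> M. s (deps (- real r)) x \<in> O2}"
  have O3: "openin T O3"
    using openin_continuous_map_preimage[OF topological_gmodule_scale(1)[OF tm] C(2)] by (simp add: O3_def M(3))
  have O3_0: "0 \<in> O3" using C(4) subspace_0[OF M(2)] by (simp add: O3_def)
  have O3_W: "O3 \<subseteq> W"
  proof
    fix x assume x: "x \<in> O3"
    have "s c x \<in> V0" if c: "c \<in> bigo_gen 0" for c
    proof -
      have "c * deps (real r) \<in> bigo_gen (real r)" using bigo_gen_mult[OF c deps_bigo_gen[of "real r"]] by simp
      then have "(c * deps (real r), s (deps (- real r)) x) \<in> C \<times> O2" using r x by (simp add: O3_def)
      from subsetD[OF CO this] have "s (c * deps (real r)) (s (deps (- real r)) x) \<in> O1" by simp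
      then show ?thesis using O1(3) by (auto simp: mult.assoc deps_add deps_zero)
    qed
    then show "x \<in> W" using x by (simp add: W_def O3_def)
  qed
  have W_V: "W \<subseteq> V"
  proof
    fix x assume "x \<in> W"
    then have "s 1 x \<in> V0" using one_bigo_gen unfolding W_def by blast
    then show "x \<in> V" using V0(1) by auto
  qed
  have add: "x + y \<in> W" if "x \<in> W" "y \<in> W" for x y
    using that V0(2) subspace_add[OF M(2)] by (auto simp: W_def gconvex_def scale_right_distrib)
  have scl: "s d x \<in> W" if "d \<in> bigo_gen 0" "x \<in> W" for d x
  proof -
    have "c * d \<in> bigo_gen 0" if "c \<in> bigo_gen 0" for c using bigo_gen_mult[OF that \<open>d \<in> bigo_gen 0\<close>] by simp
    then show ?thesis using that subspace_scale[OF M(2)] by (auto simp: W_def)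
  qed
  have W_0: "0 \<in> W" using O1 subspace_0[OF M(2)] by (auto simp: W_def)
  have W_M: "W \<subseteq> M" by (auto simp: W_def)
  have "\<exists>O'. openin T O' \<and> 0 \<in> O' \<and> O' \<subseteq> W" using O3 O3_0 O3_W by (intro exI[of _ O3] conjI)
  with W_V W_M W_0 add scl show ?thesis by (intro exI[of _ W]) simp
qed

text \<open>The absolutely convex neighborhoods of 0 for the inductive limit along inclusions.
  Balanced is taken as stable under \<open>bigo_gen 0\<close>, a ring slightly smaller than the set
  |c|_e \<le> 1, which also contains the class of log(1/\<epsilon>). That the topology obtained is
  the intended one follows from the universal property.\<close>

definition inductive_limit_base ::
  "(real gen \<Rightarrow> 'b::ab_group_add \<Rightarrow> 'b) \<Rightarrow> 'i set \<Rightarrow> ('i \<Rightarrow> 'b topology) \<Rightarrow> 'b set \<Rightarrow> 'b set set" where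
  "inductive_limit_base s \<Gamma> T M = {V. V \<subseteq> M \<and> 0 \<in> V \<and> (\<forall>x\<in>V. \<forall>y\<in>V. x + y \<in> V) \<and>
    (\<forall>c\<in>bigo_gen 0. \<forall>x\<in>V. s c x \<in> V) \<and> (\<forall>\<gamma>\<in>\<Gamma>. \<exists>O'. openin (T \<gamma>) O' \<and> 0 \<in> O' \<and> O' \<subseteq> V)}"

lemma inductive_limit_baseI:
  assumes "V \<subseteq> M" "0 \<in> V" "\<And>x y. x \<in> V \<Longrightarrow> y \<in> V \<Longrightarrow> x + y \<in> V"
    "\<And>c x. c \<in> bigo_gen 0 \<Longrightarrow> x \<in> V \<Longrightarrow> s c x \<in> V"
    "\<And>\<gamma>. \<gamma> \<in> \<Gamma> \<Longrightarrow> \<exists>O'. openin (T \<gamma>) O' \<and> 0 \<in> O' \<and> O' \<subseteq> V"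
  shows "V \<in> inductive_limit_base s \<Gamma> T M"
  using assms by (simp add: inductive_limit_base_def)

lemma inductive_limit_baseD:
  assumes "V \<in> inductive_limit_base s \<Gamma> T M"
  shows "V \<subseteq> M" "0 \<in> V" "x \<in> V \<Longrightarrow> y \<in> V \<Longrightarrow> x + y \<in> V"
    "c \<in> bigo_gen 0 \<Longrightarrow> x \<in> V \<Longrightarrow> s c x \<in> V"
    "\<gamma> \<in> \<Gamma> \<Longrightarrow> \<exists>O'. openin (T \<gamma>) O' \<and> 0 \<in> O' \<and> O' \<subseteq> V"
  using assms by (simp_all add: inductive_limit_base_def)

text \<open>As M is the union of the G \<gamma>, and not merely spanned by them, each x lies in a
  single G \<gamma>. Absorption of x then reduces to continuity of c \<mapsto> c x there.\<close>

lemma inductive_limit_base_linear: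
  assumes M: "module s" "module.subspace s M" "M = (\<Union>\<gamma>\<in>\<Gamma>. G \<gamma>)"
    and G: "\<And>\<gamma>. \<gamma> \<in> \<Gamma> \<Longrightarrow> topological_gmodule s (G \<gamma>) (T \<gamma>)"
  shows "linear_nbhd_base s M (inductive_limit_base s \<Gamma> T M)"
proof -
  interpret module s by fact
  let ?B = "inductive_limit_base s \<Gamma> T M"
  have top: "topspace (T \<gamma>) = G \<gamma>" "module.subspace s (G \<gamma>)" if "\<gamma> \<in> \<Gamma>" for \<gamma>
    using G[OF that] by (auto simp: topological_gmodule_def)
  have "openin (T \<gamma>) (G \<gamma>) \<and> 0 \<in> G \<gamma> \<and> G \<gamma> \<subseteq> M" if "\<gamma> \<in> \<Gamma>" for \<gamma>
    using top[OF that] subspace_0[of "G \<gamma>"] that M(3) openin_topspace[of "T \<gamma>"] by auto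
  then have mem: "M \<in> ?B"
    by (intro inductive_limit_baseI order_refl subspace_0[OF M(2)] subspace_add[OF M(2)] subspace_scale[OF M(2)])
      (assumption | meson)+
  have int: "V \<inter> W \<in> ?B" if "V \<in> ?B" "W \<in> ?B" for V W
  proof -
    have "\<exists>O'. openin (T \<gamma>) O' \<and> 0 \<in> O' \<and> O' \<subseteq> V \<inter> W" if \<gamma>: "\<gamma> \<in> \<Gamma>" for \<gamma>
    proof -
      obtain A B where "openin (T \<gamma>) A" "0 \<in> A" "A \<subseteq> V" "openin (T \<gamma>) B" "0 \<in> B" "B \<subseteq> W"
        using inductive_limit_baseD(5)[OF \<open>V \<in> ?B\<close> \<gamma>] inductive_limit_baseD(5)[OF \<open>W \<in> ?B\<close> \<gamma>] by blast
      then show ?thesis by (intro exI[of _ "A \<inter> B"]) auto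
    qed
    then show ?thesis
      using inductive_limit_baseD(1-4)[OF \<open>V \<in> ?B\<close>] inductive_limit_baseD(1-4)[OF \<open>W \<in> ?B\<close>]
      by (intro inductive_limit_baseI) auto
  qed
  \<comment> \<open>The witness is the preimage of V under the dilation. It is again stable under
    bounded scalars because scalars commute.\<close>
  have dil: "\<exists>W\<in>?B. \<forall>x\<in>W. s (deps (- real r)) x \<in> V" if V: "V \<in> ?B" for V and r :: nat
  proof
    let ?d = "deps (- real r)"
    let ?W = "{x \<in> M. s ?d x \<in> V}"
    have "\<exists>O'. openin (T \<gamma>) O' \<and> 0 \<in> O' \<and> O' \<subseteq> ?W" if \<gamma>: "\<gamma> \<in> \<Gamma>" for \<gamma>
    proof -
      obtain A where A: "openin (T \<gamma>) A" "0 \<in> A" "A \<subseteq> V"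
        using inductive_limit_baseD(5)[OF V \<gamma>] by blast
      have "openin (T \<gamma>) {x \<in> topspace (T \<gamma>). s ?d x \<in> A}"
        by (rule openin_continuous_map_preimage[OF topological_gmodule_scale(1)[OF G[OF \<gamma>]] A(1)])
      moreover have "0 \<in> {x \<in> topspace (T \<gamma>). s ?d x \<in> A}"
        using A top[OF \<gamma>] subspace_0 by auto
      moreover have "{x \<in> topspace (T \<gamma>). s ?d x \<in> A} \<subseteq> ?W" using A(3) top[OF \<gamma>] M(3) \<gamma> by auto
      ultimately show ?thesis by blast
    qed
    moreover have "s ?d (x + y) \<in> V" if "s ?d x \<in> V" "s ?d y \<in> V" for x y
      using inductive_limit_baseD(3)[OF V that] by (simp add: scale_right_distrib)
    moreover have "s ?d (s c x) \<in> V" if "c \<in> bigo_gen 0" "s ?d x \<in> V" for c x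
    proof -
      have "s c (s ?d x) \<in> V" by (rule inductive_limit_baseD(4)[OF V that])
      then show ?thesis by (simp add: mult.commute)
    qed
    moreover have "s ?d 0 \<in> V" using inductive_limit_baseD(2)[OF V] by simp
    ultimately show "?W \<in> ?B"
      using subspace_0[OF M(2)] subspace_add[OF M(2)] subspace_scale[OF M(2)]
      by (intro inductive_limit_baseI) auto
  qed auto
  have abs: "\<exists>r::nat. \<forall>c\<in>bigo_gen (real r). s c x \<in> V" if V: "V \<in> ?B" and x: "x \<in> M" for V x
  proof -
    obtain \<gamma> where \<gamma>: "\<gamma> \<in> \<Gamma>" "x \<in> G \<gamma>" using x M(3) by blast
    obtain A where A: "openin (T \<gamma>) A" "0 \<in> A" "A \<subseteq> V"
      using inductive_limit_baseD(5)[OF V \<gamma>(1)] by blast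
    have "openin euclidean {c \<in> topspace euclidean. s c x \<in> A}"
      by (rule openin_continuous_map_preimage[OF topological_gmodule_scale(2)[OF G[OF \<gamma>(1)] \<gamma>(2)] A(1)])
    then have "open {c \<in> topspace euclidean. s c x \<in> A}" by (rule open_openin[THEN iffD2])
    then have "open {c. s c x \<in> A}" by simp
    moreover have "0 \<in> {c. s c x \<in> A}" using A by simp
    ultimately obtain r :: nat where "\<forall>y. y - 0 \<in> bigo_gen (real r) \<longrightarrow> y \<in> {c. s c x \<in> A}"
      using open_gen_ball by blast
    then show ?thesis using A(3) by (intro exI[of _ r]) auto
  qed
  show ?thesis
    by (rule linear_nbhd_baseI; (fact inductive_limit_baseD dil abs)?) (use mem int in blast)+
qed

text \<open>Finest, because any competing locally convex T' has balanced convex neighborhoods of 0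
  by \<open>locally_convex_balanced_nbhd\<close>. Continuity of the inclusions makes their traces on
  the G \<gamma> neighborhoods of 0, so they belong to the base.\<close>

lemma inductive_limit_topology_exists:
  assumes M: "module s" "module.subspace s M" "M = (\<Union>\<gamma>\<in>\<Gamma>. G \<gamma>)"
    and G: "\<And>\<gamma>. \<gamma> \<in> \<Gamma> \<Longrightarrow> locally_convex_gmodule s (G \<gamma>) (T \<gamma>)"
  shows "is_inductive_limit_topology s s \<Gamma> G T (\<lambda>_ x. x) M (linear_topology M (inductive_limit_base s \<Gamma> T M))"
proof -
  interpret module s by fact
  have tm: "topological_gmodule s (G \<gamma>) (T \<gamma>)" and top: "topspace (T \<gamma>) = G \<gamma>" if "\<gamma> \<in> \<Gamma>" for \<gamma>
    using G[OF that] by (auto simp: locally_convex_gmodule_def topological_gmodule_def)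
  let ?B = "inductive_limit_base s \<Gamma> T M"
  let ?T = "linear_topology M ?B"
  have B: "linear_nbhd_base s M ?B" by (rule inductive_limit_base_linear[OF M tm])
  note op = openin_linear_topology[OF B]
  have lc: "locally_convex_gmodule s M ?T" by (rule locally_convex_linear_topology[OF B M(1,2)])
  then have topT: "topspace ?T = M" by (simp add: locally_convex_gmodule_def topological_gmodule_def)
  have cont: "continuous_map (T \<gamma>) ?T (\<lambda>x. x)" if \<gamma>: "\<gamma> \<in> \<Gamma>" for \<gamma>
    unfolding continuous_map_def
  proof (intro conjI allI impI)
    show "(\<lambda>x. x) \<in> topspace (T \<gamma>) \<rightarrow> topspace ?T" using M(3) \<gamma> unfolding top[OF \<gamma>] topT by blast
    fix V assume V: "openin ?T V"
    show "openin (T \<gamma>) {x \<in> topspace (T \<gamma>). x \<in> V}"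
      unfolding openin_subopen[of _ "{x \<in> topspace (T \<gamma>). x \<in> V}"]
    proof
      fix v assume v: "v \<in> {x \<in> topspace (T \<gamma>). x \<in> V}"
      have sub: "module.subspace s (G \<gamma>)" using tm[OF \<gamma>] by (simp add: topological_gmodule_def)
      obtain W where W: "W \<in> ?B" "\<forall>w\<in>W. v + w \<in> V" using V v op by blast
      obtain A where A: "openin (T \<gamma>) A" "0 \<in> A" "A \<subseteq> W"
        using inductive_limit_baseD(5)[OF W(1) \<gamma>] by blast
      have "- v \<in> G \<gamma>" using v sub subspace_neg by (simp add: top[OF \<gamma>])
      from topological_gmodule_translation[OF tm[OF \<gamma>] A(1) this]
      have "openin (T \<gamma>) {x \<in> G \<gamma>. x + - v \<in> A}" .
      moreover have "x \<in> V" if "x + - v \<in> A" for x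
      proof -
        have "v + (x + - v) \<in> V" using W(2) A(3) that by blast
        then show ?thesis by simp
      qed
      ultimately show "\<exists>A. openin (T \<gamma>) A \<and> v \<in> A \<and> A \<subseteq> {x \<in> topspace (T \<gamma>). x \<in> V}"
        using A(2) v by (intro exI[of _ "{x \<in> G \<gamma>. x + - v \<in> A}"]) (auto simp: top[OF \<gamma>])
    qed
  qed
  have finest: "openin ?T V" if T': "locally_convex_gmodule s M T'" "\<And>\<gamma>. \<gamma> \<in> \<Gamma> \<Longrightarrow> continuous_map (T \<gamma>) T' (\<lambda>x. x)"
    and V: "openin T' V" for T' V
    unfolding op
  proof (intro conjI ballI)
    have tm': "topological_gmodule s M T'" using T' by (simp add: locally_convex_gmodule_def)
    then have topT': "topspace T' = M" by (simp add: topological_gmodule_def)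
    show VM: "V \<subseteq> M" using openin_subset[OF V] topT' by simp
    fix v assume v: "v \<in> V"
    have "openin T' {x \<in> M. x + v \<in> V}" by (rule topological_gmodule_translation[OF tm' V]) (use v VM in blast)
    moreover have "0 \<in> {x \<in> M. x + v \<in> V}" using v subspace_0[OF M(2)] by simp
    ultimately have "\<exists>W\<subseteq>{x \<in> M. x + v \<in> V}. W \<subseteq> M \<and> 0 \<in> W \<and> (\<forall>x\<in>W. \<forall>y\<in>W. x + y \<in> W) \<and>
        (\<forall>c\<in>bigo_gen 0. \<forall>x\<in>W. s c x \<in> W) \<and> (\<exists>O'. openin T' O' \<and> 0 \<in> O' \<and> O' \<subseteq> W)"
      by (rule locally_convex_balanced_nbhd[OF T'(1)])
    then obtain W where W: "W \<subseteq> {x \<in> M. x + v \<in> V}" "W \<subseteq> M" "0 \<in> W" "\<forall>x\<in>W. \<forall>y\<in>W. x + y \<in> W"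
        "\<forall>c\<in>bigo_gen 0. \<forall>x\<in>W. s c x \<in> W" "\<exists>O'. openin T' O' \<and> 0 \<in> O' \<and> O' \<subseteq> W"
      by (elim exE[where P = "\<lambda>W. W \<subseteq> _ \<and> _ W"] conjE) (rule that)
    obtain A where A: "openin T' A" "0 \<in> A" "A \<subseteq> W" using W(6) by (elim exE conjE) (rule that)
    have "\<exists>O'. openin (T \<gamma>) O' \<and> 0 \<in> O' \<and> O' \<subseteq> W" if \<gamma>: "\<gamma> \<in> \<Gamma>" for \<gamma>
    proof (intro exI conjI)
      show "openin (T \<gamma>) {x \<in> topspace (T \<gamma>). x \<in> A}"
        by (rule openin_continuous_map_preimage[OF T'(2)[OF \<gamma>] A(1)])
      have "module.subspace s (G \<gamma>)" using tm[OF \<gamma>] by (simp add: topological_gmodule_def)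
      then show "0 \<in> {x \<in> topspace (T \<gamma>). x \<in> A}" using A(2) subspace_0 by (simp add: top[OF \<gamma>])
    qed (use A(3) in blast)
    with W(2-5) have "W \<in> ?B" by (intro inductive_limit_baseI) simp_all
    moreover have "\<forall>w\<in>W. v + w \<in> V" using W(1) by (auto simp: add.commute)
    ultimately show "\<exists>W\<in>?B. \<forall>w\<in>W. v + w \<in> V" by blast
  qed
  have "module.span s (\<Union>\<gamma>\<in>\<Gamma>. (\<lambda>x. x) ` G \<gamma>) = M"
    using M(2,3) span_eq_iff by simp
  then show ?thesis
    unfolding is_inductive_limit_topology_def glinear_on_def
  proof (intro conjI ballI allI impI refl G lc cont)
    assume "module.span s (\<Union>\<gamma>\<in>\<Gamma>. (\<lambda>x. x) ` G \<gamma>) = M"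
    then show "M = module.span s (\<Union>\<gamma>\<in>\<Gamma>. (\<lambda>x. x) ` G \<gamma>)" by (rule sym)
  next
    fix T' V
    assume T': "locally_convex_gmodule s M T' \<and> (\<forall>\<gamma>\<in>\<Gamma>. continuous_map (T \<gamma>) T' (\<lambda>x. x))" "openin T' V"
    then show "openin ?T V" by (intro finest[OF conjunct1[OF T'(1)] _ T'(2)]) blast
  qed
qed

text \<open>Two finest topologies are each finer than the other.\<close>

lemma inductive_limit_topology_unique:
  assumes "is_inductive_limit_topology s s' \<Gamma> G TG i M T" "is_inductive_limit_topology s s' \<Gamma> G TG i M T'"
  shows "T = T'"
proof -
  have "openin Y V" if "is_inductive_limit_topology s s' \<Gamma> G TG i M X"
    "is_inductive_limit_topology s s' \<Gamma> G TG i M Y" "openin X V" for X Y V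
  proof -
    have "locally_convex_gmodule s' M X \<and> (\<forall>\<gamma>\<in>\<Gamma>. continuous_map (TG \<gamma>) X (i \<gamma>))"
      using that(1) unfolding is_inductive_limit_topology_def by (elim conjE) (rule conjI)
    moreover have "\<forall>T'. locally_convex_gmodule s' M T' \<and> (\<forall>\<gamma>\<in>\<Gamma>. continuous_map (TG \<gamma>) T' (i \<gamma>)) \<longrightarrow>
        (\<forall>V. openin T' V \<longrightarrow> openin Y V)"
      using that(2) unfolding is_inductive_limit_topology_def by (elim conjE)
    ultimately show ?thesis using that(3) by blast
  qed
  from this[OF assms] this[OF assms(2,1)] show ?thesis unfolding topology_eq by blast
qed

section \<open>The module of compactly supported functions\<close>

lemma module_fscale: "module fscale"
  by unfold_locales (simp_all add: fscale_def fun_eq_iff algebra_simps)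

lemma GD_on_add_scale:
  fixes f g :: "(real ^ 'n) gen \<Rightarrow> real gen"
  assumes U: "U = strongly_internal_set Ue" and f: "f \<in> GD_on U K" and g: "g \<in> GD_on U K"
  shows "f + g \<in> GD_on U K" "fscale c f \<in> GD_on U K"
    "x \<in> U \<Longrightarrow> gderiv U \<alpha> (f + g) x = gderiv U \<alpha> f x + gderiv U \<alpha> g x"
    "x \<in> U \<Longrightarrow> gderiv U \<alpha> (fscale c f) x = c * gderiv U \<alpha> f x"
proof -
  have eq: "f + g = (\<lambda>x. 1 * f x + 1 * g x)" "fscale c f = (\<lambda>x. c * f x + 0 * f x)"
    by (simp_all add: fun_eq_iff fscale_def)
  show "f + g \<in> GD_on U K" "fscale c f \<in> GD_on U K" unfolding eq by (intro GD_on_lincomb[OF U] f g)+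
  show "gderiv U \<alpha> (f + g) x = gderiv U \<alpha> f x + gderiv U \<alpha> g x" if "x \<in> U"
    unfolding eq GD_on_lincomb(2)[OF U f g that] by simp
  show "gderiv U \<alpha> (fscale c f) x = c * gderiv U \<alpha> f x" if "x \<in> U"
    unfolding eq GD_on_lincomb(2)[OF U f f that] by simp
qed

lemma subspace_GD_on:
  fixes U :: "(real ^ 'n) gen set"
  assumes "U = strongly_internal_set Ue"
  shows "module.subspace fscale (GD_on U K)"
  unfolding module.subspace_def[OF module_fscale]
  using GD_on_zero GD_on_add_scale(1,2)[OF assms] by blast

definition GD_base :: "(real ^ 'n) gen set \<Rightarrow> (real ^ 'n) gen set \<Rightarrow> ((real ^ 'n) gen \<Rightarrow> real gen) set set" where
  "GD_base U K = range (\<lambda>k. GD_on U K \<inter> GD_nbhd U k)"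

lemma GD_baseI: "GD_on U K \<inter> GD_nbhd U k \<in> GD_base U K"
  by (simp add: GD_base_def)

lemma GD_nbhd_antimono: "k \<le> l \<Longrightarrow> GD_nbhd U l \<subseteq> GD_nbhd U k"
  unfolding GD_nbhd_def by (auto intro!: bigo_gen_mono[where r = "real k" and q = "real l"])

lemma GD_base_linear:
  fixes U :: "(real ^ 'n) gen set"
  assumes U: "U = strongly_internal_set Ue" and K: "K \<in> fcompacts U"
  shows "linear_nbhd_base fscale (GD_on U K) (GD_base U K)"
proof -
  let ?G = "GD_on U K"
  note lin = GD_on_add_scale[OF U]
  have 1: "0 \<in> ?G \<inter> GD_nbhd U k" for k
  proof -
    have "(0 :: (real ^ 'n) gen \<Rightarrow> real gen) = fscale 0 0" by (simp add: fscale_def fun_eq_iff)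
    then have "gderiv U \<alpha> 0 x = (0 :: real gen)" if "x \<in> U" for \<alpha> x
      using lin(4)[OF GD_on_zero[of U K] GD_on_zero that, of \<alpha> 0] by simp
    then show ?thesis by (simp add: GD_on_zero GD_nbhd_def bigo_gen_0)
  qed
  have 2: "f + g \<in> ?G \<inter> GD_nbhd U k" if "f \<in> ?G \<inter> GD_nbhd U k" "g \<in> ?G \<inter> GD_nbhd U k" for f g k
    using that lin(1,3)[of f K g] by (auto simp: GD_nbhd_def intro: bigo_gen_add)
  \<comment> \<open>Orders add under multiplication. Stability uses (p, q) = (0, k), dilation (-r, k
    + r), and absorption (k + M, -M).\<close>
  have scl: "fscale c f \<in> ?G \<inter> GD_nbhd U k"
    if "f \<in> ?G" "c \<in> bigo_gen p" "\<And>x \<alpha>. x \<in> U \<Longrightarrow> (\<Sum>i\<in>UNIV. \<alpha> i) \<le> k \<Longrightarrow> gderiv U \<alpha> f x \<in> bigo_gen q" "real k \<le> p + q"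
    for f c k p q
    using that(1) lin(2,4)[of f K f] bigo_gen_mono[OF bigo_gen_mult[OF that(2,3)] that(4)]
    by (auto simp: GD_nbhd_def)
  have 3: "fscale c f \<in> ?G \<inter> GD_nbhd U k" if "c \<in> bigo_gen 0" "f \<in> ?G \<inter> GD_nbhd U k" for c f k
    by (rule scl[OF _ that(1), of _ _ "real k"]) (use that in \<open>auto simp: GD_nbhd_def\<close>)
  have 4: "fscale (deps (- real r)) f \<in> ?G \<inter> GD_nbhd U k" if "f \<in> ?G \<inter> GD_nbhd U (k + r)" for r f k
    by (rule scl[OF _ deps_bigo_gen, of _ _ "real (k + r)"]) (use that in \<open>auto simp: GD_nbhd_def\<close>)
  have 5: "\<exists>r::nat. \<forall>c\<in>bigo_gen (real r). fscale c f \<in> ?G \<inter> GD_nbhd U k" if f: "f \<in> ?G" for f k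
  proof -
    obtain M :: nat where "\<forall>x\<in>U. \<forall>\<alpha>. (\<Sum>i\<in>UNIV. \<alpha> i) \<le> k \<longrightarrow> gderiv U \<alpha> f x \<in> bigo_gen (- real M)"
      using gderiv_bounded[OF U K f] by blast
    then show ?thesis
      by (intro exI[of _ "k + M"] ballI, intro scl[OF f, of _ "real (k + M)" _ "- real M"]) auto
  qed
  have 6: "?G \<inter> GD_nbhd U (max k l) \<subseteq> (?G \<inter> GD_nbhd U k) \<inter> (?G \<inter> GD_nbhd U l)" for k l
    using GD_nbhd_antimono[of k "max k l" U] GD_nbhd_antimono[of l "max k l" U] by auto
  show ?thesis
  proof (rule linear_nbhd_baseI)
    show "GD_base U K \<noteq> {}" by (simp add: GD_base_def)
  next
    fix V assume "V \<in> GD_base U K"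
    then obtain k where V: "V = ?G \<inter> GD_nbhd U k" unfolding GD_base_def by blast
    show "V \<subseteq> ?G" unfolding V by blast
    show "0 \<in> V" unfolding V by (rule 1)
    show "f + g \<in> V" if "f \<in> V" "g \<in> V" for f g using that unfolding V by (rule 2)
    show "fscale c f \<in> V" if "c \<in> bigo_gen 0" "f \<in> V" for c f using that unfolding V by (rule 3)
    show "\<exists>r::nat. \<forall>c\<in>bigo_gen (real r). fscale c f \<in> V" if "f \<in> ?G" for f using that unfolding V by (rule 5)
    show "\<exists>W\<in>GD_base U K. \<forall>f\<in>W. fscale (deps (- real r)) f \<in> V" for r
      by (rule bexI[OF _ GD_baseI[of U K "k + r"]], rule ballI) (unfold V, rule 4)
    fix W assume "W \<in> GD_base U K"
    then obtain l where W: "W = ?G \<inter> GD_nbhd U l" unfolding GD_base_def by blast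
    show "\<exists>X\<in>GD_base U K. X \<subseteq> V \<inter> W"
      unfolding V W by (rule bexI[OF _ GD_baseI[of U K "max k l"]]) (rule 6)
  qed
qed

text \<open>Translated to 0, this is the comparison of seminorm balls with \<open>GD_nbhd\<close>.
  It also shows that the seminorm condition does define a topology, as linear topologies do.\<close>

lemma GD_on_topology_eq:
  fixes U :: "(real ^ 'n) gen set"
  assumes U: "U = strongly_internal_set Ue" and K: "K \<in> fcompacts U"
  shows "GD_on_topology U K = linear_topology (GD_on U K) (GD_base U K)"
  unfolding GD_on_topology_def linear_topology_def
proof (rule arg_cong[where f = topology], rule ext, rule conj_cong[OF refl], rule ball_cong[OF refl])
  fix V v assume V: "V \<subseteq> GD_on U K" and v: "v \<in> V"
  interpret module fscale by (rule module_fscale)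
  have vG: "v \<in> GD_on U K" using V v by blast
  note sub = subspace_GD_on[OF U, of K]
  show "(\<exists>m \<rho>. 0 < \<rho> \<and> {g \<in> GD_on U K. GD_norm U K m (g - v) < \<rho>} \<subseteq> V) \<longleftrightarrow> (\<exists>W\<in>GD_base U K. \<forall>w\<in>W. v + w \<in> V)"
  proof
    assume "\<exists>m \<rho>. 0 < \<rho> \<and> {g \<in> GD_on U K. GD_norm U K m (g - v) < \<rho>} \<subseteq> V"
    then obtain m \<rho> where \<rho>: "0 < \<rho>" "{g \<in> GD_on U K. GD_norm U K m (g - v) < \<rho>} \<subseteq> V" by blast
    obtain k where k: "\<forall>f\<in>GD_on U K \<inter> GD_nbhd U k. GD_norm U K m f < \<rho>"
      using GD_norm_less_if_nbhd[OF U K \<rho>(1)] by blast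
    have "v + w \<in> V" if "w \<in> GD_on U K \<inter> GD_nbhd U k" for w
    proof -
      have "v + w \<in> GD_on U K" using that vG subspace_add[OF sub] by blast
      moreover have "GD_norm U K m ((v + w) - v) < \<rho>" using that k by simp
      ultimately show ?thesis using \<rho>(2) by blast
    qed
    then show "\<exists>W\<in>GD_base U K. \<forall>w\<in>W. v + w \<in> V" unfolding GD_base_def by blast
  next
    assume "\<exists>W\<in>GD_base U K. \<forall>w\<in>W. v + w \<in> V"
    then obtain k where k: "\<And>w. w \<in> GD_on U K \<Longrightarrow> w \<in> GD_nbhd U k \<Longrightarrow> v + w \<in> V"
      unfolding GD_base_def by blast
    have "g \<in> V" if g: "g \<in> GD_on U K" "GD_norm U K k (g - v) < deps (real k)" for g
    proof -
      have "g - v \<in> GD_on U K" using g vG subspace_diff[OF sub] by blast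
      from k[OF this GD_norm_less_imp_nbhd[OF U K this g(2)]] show ?thesis by simp
    qed
    then show "\<exists>m \<rho>. 0 < \<rho> \<and> {g \<in> GD_on U K. GD_norm U K m (g - v) < \<rho>} \<subseteq> V"
      using deps_pos[of "real k"] by blast
  qed
qed

lemma locally_convex_GD_on:
  fixes U :: "(real ^ 'n) gen set"
  assumes U: "U = strongly_internal_set Ue" and K: "K \<in> fcompacts U"
  shows "locally_convex_gmodule fscale (GD_on U K) (GD_on_topology U K)"
  unfolding GD_on_topology_eq[OF U K]
  by (rule locally_convex_linear_topology[OF GD_base_linear[OF U K] module_fscale subspace_GD_on[OF U]])

lemma GD_on_topology_subtopology:
  fixes U :: "(real ^ 'n) gen set"
  assumes U: "U = strongly_internal_set Ue" and K: "K \<in> fcompacts U" and L: "L \<in> fcompacts U" and "K \<subseteq> L"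
  shows "GD_on_topology U K = subtopology (GD_on_topology U L) (GD_on U K)"
  unfolding topology_eq openin_subtopology GD_on_topology_eq[OF U K] GD_on_topology_eq[OF U L]
    openin_linear_topology[OF GD_base_linear[OF U K]] openin_linear_topology[OF GD_base_linear[OF U L]]
proof (intro allI iffI)
  interpret module fscale by (rule module_fscale)
  have KL: "GD_on U K \<subseteq> GD_on U L" by (rule GD_on_mono[OF \<open>K \<subseteq> L\<close>])
  {
    fix V assume V: "V \<subseteq> GD_on U K \<and> (\<forall>v\<in>V. \<exists>W\<in>GD_base U K. \<forall>w\<in>W. v + w \<in> V)"
    \<comment> \<open>The union of the cosets v + \<open>GD_nbhd U k\<close> in the larger module,
      with k chosen for v so that the part of the coset in the smaller module lies in V.
      Independence of \<open>GD_nbhd\<close> from the compact set keeps the trace equal to V, and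
      its additivity on the larger module makes V' open.\<close>
    define V' where "V' = {x \<in> GD_on U L. \<exists>v\<in>V. \<exists>k. x - v \<in> GD_nbhd U k \<and> (\<forall>w\<in>GD_on U K \<inter> GD_nbhd U k. v + w \<in> V)}"
    have "V = V' \<inter> GD_on U K"
    proof (intro set_eqI iffI)
      fix v assume v: "v \<in> V"
      then obtain k where "\<forall>w\<in>GD_on U K \<inter> GD_nbhd U k. v + w \<in> V" using V unfolding GD_base_def by blast
      moreover have "v - v \<in> GD_nbhd U k"
        using linear_nbhd_baseD(2)[OF GD_base_linear[OF U K] GD_baseI, of k] by simp
      ultimately show "v \<in> V' \<inter> GD_on U K" using v V KL unfolding V'_def by blast
    next
      fix x assume x: "x \<in> V' \<inter> GD_on U K"
      then obtain v k where v: "v \<in> V" "x - v \<in> GD_nbhd U k" "\<forall>w\<in>GD_on U K \<inter> GD_nbhd U k. v + w \<in> V"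
        unfolding V'_def by blast
      have "x - v \<in> GD_on U K" using x v(1) V subspace_diff[OF subspace_GD_on[OF U]] by blast
      with v have "v + (x - v) \<in> V" by blast
      then show "x \<in> V" by simp
    qed
    moreover have "\<exists>W\<in>GD_base U L. \<forall>w\<in>W. x + w \<in> V'" if x: "x \<in> V'" for x
    proof -
      obtain v k where v: "x \<in> GD_on U L" "v \<in> V" "x - v \<in> GD_nbhd U k" "\<forall>w\<in>GD_on U K \<inter> GD_nbhd U k. v + w \<in> V"
        using x unfolding V'_def by blast
      have "x + w \<in> V'" if w: "w \<in> GD_on U L \<inter> GD_nbhd U k" for w
      proof -
        have "x - v \<in> GD_on U L" using v V KL subspace_diff[OF subspace_GD_on[OF U]] by blast
        then have "(x - v) + w \<in> GD_nbhd U k"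
          using linear_nbhd_baseD(3)[OF GD_base_linear[OF U L] GD_baseI, of "x - v" k w] v(3) w by blast
        moreover have "(x - v) + w = (x + w) - v" by simp
        moreover have "x + w \<in> GD_on U L" using v(1) w subspace_add[OF subspace_GD_on[OF U]] by blast
        ultimately show ?thesis using v(2,4) unfolding V'_def by auto
      qed
      then show ?thesis unfolding GD_base_def by blast
    qed
    moreover have "V' \<subseteq> GD_on U L" unfolding V'_def by blast
    ultimately show "\<exists>T. (T \<subseteq> GD_on U L \<and> (\<forall>v\<in>T. \<exists>W\<in>GD_base U L. \<forall>w\<in>W. v + w \<in> T)) \<and> V = T \<inter> GD_on U K"
      by blast
  next
    fix V assume "\<exists>T. (T \<subseteq> GD_on U L \<and> (\<forall>v\<in>T. \<exists>W\<in>GD_base U L. \<forall>w\<in>W. v + w \<in> T)) \<and> V = T \<inter> GD_on U K"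
    then obtain T where T: "T \<subseteq> GD_on U L" "\<forall>v\<in>T. \<exists>W\<in>GD_base U L. \<forall>w\<in>W. v + w \<in> T" "V = T \<inter> GD_on U K"
      by blast
    have "\<exists>W\<in>GD_base U K. \<forall>w\<in>W. v + w \<in> V" if v: "v \<in> V" for v
    proof -
      obtain k where k: "\<forall>w\<in>GD_on U L \<inter> GD_nbhd U k. v + w \<in> T" using T v unfolding GD_base_def by blast
      have "v + w \<in> V" if w: "w \<in> GD_on U K \<inter> GD_nbhd U k" for w
        using k w KL T(3) v subspace_add[OF subspace_GD_on[OF U]] by blast
      then show ?thesis unfolding GD_base_def by blast
    qed
    with T(3) show "V \<subseteq> GD_on U K \<and> (\<forall>v\<in>V. \<exists>W\<in>GD_base U K. \<forall>w\<in>W. v + w \<in> V)" by blast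
  }
qed

text \<open>Only the existence of the limit topology makes the definite description in \<^const>\<open>GD_topology\<close> meaningful.\<close>

lemma GD_topology_inductive_limit:
  fixes U :: "(real ^ 'n) gen set"
  assumes U: "U = strongly_internal_set Ue" and "module.subspace fscale (GD U)"
  shows "is_inductive_limit_topology fscale fscale (fcompacts U) (GD_on U) (GD_on_topology U) (\<lambda>_ f. f) (GD U) (GD_topology U)"
proof -
  have "is_inductive_limit_topology fscale fscale (fcompacts U) (GD_on U) (GD_on_topology U) (\<lambda>_ f. f) (GD U)
      (linear_topology (GD U) (inductive_limit_base fscale (fcompacts U) (GD_on_topology U) (GD U)))"
    by (rule inductive_limit_topology_exists[OF module_fscale assms(2) GD_def locally_convex_GD_on[OF U]])
  from theI[of "is_inductive_limit_topology fscale fscale (fcompacts U) (GD_on U) (GD_on_topology U) (\<lambda>_ f. f) (GD U)",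
      OF this inductive_limit_topology_unique[OF _ this]]
  show ?thesis unfolding GD_topology_def .
qed

lemma GD_strict_inductive_limit:
  fixes U :: "(real ^ 'n) gen set"
  assumes U: "U = strongly_internal_set Ue"
    and K: "\<And>j. N \<le> j \<Longrightarrow> K j \<in> fcompacts U" "\<And>j. N \<le> j \<Longrightarrow> K j \<subseteq> K (Suc j)"
    and cofinal: "\<And>L. L \<in> fcompacts U \<Longrightarrow> \<exists>j\<ge>N. L \<subseteq> K j"
  shows "is_strict_inductive_limit fscale N (\<lambda>j. GD_on U (K j)) (\<lambda>j. GD_on_topology U (K j)) (GD U) (GD_topology U)"
proof -
  interpret module fscale by (rule module_fscale)
  have mono: "K i \<subseteq> K j" if "N \<le> i" "i \<le> j" for i j
    using that(2) by (induction rule: dec_induct) (use K(2) that(1) in \<open>auto dest: order_trans\<close>)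
  have union: "GD U = (\<Union>j\<in>{N..}. GD_on U (K j))"
  proof (intro set_eqI iffI)
    fix f assume "f \<in> GD U"
    then obtain L where L: "L \<in> fcompacts U" "f \<in> GD_on U L" unfolding GD_def by blast
    obtain j where "N \<le> j" "L \<subseteq> K j" using cofinal[OF L(1)] by blast
    with L(2) GD_on_mono[of L "K j" U] show "f \<in> (\<Union>j\<in>{N..}. GD_on U (K j))" by auto
  qed (use K(1) in \<open>auto simp: GD_def\<close>)
  \<comment> \<open>The union is directed: functions with supports in K i and K j both belong to the
    module of the larger index.\<close>
  have "subspace (GD U)"
    unfolding subspace_def
  proof (intro conjI ballI allI)
    show "0 \<in> GD U" unfolding union using GD_on_zero by auto
    fix f g assume "f \<in> GD U" "g \<in> GD U"
    then obtain i j where ij: "N \<le> i" "f \<in> GD_on U (K i)" "N \<le> j" "g \<in> GD_on U (K j)" unfolding union by auto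
    then have "f \<in> GD_on U (K (max i j))" "g \<in> GD_on U (K (max i j))"
      using GD_on_mono[OF mono[of i "max i j"], of U] GD_on_mono[OF mono[of j "max i j"], of U] by auto
    from subspace_add[OF subspace_GD_on[OF U] this] ij show "f + g \<in> GD U" unfolding union
      by (auto intro!: bexI[of _ "max i j"])
  next
    fix c f assume "f \<in> GD U"
    then show "fscale c f \<in> GD U" unfolding union using subspace_scale[OF subspace_GD_on[OF U]] by blast
  qed
  then have lim: "is_inductive_limit_topology fscale fscale (fcompacts U) (GD_on U) (GD_on_topology U) (\<lambda>_ f. f) (GD U) (GD_topology U)"
    by (rule GD_topology_inductive_limit[OF U])
  have lc: "locally_convex_gmodule fscale (GD U) (GD_topology U)"
    and cont: "\<forall>L\<in>fcompacts U. continuous_map (GD_on_topology U L) (GD_topology U) (\<lambda>f. f)"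
    and finest: "\<forall>T'. locally_convex_gmodule fscale (GD U) T' \<and>
      (\<forall>L\<in>fcompacts U. continuous_map (GD_on_topology U L) T' (\<lambda>f. f)) \<longrightarrow>
      (\<forall>V. openin T' V \<longrightarrow> openin (GD_topology U) V)"
    using lim unfolding is_inductive_limit_topology_def by - (elim conjE, assumption)+
  have "is_inductive_limit_topology fscale fscale {N..} (\<lambda>j. GD_on U (K j)) (\<lambda>j. GD_on_topology U (K j)) (\<lambda>_ f. f) (GD U) (GD_topology U)"
    unfolding is_inductive_limit_topology_def
  proof (intro conjI ballI allI impI)
    fix j assume "j \<in> {N..}"
    then have j: "K j \<in> fcompacts U" using K(1) by simp
    show "locally_convex_gmodule fscale (GD_on U (K j)) (GD_on_topology U (K j))"
      by (rule locally_convex_GD_on[OF U j])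
    show "glinear_on fscale fscale (GD_on U (K j)) (\<lambda>f. f)" by (simp add: glinear_on_def)
    show "continuous_map (GD_on_topology U (K j)) (GD_topology U) (\<lambda>f. f)" using cont j by blast
  next
    show "GD U = span (\<Union>j\<in>{N..}. (\<lambda>f. f) ` GD_on U (K j))"
      unfolding image_ident union[symmetric] using span_eq_iff[THEN iffD2, OF \<open>subspace (GD U)\<close>] by (rule sym)
  next
    fix T' V
    assume T': "locally_convex_gmodule fscale (GD U) T' \<and>
        (\<forall>j\<in>{N..}. continuous_map (GD_on_topology U (K j)) T' (\<lambda>f. f))" and V: "openin T' V"
    \<comment> \<open>By cofinality L lies in some K j, and the topology for L is induced from that
      for K j. Continuity along the sequence therefore implies continuity for every L.\<close>
    have "continuous_map (GD_on_topology U L) T' (\<lambda>f. f)" if L: "L \<in> fcompacts U" for L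
    proof -
      obtain j where j: "N \<le> j" "L \<subseteq> K j" using cofinal[OF L] by blast
      show ?thesis
        unfolding GD_on_topology_subtopology[OF U L K(1)[OF j(1)] j(2)]
        by (rule continuous_map_from_subtopology) (use T' j in auto)
    qed
    with finest T' V show "openin (GD_topology U) V" by blast
  qed (rule lc)
  then show ?thesis
    unfolding is_strict_inductive_limit_def
    by (intro conjI allI impI union GD_on_mono[OF K(2)] GD_on_topology_subtopology[OF U K(1) K(1) K(2)]) simp_all
qed

section \<open>The exhausting sequence\<close>

lemma le_set_dist_iff: "ereal c \<le> set_dist x A \<longleftrightarrow> (\<forall>a\<in>A. c \<le> dist x a)"
  unfolding set_dist_def by (simp add: le_INF_iff)

theorem theorem52:
  fixes Ue :: "real \<Rightarrow> (real ^ 'n) set"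
    and U :: "(real ^ 'n) gen set"
    and N :: nat
    and Ke :: "nat \<Rightarrow> real \<Rightarrow> (real ^ 'n) set"
    and K :: "nat \<Rightarrow> (real ^ 'n) gen set"
  assumes "U = strongly_internal_set Ue"
    and "U \<noteq> {}"
    and "\<exists>x\<in>U. \<exists>\<xi>. represents \<xi> x \<and>
          (\<forall>\<^sub>F \<epsilon> in at_right 0. set_dist (\<xi> \<epsilon>) (- Ue \<epsilon>) > ereal (\<epsilon> ^ N) \<and> norm (\<xi> \<epsilon>) \<le> 1 / \<epsilon> ^ N)"
    and "\<And>j \<epsilon>. Ke j \<epsilon> = {x. set_dist x (- Ue \<epsilon>) \<ge> ereal (\<epsilon> ^ j) \<and> norm x \<le> 1 / \<epsilon> ^ j}"
    and "\<And>j. K j = internal_set (Ke j)"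
  shows "(\<forall>j\<ge>N. K j \<subseteq> U \<and> K j \<noteq> {} \<and> functionally_compact (K j)) \<and>
         (\<forall>j\<ge>N. K j \<subseteq> K (j + 1)) \<and>
         U = (\<Union>j\<in>{N..}. K j) \<and>
         (\<forall>L. L \<noteq> {} \<and> functionally_compact L \<and> L \<subseteq> U \<longrightarrow> (\<exists>j\<ge>N. L \<subseteq> K j)) \<and>
         is_strict_inductive_limit fscale N (\<lambda>j. GD_on U (K j)) (\<lambda>j. GD_on_topology U (K j))
           (GD U) (GD_topology U)"
proof -
  note U = assms(1) and K = assms(5)
  have Ke: "x \<in> Ke j \<epsilon> \<longleftrightarrow> (\<forall>a. a \<notin> Ue \<epsilon> \<longrightarrow> \<epsilon> ^ j \<le> dist x a) \<and> norm x \<le> 1 / \<epsilon> ^ j" for j \<epsilon> x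
    unfolding assms(4) by (auto simp: le_set_dist_iff)
  \<comment> \<open>A point at distance at least \<epsilon>^j from the complement stays in
    \<open>Ue\<close> after a move of size \<epsilon>^(j + 1), and a change of representative moves
    it by no more than that for small \<epsilon>.\<close>
  have sub: "K j \<subseteq> U" for j
  proof
    fix x assume "x \<in> K j"
    then obtain \<xi> where \<xi>: "represents \<xi> x" "\<forall>\<^sub>F \<epsilon> in at_right 0. \<xi> \<epsilon> \<in> Ke j \<epsilon>"
      unfolding K internal_set_def by blast
    have "\<forall>\<^sub>F \<epsilon> in at_right 0. \<xi>' \<epsilon> \<in> Ue \<epsilon>" if "represents \<xi>' x" for \<xi>'
    proof -
      have "\<forall>\<^sub>F \<epsilon> in at_right 0. norm (\<xi> \<epsilon> - \<xi>' \<epsilon>) \<le> \<epsilon> ^ Suc j"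
        using represents_negligible[OF \<xi>(1) that] unfolding negligible_net_iff by blast
      with \<xi>(2) eventually_unit_interval show ?thesis
      proof eventually_elim
        case (elim \<epsilon>)
        have "\<epsilon> ^ Suc j < \<epsilon> ^ j" using elim by (intro power_strict_decreasing) auto
        then have "dist (\<xi> \<epsilon>) (\<xi>' \<epsilon>) < \<epsilon> ^ j" using elim unfolding dist_norm by linarith
        then show ?case using elim by (auto simp: Ke not_le[symmetric])
      qed
    qed
    then show "x \<in> U" unfolding U strongly_internal_set_def by blast
  qed
  have Ke_mono: "Ke i \<epsilon> \<subseteq> Ke j \<epsilon>" if "i \<le> j" "0 < \<epsilon>" "\<epsilon> < 1" for i j \<epsilon>
  proof -
    have "\<epsilon> ^ j \<le> \<epsilon> ^ i" using that by (intro power_decreasing) auto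
    moreover from this have "1 / \<epsilon> ^ i \<le> 1 / \<epsilon> ^ j" using that by (intro divide_left_mono) auto
    ultimately show ?thesis unfolding subset_iff Ke by (meson order_trans)
  qed
  have mono: "K i \<subseteq> K j" if "i \<le> j" for i j
  proof
    fix x assume "x \<in> K i"
    then obtain \<xi> where \<xi>: "represents \<xi> x" "\<forall>\<^sub>F \<epsilon> in at_right 0. \<xi> \<epsilon> \<in> Ke i \<epsilon>"
      unfolding K internal_set_def by blast
    from \<xi>(2) eventually_unit_interval have "\<forall>\<^sub>F \<epsilon> in at_right 0. \<xi> \<epsilon> \<in> Ke j \<epsilon>"
      by eventually_elim (use Ke_mono[OF that] in blast)
    with \<xi>(1) show "x \<in> K j" unfolding K internal_set_def by blast
  qed
  obtain x \<xi> where x: "x \<in> U" "represents \<xi> x"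
    "\<forall>\<^sub>F \<epsilon> in at_right 0. set_dist (\<xi> \<epsilon>) (- Ue \<epsilon>) > ereal (\<epsilon> ^ N) \<and> norm (\<xi> \<epsilon>) \<le> 1 / \<epsilon> ^ N"
    using assms(3) by blast
  \<comment> \<open>The assumption on N gives a point of K N, which monotonicity passes on to all
    later indices.\<close>
  from x(3) have "\<forall>\<^sub>F \<epsilon> in at_right 0. \<xi> \<epsilon> \<in> Ke N \<epsilon>" unfolding assms(4) by eventually_elim auto
  with x(2) have "x \<in> K N" unfolding K internal_set_def by blast
  then have ne: "K j \<noteq> {}" if "N \<le> j" for j using mono[OF that] by blast
  have fc: "functionally_compact (K j)" for j
    unfolding functionally_compact_def
  proof (intro exI[of _ "Ke j"] conjI ballI K)
    fix \<epsilon> :: real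
    \<comment> \<open>The first set is an intersection of closed sets indexed by the complement of
      \<open>Ue\<close>. If the complement is empty it is the whole space, in accordance with an
      infinite \<open>set_dist\<close>.\<close>
    have eq: "Ke j \<epsilon> = {x. \<forall>a\<in>- Ue \<epsilon>. \<epsilon> ^ j \<le> dist x a} \<inter> cball 0 (1 / \<epsilon> ^ j)" by (auto simp: Ke)
    have "closed {x. \<forall>a\<in>- Ue \<epsilon>. \<epsilon> ^ j \<le> dist x a}"
      unfolding Collect_ball_eq by (intro closed_INT ballI closed_Collect_le continuous_intros)
    then show "compact (Ke j \<epsilon>)" unfolding eq by (intro closed_Int_compact compact_cball)
  next
    show "\<exists>M>0. \<forall>\<^sub>F \<epsilon> in at_right 0. \<forall>x\<in>Ke j \<epsilon>. norm x \<le> \<epsilon> powr (- M)"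
    \<comment> \<open>With Suc j the exponent stays positive even for j = 0.\<close>
    proof (intro exI[of _ "real (Suc j)"] conjI)
      show "\<forall>\<^sub>F \<epsilon> in at_right 0. \<forall>x\<in>Ke j \<epsilon>. norm x \<le> \<epsilon> powr (- real (Suc j))"
        using eventually_unit_interval
      proof eventually_elim
        case (elim \<epsilon>)
        have "1 / \<epsilon> ^ j \<le> 1 / \<epsilon> ^ Suc j"
          using elim power_decreasing[of j "Suc j" \<epsilon>] by (intro divide_left_mono) auto
        also have "\<dots> = \<epsilon> powr (- real (Suc j))"
          using elim by (simp only: powr_minus powr_realpow inverse_eq_divide)
        finally show ?case by (auto simp: Ke intro: order_trans)
      qed
    qed simp
  qed
  have cofinal: "\<exists>j\<ge>N. internal_set Le \<subseteq> K j"
    if Le: "internal_set Le \<noteq> {}" "internal_set Le \<subseteq> U" "\<forall>\<^sub>F \<epsilon> in at_right 0. \<forall>x\<in>Le \<epsilon>. norm x \<le> \<epsilon> powr (- M)" for Le M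
  proof -
    obtain m :: nat where m: "\<forall>\<^sub>F \<epsilon> in at_right 0. \<forall>x\<in>Le \<epsilon>. \<forall>a. a \<notin> Ue \<epsilon> \<longrightarrow> \<epsilon> ^ m \<le> dist x a"
      using dist_complement_lower_bound[OF Le(2)[unfolded U] Le(1,3)] by blast
    \<comment> \<open>N makes the index admissible, m comes from the distance to the complement, and
      the ceiling of M turns the norm bound into \<epsilon>^(-j).\<close>
    define j where "j = max N (max m (nat \<lceil>M\<rceil>))"
    have Le_Ke: "\<forall>\<^sub>F \<epsilon> in at_right 0. Le \<epsilon> \<subseteq> Ke j \<epsilon>"
      using m Le(3) eventually_unit_interval
    proof eventually_elim
      case (elim \<epsilon>)
      have "\<epsilon> powr (- M) \<le> \<epsilon> powr (- real j)"
        using elim real_nat_ceiling_ge[of M] by (intro powr_mono') (auto simp: j_def)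
      also have "\<dots> = 1 / \<epsilon> ^ j" using elim by (simp only: powr_minus powr_realpow inverse_eq_divide)
      finally have "\<epsilon> powr (- M) \<le> 1 / \<epsilon> ^ j" .
      moreover have "\<epsilon> ^ j \<le> \<epsilon> ^ m" using elim by (intro power_decreasing) (auto simp: j_def)
      ultimately show ?case using elim unfolding subset_iff Ke by (meson order_trans)
    qed
    have "internal_set Le \<subseteq> K j"
    proof
      fix x assume "x \<in> internal_set Le"
      then obtain \<xi> where \<xi>: "represents \<xi> x" "\<forall>\<^sub>F \<epsilon> in at_right 0. \<xi> \<epsilon> \<in> Le \<epsilon>"
        unfolding internal_set_def by blast
      from \<xi>(2) Le_Ke have "\<forall>\<^sub>F \<epsilon> in at_right 0. \<xi> \<epsilon> \<in> Ke j \<epsilon>" by eventually_elim blast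
      with \<xi>(1) show "x \<in> K j" unfolding K internal_set_def by blast
    qed
    then show ?thesis by (intro exI[of _ j]) (auto simp: j_def)
  qed
  have iv: "\<exists>j\<ge>N. L \<subseteq> K j" if "L \<noteq> {}" "functionally_compact L" "L \<subseteq> U" for L
  proof -
    obtain Le M where "L = internal_set Le" "\<forall>\<^sub>F \<epsilon> in at_right 0. \<forall>x\<in>Le \<epsilon>. norm x \<le> \<epsilon> powr (- M)"
      using \<open>functionally_compact L\<close> unfolding functionally_compact_def by blast
    with cofinal[of Le M] that show ?thesis by blast
  qed
  have "U \<subseteq> (\<Union>j\<in>{N..}. K j)"
  proof
    fix y assume y: "y \<in> U"
    obtain \<eta> where \<eta>: "represents \<eta> y" by (meson represents_rep)
    then obtain M :: nat where M: "\<forall>\<^sub>F \<epsilon> in at_right 0. norm (\<eta> \<epsilon>) \<le> \<epsilon> powr (- real M)"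
      using represents_moderate moderate_iff by blast
    have "\<exists>j\<ge>N. internal_set (\<lambda>\<epsilon>. {\<eta> \<epsilon>}) \<subseteq> K j"
      by (rule cofinal[of _ "real M"]) (use M y in \<open>simp_all add: internal_set_singleton[OF \<eta>]\<close>)
    then show "y \<in> (\<Union>j\<in>{N..}. K j)" by (auto simp: internal_set_singleton[OF \<eta>])
  qed
  then have union: "U = (\<Union>j\<in>{N..}. K j)" using sub by blast
  have "is_strict_inductive_limit fscale N (\<lambda>j. GD_on U (K j)) (\<lambda>j. GD_on_topology U (K j)) (GD U) (GD_topology U)"
    by (rule GD_strict_inductive_limit[OF U])
      (use sub ne fc mono iv in \<open>auto simp: fcompacts_def\<close>)
  then show ?thesis using sub ne fc mono union iv by (intro conjI) auto
qed

end
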